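(* Let $a,b>0$, $\Omega=(0,2a)\times(0,2b)\subseteq\mathbb R^2$, and $p=(a,b)$. Consider the set of eigenvalues $$E_{s,t}=\pi^2\left(\frac{(s+\frac12)^2}{a^2}+\frac{(t+\frac12)^2}{b^2}\right),\qquad s,t=0,1,2,\ldots$$ of the Dirichlet operator $-\Delta$ on $\Omega$, written in increasing order as $E_1<E_2<\cdots$, with corresponding eigenfunctions $\Phi_j$. Assume that for some $0<q<1/2$ and $1<\rho<2(1-q)$ there exists a sequence $(\epsilon_n)_{n=1}^\infty$, $\epsilon_n\downarrow0$, such that for each $n$ there are four consecutive eigenvalues $E_{\rm a}(n)<E_{\rm b}(n)<E_{\rm c}(n)<E_{\rm d}(n)\ll\epsilon_n^{-\rho}$ from $(E_j)$ satisfying $$E_{\rm c}-E_{\rm b}\ll\epsilon_n,\qquad E_{\rm d}-E_{\rm c}\gg\epsilon_n^{q},\qquad E_{\rm b}-E_{\rm a}\gg\epsilon_n^{q}$$ as $n\to\infty$. Then there exists a subsequence $(j_n)\subseteq\mathbb N$ such that $$\|\phi_{j_n}-\psi_n\|\to0\qquad\text{as }n\to\infty,$$ where $\phi_j$ are (normalised) eigenfunctions of $H_\pi$, and $\psi_n$ are of the form $$\psi_n=\frac1{\sqrt2}\bigl(\Phi_{j_n}+(-1)^{\beta_n}\Phi_{j_n+1}\bigr),$$ where $\beta_n$ can be $0$ or $1$ and depends on the relative signs of $\Phi_{j_n}(p)$ and $\Phi_{j_n+1}(p)$. So the subsequence $(\phi_{j_n})$ converges to a superposition of two consecutive unperturbed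 eigenfunctions of $-\Delta$.
   Context: $\Delta$ is the Dirichlet Laplacian on $\Omega$; $\|\cdot\|$ is the norm of $L^2(\Omega)$. The eigenfunctions of $-\Delta$ are $\frac{1}{\sqrt{ab}}\sin(\frac{n\pi x}{2a})\sin(\frac{m\pi y}{2b})$, $n,m\ge1$; those with $n$ or $m$ even vanish at $p$ and are excluded. The remaining ones, with $n=2s+1$, $m=2t+1$ both odd, have eigenvalue $E_{s,t}$ and value $\frac{1}{\sqrt{ab}}(-1)^{s+t}$ at $p$; these are the eigenfunctions $\Phi_j$. By convention the spectrum is listed as simple: in a degenerate eigenspace an orthonormal basis is chosen in which only one element is nonzero at $p$, and only that element is kept in the list $(\Phi_j)$. The operator $H_\pi$ (rectangular Šeba billiard with a point scatterer at $p$). Let $g_{\pm i}:=\sum_{j\ge1}\frac{\overline{\Phi_j(p)}}{E_j\mp i}\Phi_j\in L^2(\Omega)$, $\mathcal D_p:=\{f\in\mathrm{Dom}(\Delta): f(p)=0\}$, and let $H_0$ be the symmetric operator $f\mapsto-\Delta f$ with domain $\mathcal D_p$. Its deficiency subspaces are spanned by $g_{i}$ and $g_{-i}$, so $\mathrm{Dom}(H_0^* )=\mathcal D_p\oplus\mathrm{span}\{g_i,g_{-i}\}$; every $\psi\in\mathrm{Dom}(H_0^* )$ is uniquely $\psi=\hat\psi+a_+(\psi)g_i+a_-(\psi)g_{-i}$ with $\hat\psi\in\mathcal D_p$, $a_\pm(\psi)\in\mathbb C$, and $H_0^*\psi=H_0\hat\psi+i\,a_+(\psi)g_i-i\,a_-(\psi)g_{-i}$.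 $H_\pi$ is the self-adjoint restriction of $H_0^*$ to $\{\psi\in\mathrm{Dom}(H_0^* ): a_-(\psi)=a_+(\psi)\}$. $f\ll g$ (equivalently $g\gg f$) means that there exists a positive constant $C$ such that $f\le Cg$. *)

theory Defs
  imports "HOL-Analysis.Analysis"
begin

section \<open>The Hilbert space of square-integrable functions\<close>

text \<open>Elements of \<open>L\<^sup>2(\<Omega>)\<close> are represented by functions; equality in the Hilbert space is
  equality almost everywhere on \<open>\<Omega>\<close>. The inner product is antilinear in its first argument.\<close>

type_synonym wavefun = "real \<times> real \<Rightarrow> complex"

definition L2 :: "(real \<times> real) set \<Rightarrow> wavefun set" where
  "L2 \<Omega> = {f \<in> borel_measurable (lebesgue_on \<Omega>).
             integrable (lebesgue_on \<Omega>) (\<lambda>x. (cmod (f x))\<^sup>2)}"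

definition L2_norm :: "(real \<times> real) set \<Rightarrow> wavefun \<Rightarrow> real" where
  "L2_norm \<Omega> f = sqrt (LINT x|lebesgue_on \<Omega>. (cmod (f x))\<^sup>2)"

definition L2_inner :: "(real \<times> real) set \<Rightarrow> wavefun \<Rightarrow> wavefun \<Rightarrow> complex" where
  "L2_inner \<Omega> f g = (LINT x|lebesgue_on \<Omega>. cnj (f x) * g x)"

definition L2_tendsto :: "(real \<times> real) set \<Rightarrow> (nat \<Rightarrow> wavefun) \<Rightarrow> wavefun \<Rightarrow> bool" where
  "L2_tendsto \<Omega> v u \<longleftrightarrow> u \<in> L2 \<Omega> \<and> (\<forall>n. v n \<in> L2 \<Omega>) \<and>
     (\<lambda>n. L2_norm \<Omega> (\<lambda>x. v n x - u x)) \<longlonglongrightarrow> 0"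

section \<open>The Dirichlet Laplacian\<close>

text \<open>\<open>v \<in> C\<^sub>c\<^sup>1(\<Omega>)\<close>, extended by zero to the plane, with partial derivatives \<open>v1\<close> and \<open>v2\<close>.\<close>

definition C1c :: "(real \<times> real) set \<Rightarrow> wavefun \<Rightarrow> wavefun \<Rightarrow> wavefun \<Rightarrow> bool" where
  "C1c \<Omega> v v1 v2 \<longleftrightarrow>
     (\<forall>x y. ((\<lambda>t. v (t, y)) has_vector_derivative v1 (x, y)) (at x)) \<and>
     (\<forall>x y. ((\<lambda>t. v (x, t)) has_vector_derivative v2 (x, y)) (at y)) \<and>
     continuous_on UNIV v1 \<and> continuous_on UNIV v2 \<and>
     (\<exists>K. compact K \<and> K \<subseteq> \<Omega> \<and> (\<forall>z. z \<notin> K \<longrightarrow> v z = 0))"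

text \<open>\<open>u \<in> H\<^sub>0\<^sup>1(\<Omega>)\<close> with weak gradient \<open>(G1, G2)\<close>: \<open>H\<^sub>0\<^sup>1(\<Omega>)\<close> is the closure of \<open>C\<^sub>c\<^sup>1(\<Omega>)\<close>
  in the \<open>H\<^sup>1\<close> norm.\<close>

definition H1_0 :: "(real \<times> real) set \<Rightarrow> wavefun \<Rightarrow> wavefun \<Rightarrow> wavefun \<Rightarrow> bool" where
  "H1_0 \<Omega> u G1 G2 \<longleftrightarrow>
     (\<exists>v v1 v2. (\<forall>n. C1c \<Omega> (v n) (v1 n) (v2 n)) \<and>
        L2_tendsto \<Omega> v u \<and> L2_tendsto \<Omega> v1 G1 \<and> L2_tendsto \<Omega> v2 G2)"

text \<open>Unbounded operators are represented by their graphs: \<open>T u f\<close> says that \<open>u\<close> is in the domain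
  of the operator and that its image is \<open>f\<close>. The following is the graph of \<open>-\<Delta>\<close> on
  \<open>Dom(\<Delta>) = {u \<in> H\<^sub>0\<^sup>1(\<Omega>). \<Delta>u \<in> L\<^sup>2(\<Omega>)}\<close>, with \<open>\<Delta>u\<close> taken in the weak sense.\<close>

definition neg_Laplacian :: "(real \<times> real) set \<Rightarrow> wavefun \<Rightarrow> wavefun \<Rightarrow> bool" where
  "neg_Laplacian \<Omega> u f \<longleftrightarrow> f \<in> L2 \<Omega> \<and>
     (\<exists>G1 G2. H1_0 \<Omega> u G1 G2 \<and>
        (\<forall>\<eta> \<eta>1 \<eta>2. C1c \<Omega> \<eta> \<eta>1 \<eta>2 \<longrightarrow>
           L2_inner \<Omega> \<eta>1 G1 + L2_inner \<Omega> \<eta>2 G2 = L2_inner \<Omega> \<eta> f))"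

text \<open>The restriction \<open>H\<^sub>0\<close> of \<open>-\<Delta>\<close> to \<open>{f \<in> Dom(\<Delta>). f(p) = 0}\<close>. The value at \<open>p\<close> of an element of
  \<open>Dom(\<Delta>)\<close> is that of its continuous representative.\<close>

definition H0 :: "(real \<times> real) set \<Rightarrow> real \<times> real \<Rightarrow> wavefun \<Rightarrow> wavefun \<Rightarrow> bool" where
  "H0 \<Omega> p u f \<longleftrightarrow> neg_Laplacian \<Omega> u f \<and>
     (\<exists>w. continuous_on \<Omega> w \<and> (AE x in lebesgue_on \<Omega>. u x = w x) \<and> w p = 0)"

definition adjoint_op ::
  "(real \<times> real) set \<Rightarrow> (wavefun \<Rightarrow> wavefun \<Rightarrow> bool) \<Rightarrow> wavefun \<Rightarrow> wavefun \<Rightarrow> bool" where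
  "adjoint_op \<Omega> T \<psi> \<xi> \<longleftrightarrow> \<psi> \<in> L2 \<Omega> \<and> \<xi> \<in> L2 \<Omega> \<and>
     (\<forall>u f. T u f \<longrightarrow> L2_inner \<Omega> u \<xi> = L2_inner \<Omega> f \<psi>)"

section \<open>The spectrum of the Dirichlet Laplacian on the rectangle\<close>

definition rect :: "real \<Rightarrow> real \<Rightarrow> (real \<times> real) set" where
  "rect a b = {0<..<2 * a} \<times> {0<..<2 * b}"

definition sine_mode :: "real \<Rightarrow> real \<Rightarrow> nat \<times> nat \<Rightarrow> real \<times> real \<Rightarrow> real" where
  "sine_mode a b = (\<lambda>(n, m) (x, y).
     1 / sqrt (a * b) * sin (real n * pi * x / (2 * a)) * sin (real m * pi * y / (2 * b)))"

definition mode_energy :: "real \<Rightarrow> real \<Rightarrow> nat \<times> nat \<Rightarrow> real" where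
  "mode_energy a b = (\<lambda>(n, m). pi\<^sup>2 * ((real n)\<^sup>2 / (4 * a\<^sup>2) + (real m)\<^sup>2 / (4 * b\<^sup>2)))"

definition energy :: "real \<Rightarrow> real \<Rightarrow> nat \<Rightarrow> nat \<Rightarrow> real" where
  "energy a b s t = pi\<^sup>2 * ((real s + 1/2)\<^sup>2 / a\<^sup>2 + (real t + 1/2)\<^sup>2 / b\<^sup>2)"

text \<open>The real-valued eigenfunctions with eigenvalue \<open>e\<close> (and zero); the index set is finite when
  \<open>a, b > 0\<close>.\<close>

definition eigenspace :: "real \<Rightarrow> real \<Rightarrow> real \<Rightarrow> (real \<times> real \<Rightarrow> real) set" where
  "eigenspace a b e =
     {\<lambda>x. \<Sum>k\<in>{(n, m). n \<ge> 1 \<and> m \<ge> 1 \<and> mode_energy a b (n, m) = e}. c k * sine_mode a b k x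
        | c. True}"

definition orthonormal_basis ::
  "(real \<times> real) set \<Rightarrow> (real \<times> real \<Rightarrow> real) set \<Rightarrow> (real \<times> real \<Rightarrow> real) set \<Rightarrow> bool" where
  "orthonormal_basis \<Omega> V B \<longleftrightarrow> finite B \<and>
     (\<forall>u\<in>B. \<forall>v\<in>B. (LINT x|lebesgue_on \<Omega>. u x * v x) = (if u = v then 1 else 0)) \<and>
     V = {\<lambda>x. \<Sum>u\<in>B. c u * u x | c. True}"

text \<open>\<open>E\<close> lists the values \<open>energy a b s t\<close> without repetition, in increasing order, and \<open>\<Phi> j\<close> is
  the only element not vanishing at \<open>p\<close> of some orthonormal basis of the eigenspace of \<open>E j\<close>.
  If \<open>E j\<close> is a simple eigenvalue, this says that \<open>\<Phi> j\<close> is the sine mode up to sign.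
  Indices start at 0.\<close>

definition eigen_listing ::
  "real \<Rightarrow> real \<Rightarrow> (nat \<Rightarrow> real) \<Rightarrow> (nat \<Rightarrow> real \<times> real \<Rightarrow> real) \<Rightarrow> bool" where
  "eigen_listing a b E \<Phi> \<longleftrightarrow>
     strict_mono E \<and> range E = {energy a b s t | s t. True} \<and>
     (\<forall>j. \<exists>B. orthonormal_basis (rect a b) (eigenspace a b (E j)) B \<and>
              {u \<in> B. u (a, b) \<noteq> 0} = {\<Phi> j})"

section \<open>The point scatterer\<close>

text \<open>\<open>g = \<Sum>\<^sub>j \<Phi>\<^sub>j(p) / (E\<^sub>j - z) \<Phi>\<^sub>j\<close> in \<open>L\<^sup>2(\<Omega>)\<close>, with \<open>p = (a, b)\<close>; the values \<open>\<Phi>\<^sub>j(p)\<close> are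
  real, so they need no conjugation.\<close>

definition is_green ::
  "real \<Rightarrow> real \<Rightarrow> (nat \<Rightarrow> real) \<Rightarrow> (nat \<Rightarrow> real \<times> real \<Rightarrow> real) \<Rightarrow> complex \<Rightarrow> wavefun \<Rightarrow> bool" where
  "is_green a b E \<Phi> z g \<longleftrightarrow> L2_tendsto (rect a b)
     (\<lambda>N x. \<Sum>j<N. of_real (\<Phi> j (a, b)) / (of_real (E j) - z) * of_real (\<Phi> j x)) g"

text \<open>\<open>\<psi> = \<psi>' + a\<^sub>+ g\<^sub>i + a\<^sub>- g\<^sub>-\<^sub>i\<close> with \<open>\<psi>' \<in> Dom(H\<^sub>0)\<close>.\<close>

definition deficiency_coeffs ::
  "real \<Rightarrow> real \<Rightarrow> (nat \<Rightarrow> real) \<Rightarrow> (nat \<Rightarrow> real \<times> real \<Rightarrow> real) \<Rightarrow>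
   wavefun \<Rightarrow> complex \<Rightarrow> complex \<Rightarrow> bool" where
  "deficiency_coeffs a b E \<Phi> \<psi> a_plus a_minus \<longleftrightarrow>
     (\<exists>\<psi>' f g_plus g_minus. H0 (rect a b) (a, b) \<psi>' f \<and>
        is_green a b E \<Phi> \<i> g_plus \<and> is_green a b E \<Phi> (- \<i>) g_minus \<and>
        (AE x in lebesgue_on (rect a b).
           \<psi> x = \<psi>' x + a_plus * g_plus x + a_minus * g_minus x))"

text \<open>The graph of \<open>H\<^sub>\<pi>\<close>, the restriction of \<open>H\<^sub>0\<^sup>*\<close> to the vectors with \<open>a\<^sub>- = a\<^sub>+\<close>.\<close>

definition H_pi ::
  "real \<Rightarrow> real \<Rightarrow> (nat \<Rightarrow> real) \<Rightarrow> (nat \<Rightarrow> real \<times> real \<Rightarrow> real) \<Rightarrow> wavefun \<Rightarrow> wavefun \<Rightarrow> bool" where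
  "H_pi a b E \<Phi> \<psi> \<xi> \<longleftrightarrow>
     adjoint_op (rect a b) (H0 (rect a b) (a, b)) \<psi> \<xi> \<and>
     (\<exists>a_plus a_minus. deficiency_coeffs a b E \<Phi> \<psi> a_plus a_minus \<and> a_minus = a_plus)"

definition normalised_eigenfunction ::
  "(real \<times> real) set \<Rightarrow> (wavefun \<Rightarrow> wavefun \<Rightarrow> bool) \<Rightarrow> real \<Rightarrow> wavefun \<Rightarrow> bool" where
  "normalised_eigenfunction \<Omega> T \<mu> \<phi> \<longleftrightarrow>
     T \<phi> (\<lambda>x. of_real \<mu> * \<phi> x) \<and> L2_norm \<Omega> \<phi> = 1"

section \<open>Vinogradov notation\<close>

definition vinogradov :: "(nat \<Rightarrow> real) \<Rightarrow> (nat \<Rightarrow> real) \<Rightarrow> bool"  (infix "\<lless>" 50) where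
  "f \<lless> g \<longleftrightarrow> (\<exists>C>0. \<forall>\<^sub>F n in sequentially. f n \<le> C * g n)"

end

(* The eigenfunctions of the point scatterer are the Green functions G_x = sum_j Phi_j(p)/(E_j - x) Phi_j,
   where x solves the secular equation sum_j (1/(E_j - x) - E_j/(E_j^2 + 1)) = 0; there is one solution
   in each gap of the spectrum. If E_b < E_c is a close pair, the terms of all other eigenvalues add up
   to O(eps^(-q - rho/2)) = o(1/eps): eigenvalues at distance less than 1 number O(sqrt x) and contribute
   at most eps^(-q) each, and the rest is controlled by counting lattice points in thin annuli. Hence
   1/(x - E_b) and 1/(E_c - x), which are at least of order 1/eps in sum, are asymptotically equal and
   dominate the norm of G_x. The hypothesis that the gaps E_c - E_b tend to 0 forces a^2/b^2 to be
   irrational, so that every eigenspace is one-dimensional. *)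
theory Submission
  imports Defs
begin


section \<open>Square-integrable functions\<close>

text \<open>The secular equation is the boundary condition in disguise. E_j/(E_j^2 + 1) is the mean
  of 1/(E_j - i) and 1/(E_j + i), so G_x = w + (g_i + g_{-i})/2 where w has coefficients O(1/E_j^2).
  Hence w is continuous and lies in the Dirichlet domain, the two deficiency coefficients of G_x
  agree, and w(p) is a multiple of the secular sum: the equation says w(p) = 0. The obstacle is the
  adjoint: for each u in the domain of the restricted operator, sum_j Phi_j(p) <u, Phi_j> has to
  vanish. This is a formal expansion of u at p, but the Phi_j do not span L^2 and pointwise
  convergence is not automatic. It is obtained by pairing u with trigonometric polynomials that peak
  at p and contain only modes with both indices odd. The counting needs only O(sqrt x) eigenvalues
  per unit window. Replacing 1/m by x^theta m^(-1-theta) avoids a logarithm; with theta = q/rho the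
  loss x^theta becomes eps^(-q), the same as the loss from the neighbouring gaps. The exponent 1 - q
  - rho/2 left at the end is positive exactly when rho < 2(1-q).\<close>

lemma tendsto_zero_squeeze:
  fixes f g :: "nat \<Rightarrow> real"
  assumes "g \<longlonglongrightarrow> 0" "\<And>n. 0 \<le> f n" "\<And>n. f n \<le> g n"
  shows "f \<longlonglongrightarrow> 0"
  by (rule tendsto_sandwich[of "\<lambda>_. 0" f _ g]) (use assms in auto)

lemma borel_measurable_cnj [measurable]:
  "f \<in> borel_measurable M \<Longrightarrow> (\<lambda>x. cnj (f x)) \<in> borel_measurable M"
  using measurable_compose[OF _ borel_measurable_continuous_onI[OF continuous_on_cnj[OF continuous_on_id]]]
  by this

lemma L2_measurable: "f \<in> L2 \<Omega> \<Longrightarrow> f \<in> borel_measurable (lebesgue_on \<Omega>)"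
  by (simp add: L2_def)

lemma L2_square_integrable: "f \<in> L2 \<Omega> \<Longrightarrow> integrable (lebesgue_on \<Omega>) (\<lambda>x. (cmod (f x))\<^sup>2)"
  by (simp add: L2_def)

lemma L2_scale: "f \<in> L2 \<Omega> \<Longrightarrow> (\<lambda>x. c * f x) \<in> L2 \<Omega>"
  by (auto simp: L2_def norm_mult power_mult_distrib)

lemma cmod_add_square_le: "(cmod (x + y))\<^sup>2 \<le> 2 * (cmod x)\<^sup>2 + 2 * (cmod y)\<^sup>2"
proof -
  have "(cmod (x + y))\<^sup>2 \<le> (cmod x + cmod y)\<^sup>2"
    by (intro power_mono norm_triangle_ineq) auto
  also have "\<dots> \<le> 2 * (cmod x)\<^sup>2 + 2 * (cmod y)\<^sup>2"
    using sum_squares_bound[of "cmod x" "cmod y"] by (simp add: power2_sum)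
  finally show ?thesis .
qed

lemma L2_add:
  assumes f: "f \<in> L2 \<Omega>" and g: "g \<in> L2 \<Omega>"
  shows "(\<lambda>x. f x + g x) \<in> L2 \<Omega>"
proof -
  note [measurable] = L2_measurable[OF f] L2_measurable[OF g]
  have "integrable (lebesgue_on \<Omega>) (\<lambda>x. (cmod (f x + g x))\<^sup>2)"
  proof (rule Bochner_Integration.integrable_bound)
    show "integrable (lebesgue_on \<Omega>) (\<lambda>x. 2 * (cmod (f x))\<^sup>2 + 2 * (cmod (g x))\<^sup>2)"
      using f g by (intro Bochner_Integration.integrable_add integrable_mult_right L2_square_integrable)
  qed (auto intro!: always_eventually cmod_add_square_le simp: abs_of_nonneg)
  thus ?thesis by (simp add: L2_def)
qed

lemma L2_diff: "f \<in> L2 \<Omega> \<Longrightarrow> g \<in> L2 \<Omega> \<Longrightarrow> (\<lambda>x. f x - g x) \<in> L2 \<Omega>"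
  using L2_add[of f \<Omega> "\<lambda>x. (-1) * g x"] L2_scale[of g \<Omega> "-1"] by simp

lemma L2_zero: "(\<lambda>x. 0) \<in> L2 \<Omega>"
  by (simp add: L2_def)

lemma L2_sum: "(\<And>i. i \<in> I \<Longrightarrow> f i \<in> L2 \<Omega>) \<Longrightarrow> (\<lambda>x. \<Sum>i\<in>I. f i x) \<in> L2 \<Omega>"
  by (induction I rule: infinite_finite_induct) (auto intro: L2_add L2_zero)

lemma L2_product_integrable:
  assumes f: "f \<in> L2 \<Omega>" and g: "g \<in> L2 \<Omega>"
  shows "integrable (lebesgue_on \<Omega>) (\<lambda>x. cmod (f x) * cmod (g x))"
proof -
  note [measurable] = L2_measurable[OF f] L2_measurable[OF g]
  show ?thesis
  proof (rule Bochner_Integration.integrable_bound)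
    show "integrable (lebesgue_on \<Omega>) (\<lambda>x. (cmod (f x))\<^sup>2 + (cmod (g x))\<^sup>2)"
      using f g by (intro Bochner_Integration.integrable_add L2_square_integrable)
    have "cmod (f x) * cmod (g x) \<le> (cmod (f x))\<^sup>2 + (cmod (g x))\<^sup>2" for x
      using sum_squares_bound[of "cmod (f x)" "cmod (g x)"]
        mult_nonneg_nonneg[OF norm_ge_zero norm_ge_zero, of "f x" "g x"] by linarith
    thus "AE x in lebesgue_on \<Omega>. norm (cmod (f x) * cmod (g x))
        \<le> norm ((cmod (f x))\<^sup>2 + (cmod (g x))\<^sup>2)"
      by (auto intro!: always_eventually simp: abs_mult)
  qed auto
qed

lemma L2_inner_integrable:
  assumes f: "f \<in> L2 \<Omega>" and g: "g \<in> L2 \<Omega>"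
  shows "integrable (lebesgue_on \<Omega>) (\<lambda>x. cnj (f x) * g x)"
proof -
  note [measurable] = L2_measurable[OF f] L2_measurable[OF g]
  show ?thesis
    by (rule Bochner_Integration.integrable_bound[OF L2_product_integrable[OF f g]])
       (auto simp: norm_mult)
qed

lemma L2_norm_nonneg: "0 \<le> L2_norm \<Omega> f"
  by (simp add: L2_norm_def)

lemma L2_norm_power2: "(L2_norm \<Omega> f)\<^sup>2 = (LINT x|lebesgue_on \<Omega>. (cmod (f x))\<^sup>2)"
  by (simp add: L2_norm_def)

lemma L2_Cauchy_Schwarz_abs:
  assumes f: "f \<in> L2 \<Omega>" and g: "g \<in> L2 \<Omega>"
  shows "(LINT x|lebesgue_on \<Omega>. cmod (f x) * cmod (g x)) \<le> L2_norm \<Omega> f * L2_norm \<Omega> g"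
proof -
  let ?I = "LINT x|lebesgue_on \<Omega>. cmod (f x) * cmod (g x)"
  let ?A = "LINT x|lebesgue_on \<Omega>. (cmod (f x))\<^sup>2"
  let ?B = "LINT x|lebesgue_on \<Omega>. (cmod (g x))\<^sup>2"
  have A: "?A \<ge> 0" and B: "?B \<ge> 0" and I: "?I \<ge> 0" by auto
  \<comment> \<open>The integral of the square of \<open>t * |f| - |g|\<close> is nonnegative; the
    freedom in \<open>t\<close> then gives the discriminant inequality.\<close>
  have key: "2 * t * ?I \<le> t\<^sup>2 * ?A + ?B" for t
  proof -
    have "0 \<le> (LINT x|lebesgue_on \<Omega>. (t * cmod (f x) - cmod (g x))\<^sup>2)" by simp
    also have "\<dots> = (LINT x|lebesgue_on \<Omega>. t\<^sup>2 * (cmod (f x))\<^sup>2 + (cmod (g x))\<^sup>2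
        - 2 * t * (cmod (f x) * cmod (g x)))"
      by (intro Bochner_Integration.integral_cong) (auto simp: power2_eq_square algebra_simps)
    also have "\<dots> = t\<^sup>2 * ?A + ?B - 2 * t * ?I"
      using L2_square_integrable[OF f] L2_square_integrable[OF g] L2_product_integrable[OF f g]
      by simp
    finally show ?thesis by simp
  qed
  have "?I\<^sup>2 \<le> ?A * ?B"
  proof (cases "?A = 0")
    case True
    have "?I = 0"
    proof (rule ccontr)
      assume "?I \<noteq> 0"
      with I have "?I > 0" by linarith
      \<comment> \<open>With \<open>?A = 0\<close> the bound is linear in \<open>t\<close>, and this
        \<open>t\<close> turns it into \<open>?B + 1 \<le> ?B\<close>.\<close>
      with key[of "(?B + 1) / (2 * ?I)"] True show False by simp
    qed
    thus ?thesis using A B by simp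
  next
    case False
    with A have "?A > 0" by linarith
    \<comment> \<open>This \<open>t\<close> minimises the quadratic.\<close>
    with key[of "?I / ?A"] show ?thesis
      by (simp add: field_simps power2_eq_square)
  qed
  hence "sqrt (?I\<^sup>2) \<le> sqrt (?A * ?B)" by (rule real_sqrt_le_mono)
  thus ?thesis using I by (simp add: L2_norm_def real_sqrt_mult)
qed

lemma L2_Cauchy_Schwarz:
  assumes f: "f \<in> L2 \<Omega>" and g: "g \<in> L2 \<Omega>"
  shows "cmod (L2_inner \<Omega> f g) \<le> L2_norm \<Omega> f * L2_norm \<Omega> g"
proof -
  have "cmod (L2_inner \<Omega> f g) \<le> (LINT x|lebesgue_on \<Omega>. cmod (cnj (f x) * g x))"
    unfolding L2_inner_def by (rule integral_norm_bound)
  also have "\<dots> = (LINT x|lebesgue_on \<Omega>. cmod (f x) * cmod (g x))"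
    by (simp add: norm_mult)
  finally show ?thesis using L2_Cauchy_Schwarz_abs[OF f g] by simp
qed

lemma L2_norm_triangle:
  assumes f: "f \<in> L2 \<Omega>" and g: "g \<in> L2 \<Omega>"
  shows "L2_norm \<Omega> (\<lambda>x. f x + g x) \<le> L2_norm \<Omega> f + L2_norm \<Omega> g"
proof (rule power2_le_imp_le)
  have "(L2_norm \<Omega> (\<lambda>x. f x + g x))\<^sup>2 \<le>
      (LINT x|lebesgue_on \<Omega>. (cmod (f x))\<^sup>2 + (cmod (g x))\<^sup>2 + 2 * (cmod (f x) * cmod (g x)))"
    unfolding L2_norm_power2
  proof (rule integral_mono)
    show "integrable (lebesgue_on \<Omega>) (\<lambda>x. (cmod (f x + g x))\<^sup>2)"
      by (intro L2_square_integrable L2_add f g)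
    show "integrable (lebesgue_on \<Omega>)
        (\<lambda>x. (cmod (f x))\<^sup>2 + (cmod (g x))\<^sup>2 + 2 * (cmod (f x) * cmod (g x)))"
      by (intro Bochner_Integration.integrable_add integrable_mult_right L2_square_integrable
          L2_product_integrable f g)
    show "(cmod (f x + g x))\<^sup>2 \<le> (cmod (f x))\<^sup>2 + (cmod (g x))\<^sup>2 + 2 * (cmod (f x) * cmod (g x))" for x
      using power_mono[OF norm_triangle_ineq[of "f x" "g x"], of 2] by (simp add: power2_sum)
  qed
  also have "\<dots> = (L2_norm \<Omega> f)\<^sup>2 + (L2_norm \<Omega> g)\<^sup>2
      + 2 * (LINT x|lebesgue_on \<Omega>. cmod (f x) * cmod (g x))"
    using L2_square_integrable[OF f] L2_square_integrable[OF g] L2_product_integrable[OF f g]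
    by (simp add: L2_norm_power2)
  also have "\<dots> \<le> (L2_norm \<Omega> f + L2_norm \<Omega> g)\<^sup>2"
    using L2_Cauchy_Schwarz_abs[OF f g] by (simp add: power2_sum)
  finally show "(L2_norm \<Omega> (\<lambda>x. f x + g x))\<^sup>2 \<le> (L2_norm \<Omega> f + L2_norm \<Omega> g)\<^sup>2" .
qed (simp add: L2_norm_nonneg)

lemma L2_norm_scale: "L2_norm \<Omega> (\<lambda>x. c * f x) = cmod c * L2_norm \<Omega> f"
  by (simp add: L2_norm_def norm_mult power_mult_distrib real_sqrt_mult)

lemma L2_norm_minus_commute: "L2_norm \<Omega> (\<lambda>x. f x - g x) = L2_norm \<Omega> (\<lambda>x. g x - f x)"
  by (simp add: L2_norm_def norm_minus_commute)

lemma L2_inner_cnj: "L2_inner \<Omega> g f = cnj (L2_inner \<Omega> f g)"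
  unfolding L2_inner_def Bochner_Integration.integral_cnj[symmetric]
  by (intro Bochner_Integration.integral_cong) (auto simp: mult.commute)

lemma L2_inner_diff_right:
  "f \<in> L2 \<Omega> \<Longrightarrow> g \<in> L2 \<Omega> \<Longrightarrow> h \<in> L2 \<Omega> \<Longrightarrow>
    L2_inner \<Omega> f (\<lambda>x. g x - h x) = L2_inner \<Omega> f g - L2_inner \<Omega> f h"
  using L2_inner_integrable[of f \<Omega> g] L2_inner_integrable[of f \<Omega> h]
  by (simp add: L2_inner_def right_diff_distrib)

lemma L2_inner_scale_right: "L2_inner \<Omega> f (\<lambda>x. c * g x) = c * L2_inner \<Omega> f g"
  by (simp add: L2_inner_def mult.left_commute)

lemma L2_inner_sum_right:
  assumes "f \<in> L2 \<Omega>" "\<And>i. i \<in> I \<Longrightarrow> g i \<in> L2 \<Omega>"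
  shows "L2_inner \<Omega> f (\<lambda>x. \<Sum>i\<in>I. g i x) = (\<Sum>i\<in>I. L2_inner \<Omega> f (g i))"
  using assms by (simp add: L2_inner_def sum_distrib_left L2_inner_integrable)

lemma L2_inner_self: "L2_inner \<Omega> f f = of_real ((L2_norm \<Omega> f)\<^sup>2)"
proof -
  have "cnj z * z = of_real ((cmod z)\<^sup>2)" for z
    by (simp add: complex_norm_square mult.commute[of "cnj z"] del: of_real_power)
  thus ?thesis unfolding L2_inner_def L2_norm_power2 by (simp only: integral_complex_of_real)
qed

lemma cmod_diff_square: "(cmod (x - y))\<^sup>2 = (cmod x)\<^sup>2 + (cmod y)\<^sup>2 - 2 * Re (cnj x * y)"
  unfolding cmod_power2 by (simp add: power2_eq_square algebra_simps)

lemma L2_norm_diff_power2: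
  assumes f: "f \<in> L2 \<Omega>" and g: "g \<in> L2 \<Omega>"
  shows "(L2_norm \<Omega> (\<lambda>x. f x - g x))\<^sup>2
    = (L2_norm \<Omega> f)\<^sup>2 + (L2_norm \<Omega> g)\<^sup>2 - 2 * Re (L2_inner \<Omega> f g)"
proof -
  define r where "r x = Re (cnj (f x) * g x)" for x
  have Re: "Re (L2_inner \<Omega> f g) = (LINT x|lebesgue_on \<Omega>. r x)"
    unfolding L2_inner_def r_def using integral_Re[OF L2_inner_integrable[OF f g]] by simp
  have *: "integrable (lebesgue_on \<Omega>) r"
    unfolding r_def[abs_def] by (intro integrable_Re L2_inner_integrable f g)
  have "(L2_norm \<Omega> (\<lambda>x. f x - g x))\<^sup>2
      = (LINT x|lebesgue_on \<Omega>. (cmod (f x))\<^sup>2 + (cmod (g x))\<^sup>2 - 2 * r x)"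
    unfolding L2_norm_power2 r_def
    by (intro Bochner_Integration.integral_cong refl cmod_diff_square)
  also have "\<dots> = (L2_norm \<Omega> f)\<^sup>2 + (L2_norm \<Omega> g)\<^sup>2 - 2 * Re (L2_inner \<Omega> f g)"
    unfolding Re using L2_square_integrable[OF f] L2_square_integrable[OF g] * 
    by (simp add: L2_norm_power2 )
  finally show ?thesis .
qed

section \<open>Convergence in the mean\<close>

lemma L2_tendsto_inner:
  assumes f: "f \<in> L2 \<Omega>" and v: "L2_tendsto \<Omega> v u"
  shows "(\<lambda>n. L2_inner \<Omega> f (v n)) \<longlonglongrightarrow> L2_inner \<Omega> f u"
proof (rule LIM_zero_cancel, rule Lim_null_comparison)
  have u: "u \<in> L2 \<Omega>" and vn: "\<And>n. v n \<in> L2 \<Omega>"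
    and lim: "(\<lambda>n. L2_norm \<Omega> (\<lambda>x. v n x - u x)) \<longlonglongrightarrow> 0"
    using v by (auto simp: L2_tendsto_def)
  show "\<forall>\<^sub>F n in sequentially. norm (L2_inner \<Omega> f (v n) - L2_inner \<Omega> f u)
      \<le> L2_norm \<Omega> f * L2_norm \<Omega> (\<lambda>x. v n x - u x)"
    using f u vn by (auto intro!: always_eventually L2_Cauchy_Schwarz L2_diff
        simp: L2_inner_diff_right[symmetric])
  show "(\<lambda>n. L2_norm \<Omega> f * L2_norm \<Omega> (\<lambda>x. v n x - u x)) \<longlonglongrightarrow> 0"
    using tendsto_mult_left[OF lim, of "L2_norm \<Omega> f"] by simp
qed

lemma L2_tendsto_inner_left:
  assumes f: "f \<in> L2 \<Omega>" and v: "L2_tendsto \<Omega> v u"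
  shows "(\<lambda>n. L2_inner \<Omega> (v n) f) \<longlonglongrightarrow> L2_inner \<Omega> u f"
  using tendsto_cnj[OF L2_tendsto_inner[OF f v]] by (simp add: L2_inner_cnj[symmetric])

lemma L2_tendsto_norm:
  assumes v: "L2_tendsto \<Omega> v u"
  shows "(\<lambda>n. L2_norm \<Omega> (v n)) \<longlonglongrightarrow> L2_norm \<Omega> u"
proof (rule LIM_zero_cancel, rule Lim_null_comparison)
  have u: "u \<in> L2 \<Omega>" and vn: "\<And>n. v n \<in> L2 \<Omega>"
    and lim: "(\<lambda>n. L2_norm \<Omega> (\<lambda>x. v n x - u x)) \<longlonglongrightarrow> 0"
    using v by (auto simp: L2_tendsto_def)
  show "(\<lambda>n. L2_norm \<Omega> (\<lambda>x. v n x - u x)) \<longlonglongrightarrow> 0" by fact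
  have "\<bar>L2_norm \<Omega> (v n) - L2_norm \<Omega> u\<bar> \<le> L2_norm \<Omega> (\<lambda>x. v n x - u x)" for n
    using L2_norm_triangle[OF L2_diff[OF vn u] u, of n] L2_norm_triangle[OF L2_diff[OF u vn] vn, of n n]
    by (simp add: L2_norm_minus_commute[of \<Omega> u])
  thus "\<forall>\<^sub>F n in sequentially. norm (L2_norm \<Omega> (v n) - L2_norm \<Omega> u)
      \<le> L2_norm \<Omega> (\<lambda>x. v n x - u x)" by simp
qed

lemma L2_tendsto_add:
  assumes v: "L2_tendsto \<Omega> v u" and v': "L2_tendsto \<Omega> v' u'"
  shows "L2_tendsto \<Omega> (\<lambda>n x. v n x + v' n x) (\<lambda>x. u x + u' x)"
proof -
  have u: "u \<in> L2 \<Omega>" "u' \<in> L2 \<Omega>" and vn: "\<And>n. v n \<in> L2 \<Omega>" "\<And>n. v' n \<in> L2 \<Omega>"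
    and lim: "(\<lambda>n. L2_norm \<Omega> (\<lambda>x. v n x - u x)) \<longlonglongrightarrow> 0"
      "(\<lambda>n. L2_norm \<Omega> (\<lambda>x. v' n x - u' x)) \<longlonglongrightarrow> 0"
    using v v' by (auto simp: L2_tendsto_def)
  have le: "L2_norm \<Omega> (\<lambda>x. v n x + v' n x - (u x + u' x))
      \<le> L2_norm \<Omega> (\<lambda>x. v n x - u x) + L2_norm \<Omega> (\<lambda>x. v' n x - u' x)" for n
    using L2_norm_triangle[OF L2_diff[OF vn(1) u(1)] L2_diff[OF vn(2) u(2)], of n n]
    by (simp add: algebra_simps)
  have "(\<lambda>n. L2_norm \<Omega> (\<lambda>x. v n x + v' n x - (u x + u' x))) \<longlonglongrightarrow> 0"
    by (rule Lim_null_comparison[OF _ tendsto_add_zero[OF lim]])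
       (use le in \<open>auto simp: L2_norm_nonneg\<close>)
  thus ?thesis using u vn by (auto simp: L2_tendsto_def intro: L2_add)
qed

lemma L2_tendsto_scale:
  assumes v: "L2_tendsto \<Omega> v u"
  shows "L2_tendsto \<Omega> (\<lambda>n x. c * v n x) (\<lambda>x. c * u x)"
proof -
  have eq: "L2_norm \<Omega> (\<lambda>x. c * v n x - c * u x) = cmod c * L2_norm \<Omega> (\<lambda>x. v n x - u x)" for n
    by (simp add: L2_norm_scale[symmetric] right_diff_distrib)
  show ?thesis
    using v tendsto_mult_left[of "\<lambda>n. L2_norm \<Omega> (\<lambda>x. v n x - u x)" 0 sequentially "cmod c"]
    by (auto simp: L2_tendsto_def eq intro: L2_scale)
qed

text \<open>Triangle inequality with an error 1/(n+1) that tends to 0. This is the diagonal step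
  that lets compactly supported functions replace elements of \<open>H1_0\<close> in a
  limit.\<close>

lemma L2_tendsto_diagonal:
  assumes lim: "L2_tendsto \<Omega> v u" and approx: "\<And>n. L2_norm \<Omega> (\<lambda>x. w n x - v n x) < 1 / real (Suc n)"
    and w: "\<And>n. w n \<in> L2 \<Omega>"
  shows "L2_tendsto \<Omega> w u"
proof -
  have u: "u \<in> L2 \<Omega>" and vn: "\<And>n. v n \<in> L2 \<Omega>"
    and lim': "(\<lambda>n. L2_norm \<Omega> (\<lambda>x. v n x - u x)) \<longlonglongrightarrow> 0"
    using lim by (auto simp: L2_tendsto_def)
  have le: "L2_norm \<Omega> (\<lambda>x. w n x - u x) \<le> 1 / real (Suc n) + L2_norm \<Omega> (\<lambda>x. v n x - u x)" for n
    using L2_norm_triangle[OF L2_diff[OF w vn] L2_diff[OF vn u], of n n n] approx[of n] by simp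
  have *: "(\<lambda>n. 1 / real (Suc n) + L2_norm \<Omega> (\<lambda>x. v n x - u x)) \<longlonglongrightarrow> 0"
    using tendsto_add[OF lim_inverse_n' [THEN LIMSEQ_Suc] lim'] by simp
  have "(\<lambda>n. L2_norm \<Omega> (\<lambda>x. w n x - u x)) \<longlonglongrightarrow> 0"
    by (rule tendsto_zero_squeeze[OF * L2_norm_nonneg le])
  thus ?thesis using u w by (simp add: L2_tendsto_def)
qed

lemma bounded_in_L2:
  assumes "\<Omega> \<in> lmeasurable" "f \<in> borel_measurable (lebesgue_on \<Omega>)"
    "\<And>x. x \<in> \<Omega> \<Longrightarrow> cmod (f x) \<le> B"
  shows "f \<in> L2 \<Omega>"
proof -
  interpret finite_measure "lebesgue_on \<Omega>" by (rule finite_measure_lebesgue_on[OF assms(1)])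
  have "integrable (lebesgue_on \<Omega>) (\<lambda>x. (cmod (f x))\<^sup>2)"
    using assms(2,3)
    by (intro integrable_const_bound[of _ "B\<^sup>2"] AE_I2) (auto simp: abs_of_nonneg intro!: power_mono)
  with assms(2) show ?thesis by (simp add: L2_def)
qed

text \<open>Dominated convergence: \<open>\<Omega>\<close> has finite measure and
  \<open>(2 * B)\<^sup>2\<close> majorises the squared differences. For explicitly given functions
  this reduces convergence in the mean to pointwise convergence and one uniform bound.\<close>

lemma L2_tendsto_bounded_convergence:
  assumes \<Omega>: "\<Omega> \<in> lmeasurable" and meas: "\<And>n. v n \<in> borel_measurable (lebesgue_on \<Omega>)"
    and bound: "\<And>n x. x \<in> \<Omega> \<Longrightarrow> cmod (v n x) \<le> B"
    and lim: "\<And>x. x \<in> \<Omega> \<Longrightarrow> (\<lambda>n. v n x) \<longlonglongrightarrow> u x"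
  shows "L2_tendsto \<Omega> v u"
proof -
  interpret finite_measure "lebesgue_on \<Omega>" by (rule finite_measure_lebesgue_on[OF \<Omega>])
  have u_meas: "u \<in> borel_measurable (lebesgue_on \<Omega>)"
    by (rule borel_measurable_LIMSEQ_metric[OF meas]) (auto intro: lim)
  have u_bound: "cmod (u x) \<le> B" if "x \<in> \<Omega>" for x
    by (rule LIMSEQ_le_const2[OF tendsto_norm[OF lim[OF that]]]) (use bound[OF that] in auto)
  have "(\<lambda>n. LINT x|lebesgue_on \<Omega>. (cmod (v n x - u x))\<^sup>2) \<longlonglongrightarrow> (LINT x|lebesgue_on \<Omega>. 0)"
  proof (rule integral_dominated_convergence[where w = "\<lambda>_. (2 * B)\<^sup>2"])
    show "AE x in lebesgue_on \<Omega>. (\<lambda>n. (cmod (v n x - u x))\<^sup>2) \<longlonglongrightarrow> 0"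
    proof (rule AE_I2)
      fix x assume "x \<in> space (lebesgue_on \<Omega>)"
      hence "(\<lambda>n. v n x - u x) \<longlonglongrightarrow> 0" using LIM_zero[OF lim] by simp
      thus "(\<lambda>n. (cmod (v n x - u x))\<^sup>2) \<longlonglongrightarrow> 0"
        using tendsto_power[OF tendsto_norm_zero, of "\<lambda>n. v n x - u x" sequentially 2] by simp
    qed
    show "AE x in lebesgue_on \<Omega>. norm ((cmod (v n x - u x))\<^sup>2) \<le> (2 * B)\<^sup>2" for n
    proof (rule AE_I2)
      fix x assume "x \<in> space (lebesgue_on \<Omega>)"
      hence "cmod (v n x - u x) \<le> 2 * B"
        using bound[of x n] u_bound[of x] norm_triangle_ineq4[of "v n x" "u x"] by simp
      thus "norm ((cmod (v n x - u x))\<^sup>2) \<le> (2 * B)\<^sup>2"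
        using power_mono[of "cmod (v n x - u x)" "2 * B" 2] by simp
    qed
  qed (use meas u_meas in auto)
  from tendsto_real_sqrt[OF this]
  have "(\<lambda>n. L2_norm \<Omega> (\<lambda>x. v n x - u x)) \<longlonglongrightarrow> 0"
    by (simp add: L2_norm_def)
  thus ?thesis
    using bounded_in_L2[OF \<Omega> u_meas u_bound] bounded_in_L2[OF \<Omega> meas bound]
    by (simp add: L2_tendsto_def)
qed


section \<open>Orthonormal series: Pythagoras and Riesz-Fischer\<close>

lemma L2_orthonormal_norm_power2:
  assumes e: "\<And>j. e j \<in> L2 \<Omega>"
    and orth: "\<And>i j. L2_inner \<Omega> (e i) (e j) = (if i = j then 1 else 0)" and F: "finite F"
  shows "(L2_norm \<Omega> (\<lambda>x. \<Sum>j\<in>F. c j * e j x))\<^sup>2 = (\<Sum>j\<in>F. (cmod (c j))\<^sup>2)"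
proof -
  define S where "S = (\<lambda>x. \<Sum>j\<in>F. c j * e j x)"
  have S: "S \<in> L2 \<Omega>" unfolding S_def by (intro L2_sum L2_scale e)
  have inner: "L2_inner \<Omega> (e i) S = c i" if "i \<in> F" for i
  proof -
    have "L2_inner \<Omega> (e i) S = (\<Sum>j\<in>F. c j * (if i = j then 1 else 0))"
      unfolding S_def by (subst L2_inner_sum_right) (simp_all add: e L2_scale L2_inner_scale_right orth)
    also have "\<dots> = (\<Sum>j\<in>F. if i = j then c j else 0)"
      by (intro sum.cong) simp_all
    finally show ?thesis using that F by simp
  qed
  have "L2_inner \<Omega> S (\<lambda>x. \<Sum>j\<in>F. c j * e j x) = (\<Sum>j\<in>F. c j * L2_inner \<Omega> S (e j))"
    by (subst L2_inner_sum_right) (simp_all add: e L2_scale L2_inner_scale_right S)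
  hence "L2_inner \<Omega> S S = (\<Sum>j\<in>F. c j * L2_inner \<Omega> S (e j))"
    by (simp only: S_def[symmetric])
  also have "\<dots> = (\<Sum>j\<in>F. c j * cnj (c j))"
    by (intro sum.cong refl) (simp add: L2_inner_cnj[of \<Omega> S] inner)
  also have "\<dots> = of_real (\<Sum>j\<in>F. (cmod (c j))\<^sup>2)"
    by (simp add: complex_norm_square del: of_real_power)
  finally show ?thesis unfolding L2_inner_self S_def[symmetric] of_real_eq_iff .
qed

text \<open>Riesz-Fischer. The limit is the pointwise limit of a subsequence of partial sums whose
  successive differences are summable in \<open>L\<^sup>2\<close>, hence almost everywhere absolutely summable.\<close>

lemma L2_orthonormal_series_converges:
  assumes \<Omega>: "\<Omega> \<in> lmeasurable" and e: "\<And>j. e j \<in> L2 \<Omega>"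
    and orth: "\<And>i j. L2_inner \<Omega> (e i) (e j) = (if i = j then 1 else 0)"
    and c: "summable (\<lambda>j. (cmod (c j))\<^sup>2)"
  shows "\<exists>g. L2_tendsto \<Omega> (\<lambda>N x. \<Sum>j<N. c j * e j x) g"
proof -
  define S where "S N x = (\<Sum>j<N. c j * e j x)" for N x
  \<comment> \<open>The tail of the coefficient series: it bounds the squared distance from
    \<open>S N\<close> to every later partial sum, and in the end to the limit.\<close>
  define T where "T N = (\<Sum>j. (cmod (c (j + N)))\<^sup>2)" for N
  have S: "S N \<in> L2 \<Omega>" for N unfolding S_def[abs_def] by (intro L2_sum L2_scale e)
  note [measurable] = S[THEN L2_measurable]
  have diff: "(L2_norm \<Omega> (\<lambda>x. S n x - S m x))\<^sup>2 \<le> T m" if "m \<le> n" for m n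
  proof -
    have "(\<lambda>x. S n x - S m x) = (\<lambda>x. \<Sum>j\<in>{m..<n}. c j * e j x)"
      unfolding S_def lessThan_atLeast0 using that by (auto simp: sum_diff_nat_ivl)
    hence "(L2_norm \<Omega> (\<lambda>x. S n x - S m x))\<^sup>2 = (\<Sum>j\<in>{m..<n}. (cmod (c j))\<^sup>2)"
      using L2_orthonormal_norm_power2[OF e orth, of "{m..<n}" c] by simp
    also have "\<dots> = (\<Sum>j<n-m. (cmod (c (j + m)))\<^sup>2)"
      using that by (intro sum.reindex_bij_witness[of _ "\<lambda>j. j + m" "\<lambda>j. j - m"]) auto
    also have "\<dots> \<le> T m"
      unfolding T_def using c by (intro sum_le_suminf) (auto intro: summable_ignore_initial_segment)
    finally show ?thesis .
  qed
  have T0: "T \<longlonglongrightarrow> 0"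
    unfolding T_def using suminf_exist_split2[OF c] .
  have T_nonneg: "T N \<ge> 0" for N unfolding T_def using c
    by (intro suminf_nonneg) (auto intro: summable_ignore_initial_segment)
  \<comment> \<open>Along \<open>r\<close> the tails drop below 4^(-k), so successive differences
    have norm at most 2^(-k).\<close>
  have "\<exists>r::nat \<Rightarrow> nat. \<forall>k. T (r k) < (1/4)^k \<and> r k < r (Suc k)"
  proof (rule dependent_nat_choice)
    show "\<exists>x. T x < (1/4)^0"
      using order_tendstoD(2)[OF T0, of 1] by (auto simp: eventually_sequentially)
    fix x k
    have "\<forall>\<^sub>F y in sequentially. T y < (1/4)^(Suc k) \<and> x < y"
      using order_tendstoD(2)[OF T0, of "(1/4)^(Suc k)"] eventually_gt_at_top[of x]
      by (intro eventually_conj) auto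
    thus "\<exists>y. T y < (1/4)^(Suc k) \<and> x < y" by (auto simp: eventually_sequentially)
  qed
  then obtain r :: "nat \<Rightarrow> nat" where r: "\<And>k. T (r k) < (1/4)^k" "\<And>k. r k < r (Suc k)"
    by blast
  have r_mono: "strict_mono r" using r(2) by (simp add: strict_mono_Suc_iff)
  define h where "h k x = S (r (Suc k)) x - S (r k) x" for k x
  have h: "h k \<in> L2 \<Omega>" for k unfolding h_def[abs_def] by (intro L2_diff S)
  note [measurable] = h[THEN L2_measurable]
  have h_norm: "L2_norm \<Omega> (h k) \<le> (1/2)^k" for k
  proof (rule power2_le_imp_le)
    have "(L2_norm \<Omega> (h k))\<^sup>2 \<le> (1/4)^k"
      using diff[of "r k" "r (Suc k)"] r[of k] unfolding h_def[abs_def] by simp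
    also have "(1/4::real)^k = ((1/2)\<^sup>2)^k" by (simp add: power2_eq_square)
    also have "\<dots> = ((1/2)^k)\<^sup>2" by (metis power_mult mult.commute)
    finally show "(L2_norm \<Omega> (h k))\<^sup>2 \<le> ((1/2)^k)\<^sup>2" .
  qed simp
  \<comment> \<open>Since the measure is finite, Cauchy-Schwarz against the constant 1 turns the
    geometric bounds in L^2 into geometric bounds in L^1; the increments are then absolutely
    summable almost everywhere.\<close>
  have one: "(\<lambda>x. 1) \<in> L2 \<Omega>" by (rule bounded_in_L2[OF \<Omega>, of _ 1]) auto
  define V where "V = L2_norm \<Omega> (\<lambda>x. 1)"
  have V: "V \<ge> 0" by (simp add: V_def L2_norm_nonneg)
  have h_L1: "integrable (lebesgue_on \<Omega>) (\<lambda>x. cmod (h k x))"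
    "(LINT x|lebesgue_on \<Omega>. cmod (h k x)) \<le> (1/2)^k * V" for k
    using L2_product_integrable[OF h one, of k] L2_Cauchy_Schwarz_abs[OF h one, of k]
      mult_right_mono[OF h_norm[of k] V] by (auto simp: V_def)
  have "(\<integral>\<^sup>+x. (\<Sum>k. ennreal (cmod (h k x))) \<partial>lebesgue_on \<Omega>)
      = (\<Sum>k. \<integral>\<^sup>+x. ennreal (cmod (h k x)) \<partial>lebesgue_on \<Omega>)"
    by (rule nn_integral_suminf) measurable
  also have "\<dots> \<le> (\<Sum>k. ennreal ((1/2)^k * V))"
    using h_L1 by (intro suminf_le) (auto simp: nn_integral_eq_integral intro!: ennreal_leI)
  also have "\<dots> < \<infinity>"
    using V summable_mult2[OF summable_geometric[of "1/2::real"], of V]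
    by (subst suminf_ennreal2) simp_all
  finally have "AE x in lebesgue_on \<Omega>. (\<Sum>k. ennreal (cmod (h k x))) \<noteq> \<infinity>"
    by (intro nn_integral_noteq_infinite) auto
  hence conv: "AE x in lebesgue_on \<Omega>. (\<lambda>k. S (r k) x) \<longlonglongrightarrow> lim (\<lambda>k. S (r k) x)"
  proof (rule AE_mp, intro AE_I2 impI)
    fix x assume "(\<Sum>k. ennreal (cmod (h k x))) \<noteq> \<infinity>"
    hence "summable (\<lambda>k. cmod (h k x))" by (intro summable_suminf_not_top) auto
    hence "convergent (\<lambda>n. \<Sum>k<n. h k x)"
      by (simp add: summable_norm_cancel summable_iff_convergent[symmetric])
    moreover have "(\<Sum>k<n. h k x) = S (r n) x - S (r 0) x" for n
      unfolding h_def by (rule sum_lessThan_telescope)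
    ultimately have "convergent (\<lambda>n. S (r n) x - S (r 0) x)" by simp
    from convergent_add[OF this convergent_const[of "S (r 0) x"]]
    show "(\<lambda>k. S (r k) x) \<longlonglongrightarrow> lim (\<lambda>k. S (r k) x)"
      by (simp add: convergent_LIMSEQ_iff)
  qed
  \<comment> \<open>\<open>lim\<close> has some value at every point, so \<open>g\<close> is total
    and measurable; \<open>conv\<close> identifies it almost everywhere as a genuine limit.\<close>
  define g where "g x = lim (\<lambda>k. S (r k) x)" for x
  have g_meas [measurable]: "g \<in> borel_measurable (lebesgue_on \<Omega>)"
    unfolding g_def[abs_def] by (rule borel_measurable_lim_metric[OF S[THEN L2_measurable]])
  \<comment> \<open>Fatou along the subsequence: the bound \<open>T N\<close> holds for
    \<open>S (r k) - S N\<close> as soon as \<open>r k \<ge> N\<close> and survives the limit. It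
    controls \<open>S N\<close> for every \<open>N\<close>, so the full sequence converges.\<close>
  have fatou: "(\<integral>\<^sup>+x. ennreal ((cmod (g x - S N x))\<^sup>2) \<partial>lebesgue_on \<Omega>) \<le> ennreal (T N)" for N
  proof -
    have "(\<integral>\<^sup>+x. ennreal ((cmod (g x - S N x))\<^sup>2) \<partial>lebesgue_on \<Omega>)
        = (\<integral>\<^sup>+x. liminf (\<lambda>k. ennreal ((cmod (S (r k) x - S N x))\<^sup>2)) \<partial>lebesgue_on \<Omega>)"
    proof (rule nn_integral_cong_AE, rule AE_mp[OF conv], intro AE_I2 impI)
      fix x assume "(\<lambda>k. S (r k) x) \<longlonglongrightarrow> lim (\<lambda>k. S (r k) x)"
      hence "(\<lambda>k. ennreal ((cmod (S (r k) x - S N x))\<^sup>2)) \<longlonglongrightarrow> ennreal ((cmod (g x - S N x))\<^sup>2)"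
        unfolding g_def
        by (rule tendsto_ennrealI[OF tendsto_power[OF tendsto_norm[OF tendsto_diff[OF _ tendsto_const]]]])
      thus "ennreal ((cmod (g x - S N x))\<^sup>2) = liminf (\<lambda>k. ennreal ((cmod (S (r k) x - S N x))\<^sup>2))"
        by (intro lim_imp_Liminf[symmetric]) auto
    qed
    also have "\<dots> \<le> liminf (\<lambda>k. \<integral>\<^sup>+x. ennreal ((cmod (S (r k) x - S N x))\<^sup>2) \<partial>lebesgue_on \<Omega>)"
      by (rule nn_integral_liminf) measurable
    also have "\<dots> \<le> liminf (\<lambda>k. ennreal (T N))"
    proof (rule Liminf_mono)
      have le: "(\<integral>\<^sup>+x. ennreal ((cmod (S n x - S N x))\<^sup>2) \<partial>lebesgue_on \<Omega>) \<le> ennreal (T N)"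
        if "n \<ge> N" for n
        using diff[OF that] L2_square_integrable[OF L2_diff[OF S S], of n N]
        by (subst nn_integral_eq_integral) (auto simp: L2_norm_power2 intro: ennreal_leI)
      have "\<forall>\<^sub>F k in sequentially. r k \<ge> N"
        using filterlim_subseq[OF r_mono] by (simp add: filterlim_at_top)
      thus "\<forall>\<^sub>F k in sequentially.
          (\<integral>\<^sup>+x. ennreal ((cmod (S (r k) x - S N x))\<^sup>2) \<partial>lebesgue_on \<Omega>) \<le> ennreal (T N)"
        by (rule eventually_mono) (rule le)
    qed
    finally show ?thesis by (simp add: Liminf_const)
  qed
  have gS: "(\<lambda>x. g x - S N x) \<in> L2 \<Omega>" for N
  proof -
    have "(\<integral>\<^sup>+x. ennreal ((cmod (g x - S N x))\<^sup>2) \<partial>lebesgue_on \<Omega>) < \<infinity>"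
      using fatou[of N] by (auto intro: le_less_trans)
    thus ?thesis by (auto simp: L2_def intro!: integrableI_bounded)
  qed
  have g: "g \<in> L2 \<Omega>" using L2_add[OF gS S, of 0 0] by simp
  have le: "L2_norm \<Omega> (\<lambda>x. S N x - g x) \<le> sqrt (T N)" for N
  proof -
    have "ennreal ((L2_norm \<Omega> (\<lambda>x. g x - S N x))\<^sup>2) \<le> ennreal (T N)"
      using fatou[of N] L2_square_integrable[OF gS, of N]
      by (subst (asm) nn_integral_eq_integral) (auto simp: L2_norm_power2)
    hence "(L2_norm \<Omega> (\<lambda>x. g x - S N x))\<^sup>2 \<le> T N" using T_nonneg by simp
    thus ?thesis by (simp add: L2_norm_minus_commute[of \<Omega> "S N"] real_le_rsqrt)
  qed
  have *: "(\<lambda>N. sqrt (T N)) \<longlonglongrightarrow> 0" using tendsto_real_sqrt[OF T0] by simp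
  have "(\<lambda>N. L2_norm \<Omega> (\<lambda>x. S N x - g x)) \<longlonglongrightarrow> 0"
    by (rule tendsto_zero_squeeze[OF * L2_norm_nonneg le])
  thus ?thesis using g S unfolding S_def[abs_def] by (auto simp: L2_tendsto_def)
qed


section \<open>Sine modes\<close>

lemma rect_eq_box: "rect a b = box (0, 0) (2 * a, 2 * b)"
  by (auto simp: rect_def box_def Basis_prod_def)

lemma rect_lmeasurable: "rect a b \<in> lmeasurable"
  unfolding rect_eq_box by (rule lmeasurable_box)

lemma rect_subset_cbox: "rect a b \<subseteq> cbox (0, 0) (2 * a, 2 * b)"
  unfolding rect_eq_box by (rule box_subset_cbox)

lemma continuous_measurable_rect:
  "continuous_on UNIV F \<Longrightarrow> F \<in> borel_measurable (lebesgue_on (rect a b))"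
  by (rule continuous_imp_measurable_on_sets_lebesgue)
     (auto intro: continuous_on_subset fmeasurableD rect_lmeasurable)

lemma continuous_bounded_rect:
  fixes F :: "real \<times> real \<Rightarrow> 'a::real_normed_vector"
  assumes "continuous_on UNIV F"
  obtains B where "\<And>x. x \<in> rect a b \<Longrightarrow> norm (F x) \<le> B"
proof -
  have "compact (F ` cbox (0, 0) (2 * a, 2 * b))"
    using assms by (intro compact_continuous_image) (auto intro: continuous_on_subset)
  then obtain B where "\<forall>y\<in>F ` cbox (0, 0) (2 * a, 2 * b). norm y \<le> B"
    using compact_imp_bounded bounded_iff by metis
  thus thesis using that[of B] rect_subset_cbox[of a b] by blast
qed

lemma continuous_in_L2:
  "continuous_on UNIV F \<Longrightarrow> F \<in> L2 (rect a b)"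
  by (metis continuous_bounded_rect bounded_in_L2 rect_lmeasurable continuous_measurable_rect)

lemma continuous_integrable_rect:
  fixes F :: "real \<times> real \<Rightarrow> 'a::euclidean_space"
  assumes F: "continuous_on UNIV F"
  shows "integrable (lebesgue_on (rect a b)) F"
proof -
  interpret finite_measure "lebesgue_on (rect a b)"
    by (rule finite_measure_lebesgue_on[OF rect_lmeasurable])
  obtain B where B: "\<And>x. x \<in> rect a b \<Longrightarrow> norm (F x) \<le> B"
    using continuous_bounded_rect[OF F] by blast
  show ?thesis
    by (rule integrable_const_bound[of _ B])
       (auto intro!: AE_I2 B continuous_measurable_rect[OF F])
qed

text \<open>The open rectangle and its closure have the same integral, so Fubini for continuous
  functions on a closed box applies. The inner integrals become one-dimensional gauge integrals,
  open to the fundamental theorem of calculus.\<close>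

lemma LINT_rect:
  fixes F :: "real \<times> real \<Rightarrow> 'a::euclidean_space"
  assumes F: "continuous_on UNIV F"
  shows "(LINT x|lebesgue_on (rect a b). F x)
    = integral {0..2*a} (\<lambda>x. integral {0..2*b} (\<lambda>y. F (x, y)))"
proof -
  have "(LINT x|lebesgue_on (rect a b). F x) = integral (rect a b) F"
    by (rule lebesgue_integral_eq_integral[OF continuous_integrable_rect[OF F]])
       (rule fmeasurableD[OF rect_lmeasurable])
  also have "\<dots> = integral (cbox (0, 0) (2*a, 2*b)) F"
    unfolding rect_eq_box by (rule integral_open_interval)
  also have "\<dots> = integral (cbox 0 (2*a)) (\<lambda>x. integral (cbox 0 (2*b)) (\<lambda>y. F (x, y)))"
    by (rule integral_prod_continuous[OF continuous_on_subset[OF F subset_UNIV]])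
  finally show ?thesis by simp
qed

text \<open>Integration by parts in the first variable requires that variable to be the inner
  one.\<close>

lemma LINT_rect_swap:
  fixes F :: "real \<times> real \<Rightarrow> 'a::euclidean_space"
  assumes F: "continuous_on UNIV F"
  shows "(LINT x|lebesgue_on (rect a b). F x)
    = integral {0..2*b} (\<lambda>y. integral {0..2*a} (\<lambda>x. F (x, y)))"
proof -
  have "continuous_on (cbox (0, 0) (2*a, 2*b)) (\<lambda>(x, y). F (x, y))"
    using continuous_on_subset[OF F subset_UNIV] by simp
  from integral_swap_continuous[OF this] show ?thesis
    using LINT_rect[OF F, of a b] by simp
qed

definition sine_mode_dx :: "real \<Rightarrow> real \<Rightarrow> nat \<times> nat \<Rightarrow> real \<times> real \<Rightarrow> real" where
  "sine_mode_dx a b = (\<lambda>(n, m) (x, y). 1 / sqrt (a * b) * (real n * pi / (2 * a))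
     * cos (real n * pi * x / (2 * a)) * sin (real m * pi * y / (2 * b)))"

definition sine_mode_dy :: "real \<Rightarrow> real \<Rightarrow> nat \<times> nat \<Rightarrow> real \<times> real \<Rightarrow> real" where
  "sine_mode_dy a b = (\<lambda>(n, m) (x, y). 1 / sqrt (a * b) * (real m * pi / (2 * b))
     * sin (real n * pi * x / (2 * a)) * cos (real m * pi * y / (2 * b)))"

lemma continuous_sine_mode: "continuous_on A (sine_mode a b k)"
  unfolding sine_mode_def case_prod_unfold divide_inverse by (intro continuous_intros)

lemma continuous_sine_mode_dx: "continuous_on A (sine_mode_dx a b k)"
  unfolding sine_mode_dx_def case_prod_unfold divide_inverse by (intro continuous_intros)

lemma continuous_sine_mode_dy: "continuous_on A (sine_mode_dy a b k)"
  unfolding sine_mode_dy_def case_prod_unfold divide_inverse by (intro continuous_intros)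

lemma abs_sine_mode_le:
  assumes "a > 0" "b > 0"
  shows "\<bar>sine_mode a b k x\<bar> \<le> 1 / sqrt (a * b)"
proof -
  obtain n m u v where [simp]: "k = (n, m)" "x = (u, v)" by (cases k, cases x) auto
  have "\<bar>sin (real n * pi * u / (2 * a))\<bar> * \<bar>sin (real m * pi * v / (2 * b))\<bar> \<le> 1 * 1"
    by (intro mult_mono) auto
  thus ?thesis using assms
    by (simp add: sine_mode_def abs_mult divide_right_mono)
qed

subsection \<open>Orthonormality\<close>

text \<open>Explicit antiderivatives: x/2 - sin cos/(2c) for equal frequencies, and the
  product-to-sum formula with difference frequency \<open>c\<close> and sum frequency
  \<open>d\<close> otherwise. All sines at the right end vanish because the frequencies times
  \<open>L\<close> are integer multiples of pi.\<close>

lemma sine_integral: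
  assumes L: "L > 0" and n: "n \<ge> 1" "m \<ge> 1"
  shows "((\<lambda>x. sin (real n * pi * x / L) * sin (real m * pi * x / L)) has_integral
    (if n = m then L / 2 else 0)) {0..L}"
proof (cases "n = m")
  case True
  define c where "c = real n * pi / L"
  have c: "c > 0" "c * L = real n * pi" using L n by (auto simp: c_def)
  have "((\<lambda>x. sin (c * x) * sin (c * x)) has_integral
      ((L / 2 - sin (c * L) * cos (c * L) / (2 * c)) - (0 / 2 - sin (c * 0) * cos (c * 0) / (2 * c)))) {0..L}"
  proof (rule fundamental_theorem_of_calculus)
    fix x
    have *: "cos (c * x) * cos (c * x) = 1 - sin (c * x) * sin (c * x)"
      using sin_cos_squared_add[of "c * x"] by (simp add: power2_eq_square)
    have "((\<lambda>x. x / 2 - sin (c * x) * cos (c * x) / (2 * c)) has_real_derivative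
        sin (c * x) * sin (c * x)) (at x within {0..L})"
      using c by (auto intro!: derivative_eq_intros simp: field_simps *)
    thus "((\<lambda>x. x / 2 - sin (c * x) * cos (c * x) / (2 * c)) has_vector_derivative
        sin (c * x) * sin (c * x)) (at x within {0..L})"
      by (simp add: has_real_derivative_iff_has_vector_derivative)
  qed (use L in auto)
  thus ?thesis using True c by (simp add: c_def mult.commute)
next
  case False
  define c where "c = (real n - real m) * pi / L"
  define d where "d = (real n + real m) * pi / L"
  have c: "c \<noteq> 0" "c * L = (real n - real m) * pi" using L False by (auto simp: c_def)
  have d: "d \<noteq> 0" "d * L = real (n + m) * pi" using L n by (auto simp: d_def)
  have s: "sin (c * L) = 0" "sin (d * L) = 0"
    unfolding c d using sin_npi_int[of "int n - int m"] sin_npi[of "n + m"]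
    by (auto simp: mult.commute)
  have "((\<lambda>x. (cos (c * x) - cos (d * x)) / 2) has_integral
      ((sin (c * L) / c - sin (d * L) / d) / 2 - (sin (c * 0) / c - sin (d * 0) / d) / 2)) {0..L}"
  proof (rule fundamental_theorem_of_calculus)
    fix x
    have "((\<lambda>x. (sin (c * x) / c - sin (d * x) / d) / 2) has_real_derivative
        (cos (c * x) - cos (d * x)) / 2) (at x within {0..L})"
      using c d by (auto intro!: derivative_eq_intros simp: field_simps)
    thus "((\<lambda>x. (sin (c * x) / c - sin (d * x) / d) / 2) has_vector_derivative
        (cos (c * x) - cos (d * x)) / 2) (at x within {0..L})"
      by (simp add: has_real_derivative_iff_has_vector_derivative)
  qed (use L in auto)
  moreover have "(cos (c * x) - cos (d * x)) / 2
      = sin (real n * pi * x / L) * sin (real m * pi * x / L)" for x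
    unfolding sin_times_sin c_def d_def
    by (simp add: diff_divide_distrib add_divide_distrib algebra_simps)
  ultimately show ?thesis using False s by simp
qed

text \<open>The sides are \<open>2 * a\<close> and \<open>2 * b\<close>, so the one-dimensional
  integrals are 0 or \<open>a\<close> and 0 or \<open>b\<close>; the prefactor 1/(ab) cancels
  them.\<close>

lemma sine_mode_orthonormal:
  assumes ab: "a > 0" "b > 0" and k: "fst k \<ge> 1" "snd k \<ge> 1" "fst l \<ge> 1" "snd l \<ge> 1"
  shows "(LINT x|lebesgue_on (rect a b). sine_mode a b k x * sine_mode a b l x)
    = (if k = l then 1 else 0)"
proof -
  obtain n m n' m' where [simp]: "k = (n, m)" "l = (n', m')" by (cases k, cases l) auto
  have X: "integral {0..2*a} (\<lambda>x. sin (real n * pi * x / (2*a)) * sin (real n' * pi * x / (2*a)))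
      = (if n = n' then a else 0)"
    using sine_integral[of "2*a" n n'] ab k by (simp add: integral_unique)
  have Y: "integral {0..2*b} (\<lambda>x. sin (real m * pi * x / (2*b)) * sin (real m' * pi * x / (2*b)))
      = (if m = m' then b else 0)"
    using sine_integral[of "2*b" m m'] ab k by (simp add: integral_unique)
  have eq: "sine_mode a b k (x, y) * sine_mode a b l (x, y)
      = (1 / (a * b) * (sin (real n * pi * x / (2*a)) * sin (real n' * pi * x / (2*a))))
        * (sin (real m * pi * y / (2*b)) * sin (real m' * pi * y / (2*b)))" for x y
  proof -
    have "sqrt (a * b) * sqrt (a * b) = a * b" using ab by simp
    thus ?thesis using ab by (simp add: sine_mode_def field_simps)
  qed
  have "(LINT x|lebesgue_on (rect a b). sine_mode a b k x * sine_mode a b l x)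
      = integral {0..2*a} (\<lambda>x. integral {0..2*b} (\<lambda>y. sine_mode a b k (x, y) * sine_mode a b l (x, y)))"
    by (rule LINT_rect) (intro continuous_on_mult continuous_sine_mode)
  also have "\<dots> = 1 / (a * b) * ((if n = n' then a else 0) * (if m = m' then b else 0))"
    unfolding eq integral_mult_right Y integral_mult_left X by simp
  also have "\<dots> = (if k = l then 1 else 0)" using ab by simp
  finally show ?thesis .
qed

subsection \<open>Integration by parts\<close>

text \<open>\<open>C1c\<close> speaks of partial derivatives and their continuity, not of continuity
  of \<open>v\<close> itself. Both partials exist and the second is continuous, which gives total
  differentiability and hence continuity.\<close>

lemma C1c_continuous:
  assumes "C1c \<Omega> v v1 v2"
  shows "continuous_on UNIV v"
proof -
  have v1: "((\<lambda>t. v (t, y)) has_vector_derivative v1 (x, y)) (at x)"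
    and v2: "((\<lambda>t. v (x, t)) has_vector_derivative v2 (x, y)) (at y)"
    and cont: "continuous_on UNIV v2" for x y
    using assms by (auto simp: C1c_def)
  have "isCont v (x, y)" for x y
  proof -
    have "((\<lambda>(x, y). v (x, y)) has_derivative
        (\<lambda>(tx, ty). tx *\<^sub>R v1 (x, y) + blinfun_apply (blinfun_scaleR_left (v2 (x, y))) ty))
        (at (x, y) within UNIV \<times> UNIV)"
    proof (rule has_derivative_partialsI)
      show "((\<lambda>x. v (x, y)) has_derivative (\<lambda>t. t *\<^sub>R v1 (x, y))) (at x within UNIV)"
        using v1 by (simp add: has_vector_derivative_def)
      show "((\<lambda>y. v (x, y)) has_derivative blinfun_apply (blinfun_scaleR_left (v2 (x, y))))
          (at y within UNIV)" for x y
        using v2 by (simp add: has_vector_derivative_def)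
      have "continuous (at (x, y)) (\<lambda>p. blinfun_scaleR_left (v2 p))"
        using cont
        by (intro bounded_linear.continuous[OF bounded_linear_blinfun_scaleR_left])
           (auto simp: continuous_on_eq_continuous_at)
      thus "continuous (at (x, y) within UNIV \<times> UNIV) (\<lambda>(x, y). blinfun_scaleR_left (v2 (x, y)))"
        by (simp add: case_prod_unfold)
    qed auto
    thus ?thesis using has_derivative_continuous by fastforce
  qed
  thus ?thesis by (auto simp: continuous_on_eq_continuous_at)
qed

lemma C1c_in_L2:
  assumes "C1c \<Omega> v v1 v2"
  shows "v \<in> L2 (rect a b)" "v1 \<in> L2 (rect a b)" "v2 \<in> L2 (rect a b)"
  using C1c_continuous[OF assms] assms by (auto simp: C1c_def intro!: continuous_in_L2)

lemma integral_by_parts_vanishing: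
  fixes u u' :: "real \<Rightarrow> complex" and g g' :: "real \<Rightarrow> real"
  assumes L: "0 \<le> L" and u: "\<And>x. (u has_vector_derivative u' x) (at x)"
    and g: "\<And>x. (g has_real_derivative g' x) (at x)"
    and cont: "continuous_on UNIV u'" "continuous_on UNIV g'" and zero: "u 0 = 0" "u L = 0"
  shows "integral {0..L} (\<lambda>x. u' x * of_real (g x)) = - integral {0..L} (\<lambda>x. u x * of_real (g' x))"
proof -
  have "((\<lambda>x. u' x * of_real (g x) + u x * of_real (g' x)) has_integral
      (u L * of_real (g L) - u 0 * of_real (g 0))) {0..L}"
  proof (rule fundamental_theorem_of_calculus[OF L])
    fix x
    have "((\<lambda>x. of_real (g x) :: complex) has_vector_derivative of_real (g' x)) (at x)"
      using g[of x] by (rule has_vector_derivative_of_real)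
    from has_vector_derivative_mult[OF u[of x] this]
    show "((\<lambda>x. u x * of_real (g x)) has_vector_derivative u' x * of_real (g x) + u x * of_real (g' x))
        (at x within {0..L})"
      by (simp add: add.commute has_vector_derivative_at_within)
  qed
  hence sum0: "integral {0..L} (\<lambda>x. u' x * of_real (g x) + u x * of_real (g' x)) = 0"
    using zero by (simp add: integral_unique)
  have cu: "continuous_on UNIV u" and cg: "continuous_on UNIV g"
    using u g by (auto simp: continuous_on_eq_continuous_at
        intro: has_vector_derivative_continuous DERIV_isCont)
  have "(\<lambda>x. u' x * of_real (g x)) integrable_on {0..L}" "(\<lambda>x. u x * of_real (g' x)) integrable_on {0..L}"
    by (intro integrable_continuous_real continuous_on_mult continuous_on_of_real
        continuous_on_subset[OF cu] continuous_on_subset[OF cg]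
        continuous_on_subset[OF cont(1)] continuous_on_subset[OF cont(2)] subset_UNIV)+
  from Henstock_Kurzweil_Integration.integral_add[OF this] sum0 show ?thesis
    by (simp add: eq_neg_iff_add_eq_0)
qed

text \<open>The weak form of the eigenvalue equation. The test function vanishes on all four sides,
  so one integration by parts in each variable leaves no boundary term; differentiating the mode
  twice multiplies it by \<open>-c\<^sup>2\<close> or \<open>-d\<^sup>2\<close>, and the energy is
  \<open>c\<^sup>2 + d\<^sup>2\<close>.\<close>

lemma sine_mode_integration_by_parts:
  assumes ab: "a > 0" "b > 0" and \<eta>: "C1c (rect a b) \<eta> \<eta>1 \<eta>2"
  shows "L2_inner (rect a b) \<eta>1 (\<lambda>x. of_real (sine_mode_dx a b k x))
      + L2_inner (rect a b) \<eta>2 (\<lambda>x. of_real (sine_mode_dy a b k x))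
    = of_real (mode_energy a b k) * L2_inner (rect a b) \<eta> (\<lambda>x. of_real (sine_mode a b k x))"
proof -
  obtain n m where k [simp]: "k = (n, m)" by (cases k)
  define c where "c = real n * pi / (2 * a)"
  define d where "d = real m * pi / (2 * b)"
  define A where "A = 1 / sqrt (a * b)"
  have mode: "sine_mode a b k (x, y) = A * sin (c * x) * sin (d * y)"
    and dx: "sine_mode_dx a b k (x, y) = A * c * cos (c * x) * sin (d * y)"
    and dy: "sine_mode_dy a b k (x, y) = A * d * sin (c * x) * cos (d * y)" for x y
    by (simp_all add: sine_mode_def sine_mode_dx_def sine_mode_dy_def A_def c_def d_def)
  have d1: "((\<lambda>t. \<eta> (t, y)) has_vector_derivative \<eta>1 (x, y)) (at x)"
    and d2: "((\<lambda>t. \<eta> (x, t)) has_vector_derivative \<eta>2 (x, y)) (at y)"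
    and cont: "continuous_on UNIV \<eta>1" "continuous_on UNIV \<eta>2" for x y
    using \<eta> by (auto simp: C1c_def)
  obtain K where K: "K \<subseteq> rect a b" "\<And>z. z \<notin> K \<Longrightarrow> \<eta> z = 0"
    using \<eta> unfolding C1c_def by blast
  have zero: "\<eta> (0, y) = 0" "\<eta> (2*a, y) = 0" "\<eta> (x, 0) = 0" "\<eta> (x, 2*b) = 0" for x y
    using K by (auto simp: rect_def intro!: K(2))
  note cts = continuous_on_mult continuous_on_cnj continuous_on_of_real C1c_continuous[OF \<eta>] cont
    continuous_sine_mode continuous_sine_mode_dx continuous_sine_mode_dy
  have cont1: "continuous_on UNIV (\<lambda>x. cnj (\<eta>1 (x, y)))" "continuous_on UNIV (\<lambda>y. cnj (\<eta>2 (x, y)))" for x y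
    by (intro continuous_on_cnj continuous_on_compose2[OF cont(1)]
        continuous_on_compose2[OF cont(2)] continuous_intros subset_UNIV)+
  have x_parts: "integral {0..2*a} (\<lambda>x. cnj (\<eta>1 (x, y)) * of_real (sine_mode_dx a b k (x, y)))
      = of_real (c\<^sup>2) * integral {0..2*a} (\<lambda>x. cnj (\<eta> (x, y)) * of_real (sine_mode a b k (x, y)))" for y
  proof -
    have "integral {0..2*a} (\<lambda>x. cnj (\<eta>1 (x, y)) * of_real (sine_mode_dx a b k (x, y)))
        = - integral {0..2*a} (\<lambda>x. cnj (\<eta> (x, y)) * of_real (- (c\<^sup>2 * sine_mode a b k (x, y))))"
    proof (rule integral_by_parts_vanishing)
      show "((\<lambda>x. sine_mode_dx a b k (x, y)) has_real_derivative - (c\<^sup>2 * sine_mode a b k (x, y))) (at x)" for x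
        unfolding dx mode by (auto intro!: derivative_eq_intros simp: power2_eq_square)
      show "continuous_on UNIV (\<lambda>x. - (c\<^sup>2 * sine_mode a b k (x, y)))"
        unfolding mode by (intro continuous_intros)
    qed (use ab in \<open>auto intro!: has_vector_derivative_cnj d1 cont1 simp: zero\<close>)
    also have "\<dots> = integral {0..2*a} (\<lambda>x. of_real (c\<^sup>2) * (cnj (\<eta> (x, y)) * of_real (sine_mode a b k (x, y))))"
      by (subst integral_neg[symmetric]) (simp add: mult_ac)
    finally show ?thesis by simp
  qed
  have y_parts: "integral {0..2*b} (\<lambda>y. cnj (\<eta>2 (x, y)) * of_real (sine_mode_dy a b k (x, y)))
      = of_real (d\<^sup>2) * integral {0..2*b} (\<lambda>y. cnj (\<eta> (x, y)) * of_real (sine_mode a b k (x, y)))" for x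
  proof -
    have "integral {0..2*b} (\<lambda>y. cnj (\<eta>2 (x, y)) * of_real (sine_mode_dy a b k (x, y)))
        = - integral {0..2*b} (\<lambda>y. cnj (\<eta> (x, y)) * of_real (- (d\<^sup>2 * sine_mode a b k (x, y))))"
    proof (rule integral_by_parts_vanishing)
      show "((\<lambda>y. sine_mode_dy a b k (x, y)) has_real_derivative - (d\<^sup>2 * sine_mode a b k (x, y))) (at y)" for y
        unfolding dy mode by (auto intro!: derivative_eq_intros simp: power2_eq_square)
      show "continuous_on UNIV (\<lambda>y. - (d\<^sup>2 * sine_mode a b k (x, y)))"
        unfolding mode by (intro continuous_intros)
    qed (use ab in \<open>auto intro!: has_vector_derivative_cnj d2 cont1 simp: zero\<close>)
    also have "\<dots> = integral {0..2*b} (\<lambda>y. of_real (d\<^sup>2) * (cnj (\<eta> (x, y)) * of_real (sine_mode a b k (x, y))))"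
      by (subst integral_neg[symmetric]) (simp add: mult_ac)
    finally show ?thesis by simp
  qed
  have I: "L2_inner (rect a b) \<eta> (\<lambda>x. of_real (sine_mode a b k x))
      = integral {0..2*a} (\<lambda>x. integral {0..2*b} (\<lambda>y. cnj (\<eta> (x, y)) * of_real (sine_mode a b k (x, y))))"
    "L2_inner (rect a b) \<eta> (\<lambda>x. of_real (sine_mode a b k x))
      = integral {0..2*b} (\<lambda>y. integral {0..2*a} (\<lambda>x. cnj (\<eta> (x, y)) * of_real (sine_mode a b k (x, y))))"
    unfolding L2_inner_def by (rule LINT_rect LINT_rect_swap, intro cts)+
  have "L2_inner (rect a b) \<eta>1 (\<lambda>x. of_real (sine_mode_dx a b k x))
      = integral {0..2*b} (\<lambda>y. integral {0..2*a} (\<lambda>x. cnj (\<eta>1 (x, y)) * of_real (sine_mode_dx a b k (x, y))))"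
    unfolding L2_inner_def by (rule LINT_rect_swap, intro cts)
  also have "\<dots> = of_real (c\<^sup>2) * L2_inner (rect a b) \<eta> (\<lambda>x. of_real (sine_mode a b k x))"
    unfolding x_parts I(2) by simp
  finally have 1: "L2_inner (rect a b) \<eta>1 (\<lambda>x. of_real (sine_mode_dx a b k x)) = \<dots>" .
  have "L2_inner (rect a b) \<eta>2 (\<lambda>x. of_real (sine_mode_dy a b k x))
      = integral {0..2*a} (\<lambda>x. integral {0..2*b} (\<lambda>y. cnj (\<eta>2 (x, y)) * of_real (sine_mode_dy a b k (x, y))))"
    unfolding L2_inner_def by (rule LINT_rect, intro cts)
  also have "\<dots> = of_real (d\<^sup>2) * L2_inner (rect a b) \<eta> (\<lambda>x. of_real (sine_mode a b k x))"
    unfolding y_parts I(1) by simp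
  finally have 2: "L2_inner (rect a b) \<eta>2 (\<lambda>x. of_real (sine_mode_dy a b k x)) = \<dots>" .
  have "mode_energy a b k = c\<^sup>2 + d\<^sup>2"
    by (simp add: mode_energy_def c_def d_def power2_eq_square field_simps)
  thus ?thesis unfolding 1 2 by (simp add: distrib_right)
qed


section \<open>Sine modes lie in the form domain\<close>

lemma C1c_add:
  assumes "C1c \<Omega> v v1 v2" "C1c \<Omega> w w1 w2"
  shows "C1c \<Omega> (\<lambda>x. v x + w x) (\<lambda>x. v1 x + w1 x) (\<lambda>x. v2 x + w2 x)"
proof -
  obtain K K' where K: "compact K" "K \<subseteq> \<Omega>" "\<And>z. z \<notin> K \<Longrightarrow> v z = 0"
    and K': "compact K'" "K' \<subseteq> \<Omega>" "\<And>z. z \<notin> K' \<Longrightarrow> w z = 0"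
    using assms unfolding C1c_def by blast
  have "\<exists>K. compact K \<and> K \<subseteq> \<Omega> \<and> (\<forall>z. z \<notin> K \<longrightarrow> v z + w z = 0)"
    using K K' by (intro exI[of _ "K \<union> K'"]) auto
  thus ?thesis using assms unfolding C1c_def
    by (auto intro!: has_vector_derivative_add continuous_on_add)
qed

lemma C1c_scale:
  assumes "C1c \<Omega> v v1 v2"
  shows "C1c \<Omega> (\<lambda>x. c * v x) (\<lambda>x. c * v1 x) (\<lambda>x. c * v2 x)"
  using assms unfolding C1c_def
  by (auto intro!: has_vector_derivative_mult_right continuous_on_mult continuous_on_const)

lemma H1_0_add:
  assumes "H1_0 \<Omega> u G1 G2" "H1_0 \<Omega> u' G1' G2'"
  shows "H1_0 \<Omega> (\<lambda>x. u x + u' x) (\<lambda>x. G1 x + G1' x) (\<lambda>x. G2 x + G2' x)"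
proof -
  obtain v v1 v2 where v: "\<And>n. C1c \<Omega> (v n) (v1 n) (v2 n)" "L2_tendsto \<Omega> v u"
    "L2_tendsto \<Omega> v1 G1" "L2_tendsto \<Omega> v2 G2"
    using assms(1) unfolding H1_0_def by blast
  obtain w w1 w2 where w: "\<And>n. C1c \<Omega> (w n) (w1 n) (w2 n)" "L2_tendsto \<Omega> w u'"
    "L2_tendsto \<Omega> w1 G1'" "L2_tendsto \<Omega> w2 G2'"
    using assms(2) unfolding H1_0_def by blast
  show ?thesis unfolding H1_0_def
    using C1c_add[OF v(1) w(1)] L2_tendsto_add[OF v(2) w(2)] L2_tendsto_add[OF v(3) w(3)]
      L2_tendsto_add[OF v(4) w(4)]
    by (intro exI[of _ "\<lambda>n x. v n x + w n x"] exI[of _ "\<lambda>n x. v1 n x + w1 n x"]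
        exI[of _ "\<lambda>n x. v2 n x + w2 n x"] conjI allI)
qed

lemma H1_0_scale:
  assumes "H1_0 \<Omega> u G1 G2"
  shows "H1_0 \<Omega> (\<lambda>x. c * u x) (\<lambda>x. c * G1 x) (\<lambda>x. c * G2 x)"
proof -
  obtain v v1 v2 where v: "\<And>n. C1c \<Omega> (v n) (v1 n) (v2 n)" "L2_tendsto \<Omega> v u"
    "L2_tendsto \<Omega> v1 G1" "L2_tendsto \<Omega> v2 G2"
    using assms unfolding H1_0_def by blast
  show ?thesis unfolding H1_0_def
    using C1c_scale[OF v(1)] L2_tendsto_scale[OF v(2)] L2_tendsto_scale[OF v(3)]
      L2_tendsto_scale[OF v(4)]
    by (intro exI[of _ "\<lambda>n x. c * v n x"] exI[of _ "\<lambda>n x. c * v1 n x"]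
        exI[of _ "\<lambda>n x. c * v2 n x"] conjI allI)
qed

lemma H1_0_zero: "H1_0 \<Omega> (\<lambda>x. 0) (\<lambda>x. 0) (\<lambda>x. 0)"
proof -
  have "C1c \<Omega> (\<lambda>x. 0) (\<lambda>x. 0) (\<lambda>x. 0)"
    unfolding C1c_def
    by (intro conjI allI exI[of _ "{}"] has_vector_derivative_const continuous_on_const) simp_all
  moreover have "L2_tendsto \<Omega> (\<lambda>n x. 0) (\<lambda>x. 0)"
    by (simp add: L2_tendsto_def L2_zero L2_norm_def)
  ultimately show ?thesis unfolding H1_0_def
    by (intro exI[of _ "\<lambda>n x. 0"] conjI allI)
qed

lemma H1_0_sum:
  assumes "\<And>i. i \<in> I \<Longrightarrow> H1_0 \<Omega> (u i) (G1 i) (G2 i)"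
  shows "H1_0 \<Omega> (\<lambda>x. \<Sum>i\<in>I. u i x) (\<lambda>x. \<Sum>i\<in>I. G1 i x) (\<lambda>x. \<Sum>i\<in>I. G2 i x)"
  using assms
proof (induction I rule: infinite_finite_induct)
  case (insert i I)
  thus ?case using H1_0_add[of \<Omega> "u i" "G1 i" "G2 i"] by simp
qed (simp_all add: H1_0_zero)

text \<open>Diagonal argument: each \<open>u n\<close> has a \<open>C1c\<close> approximant that is
  within 1/(n+1) for the function and for both derivatives at once, as recorded by \<open>P\<close>.
  These approximants converge to the limit triple.\<close>

lemma H1_0_closed:
  assumes u: "\<And>n. H1_0 \<Omega> (u n) (g n) (h n)"
    and lim: "L2_tendsto \<Omega> u U" "L2_tendsto \<Omega> g G" "L2_tendsto \<Omega> h H"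
  shows "H1_0 \<Omega> U G H"
proof -
  define P where "P n v v1 v2 \<longleftrightarrow> C1c \<Omega> v v1 v2 \<and> v \<in> L2 \<Omega> \<and> v1 \<in> L2 \<Omega> \<and> v2 \<in> L2 \<Omega> \<and>
      L2_norm \<Omega> (\<lambda>x. v x - u n x) < 1 / real (Suc n) \<and>
      L2_norm \<Omega> (\<lambda>x. v1 x - g n x) < 1 / real (Suc n) \<and>
      L2_norm \<Omega> (\<lambda>x. v2 x - h n x) < 1 / real (Suc n)" for n v v1 v2
  have "\<exists>v v1 v2. P n v v1 v2" for n
  proof -
    obtain v v1 v2 where v: "\<And>k. C1c \<Omega> (v k) (v1 k) (v2 k)" "L2_tendsto \<Omega> v (u n)"
      "L2_tendsto \<Omega> v1 (g n)" "L2_tendsto \<Omega> v2 (h n)"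
      using u[of n] unfolding H1_0_def by blast
    let ?e = "1 / real (Suc n)"
    have "\<forall>\<^sub>F k in sequentially. L2_norm \<Omega> (\<lambda>x. v k x - u n x) < ?e \<and>
        L2_norm \<Omega> (\<lambda>x. v1 k x - g n x) < ?e \<and> L2_norm \<Omega> (\<lambda>x. v2 k x - h n x) < ?e"
      using v(2-4) unfolding L2_tendsto_def
      by (intro eventually_conj order_tendstoD(2)[where y = 0]) auto
    then obtain k where "L2_norm \<Omega> (\<lambda>x. v k x - u n x) < ?e"
        "L2_norm \<Omega> (\<lambda>x. v1 k x - g n x) < ?e" "L2_norm \<Omega> (\<lambda>x. v2 k x - h n x) < ?e"
      using eventually_happens'[OF sequentially_bot] by blast
    hence "P n (v k) (v1 k) (v2 k)" using v unfolding P_def L2_tendsto_def by simp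
    thus ?thesis by blast
  qed
  then obtain v v1 v2 where "\<And>n. P n (v n) (v1 n) (v2 n)" by metis
  hence v: "\<And>n. C1c \<Omega> (v n) (v1 n) (v2 n)"
    "\<And>n. v n \<in> L2 \<Omega>" "\<And>n. v1 n \<in> L2 \<Omega>" "\<And>n. v2 n \<in> L2 \<Omega>"
    "\<And>n. L2_norm \<Omega> (\<lambda>x. v n x - u n x) < 1 / real (Suc n)"
    "\<And>n. L2_norm \<Omega> (\<lambda>x. v1 n x - g n x) < 1 / real (Suc n)"
    "\<And>n. L2_norm \<Omega> (\<lambda>x. v2 n x - h n x) < 1 / real (Suc n)"
    unfolding P_def by simp_all
  show ?thesis unfolding H1_0_def
    by (intro exI[of _ v] exI[of _ v1] exI[of _ v2] conjI allI v(1)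
        L2_tendsto_diagonal[OF lim(1) v(5) v(2)] L2_tendsto_diagonal[OF lim(2) v(6) v(3)]
        L2_tendsto_diagonal[OF lim(3) v(7) v(4)])
qed

section \<open>Approximation of the sine modes by compactly supported functions\<close>

lemma DERIV_max_0_power2: "((\<lambda>t. (max 0 t)\<^sup>2) has_real_derivative 2 * max 0 t) (at t)"
proof (cases t "0 :: real" rule: linorder_cases)
  case less
  have "((\<lambda>t. 0) has_real_derivative 2 * max 0 t) (at t)" using less by simp
  thus ?thesis
    by (rule has_field_derivative_transform_within_open[of _ _ _ "{..<0}"]) (use less in auto)
next
  case greater
  have "((\<lambda>t. t\<^sup>2) has_real_derivative 2 * max 0 t) (at t)"
    using greater by (auto intro!: derivative_eq_intros)
  thus ?thesis
    by (rule has_field_derivative_transform_within_open[of _ _ _ "{0<..}"]) (use greater in auto)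
next
  case equal
  have "(\<lambda>h. ((max 0 h)\<^sup>2 - 0) / h) \<midarrow>0\<rightarrow> (0::real)"
  proof (rule Lim_null_comparison)
    show "\<forall>\<^sub>F h in at 0. norm (((max 0 h)\<^sup>2 - 0) / h) \<le> \<bar>h :: real\<bar>"
      by (intro always_eventually allI) (simp add: max_def power2_eq_square)
    show "(\<lambda>h::real. \<bar>h\<bar>) \<midarrow>0\<rightarrow> 0" by (rule tendsto_rabs_zero[OF tendsto_ident_at])
  qed
  thus ?thesis using equal by (simp add: DERIV_def)
qed

text \<open>With r = max 0 (t - 1) this is r^2/(1 + r^2): a continuously differentiable step that
  vanishes for t \<le> 1 and tends to 1. What matters is that t times its derivative is bounded and
  tends to 0, which makes the cutoff harmless after scaling towards the boundary.\<close>

definition cutoff :: "real \<Rightarrow> real" where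
  "cutoff t = (max 0 (t - 1))\<^sup>2 / (1 + (max 0 (t - 1))\<^sup>2)"

definition cutoff_deriv :: "real \<Rightarrow> real" where
  "cutoff_deriv t = 2 * max 0 (t - 1) / (1 + (max 0 (t - 1))\<^sup>2)\<^sup>2"

lemma one_plus_square_pos: "0 < 1 + (r::real)\<^sup>2" "1 + (r::real)\<^sup>2 \<noteq> 0"
  using zero_le_power2[of r] by linarith+

lemma DERIV_cutoff: "(cutoff has_real_derivative cutoff_deriv t) (at t)"
proof -
  have P: "((\<lambda>t. (max 0 (t - 1))\<^sup>2) has_real_derivative 2 * max 0 (t - 1)) (at t)"
  proof -
    have "((\<lambda>t. t - 1) has_real_derivative 1) (at t)" by (auto intro!: derivative_eq_intros)
    from DERIV_chain2[OF DERIV_max_0_power2 this] show ?thesis by simp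
  qed
  define m where "m = max 0 (t - 1)"
  have "(cutoff has_real_derivative
      (2 * m * (1 + m\<^sup>2) - m\<^sup>2 * (2 * m)) / ((1 + m\<^sup>2) * (1 + m\<^sup>2))) (at t)"
    unfolding cutoff_def[abs_def] m_def
    by (rule DERIV_divide[OF P], rule DERIV_cong[OF DERIV_add[OF DERIV_const[of 1] P]])
      (simp_all only: add_0_left one_plus_square_pos not_False_eq_True)
  moreover have "2 * m * (1 + m\<^sup>2) - m\<^sup>2 * (2 * m) = 2 * m" by (simp add: algebra_simps)
  ultimately show ?thesis unfolding cutoff_deriv_def m_def[symmetric]
    by (simp only: power2_eq_square)
qed

lemma continuous_cutoff_deriv: "continuous_on A cutoff_deriv"
  unfolding cutoff_deriv_def[abs_def]
  by (intro continuous_intros) (use one_plus_square_pos in auto)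

lemma cutoff_bounds: "0 \<le> cutoff t" "cutoff t \<le> 1" "0 \<le> cutoff_deriv t"
  unfolding cutoff_def cutoff_deriv_def using one_plus_square_pos by (auto simp: divide_le_eq)

lemma cutoff_eq_0: "t \<le> 1 \<Longrightarrow> cutoff t = 0"
  by (simp add: cutoff_def)

lemma cutoff_near_1: "t > 1 \<Longrightarrow> \<bar>cutoff t - 1\<bar> \<le> 1 / (t - 1)"
proof -
  assume t: "t > 1"
  define r where "r = t - 1"
  have r: "r > 0" using t by (simp add: r_def)
  have "cutoff t - 1 = - 1 / (1 + r\<^sup>2)"
    using r one_plus_square_pos[of r] by (simp add: cutoff_def r_def[symmetric] max_def field_simps)
  moreover have "1 / (1 + r\<^sup>2) \<le> 1 / r"
    using r sum_squares_bound[of 1 r] one_plus_square_pos[of r]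
    by (intro divide_left_mono) auto
  ultimately show ?thesis using one_plus_square_pos[of r] by (simp add: r_def abs_divide)
qed

lemma cutoff_deriv_decay: "t > 1 \<Longrightarrow> t * cutoff_deriv t \<le> 4 / (t - 1)"
proof -
  assume t: "t > 1"
  define r where "r = t - 1"
  have r: "r > 0" "t = r + 1" using t by (simp_all add: r_def)
  \<comment> \<open>The right side is
    \<open>4 * (1 + r\<^sup>2)\<^sup>2 - 2 * r\<^sup>2 * (r + 1)\<close>, regrouped so that a square
    absorbs the negative cubic term.\<close>
  have "0 \<le> 2 * (r * (r - 1))\<^sup>2 + 2 * r^4 + 6 * r\<^sup>2 + 4 - 2 * r\<^sup>2 + 2 * r^3"
    using r by (auto intro!: add_nonneg_nonneg)
  hence "(r + 1) * (2 * r) * r \<le> 4 * (1 + r\<^sup>2)\<^sup>2"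
    by (simp add: power2_eq_square power3_eq_cube power4_eq_xxxx algebra_simps)
  hence "(r + 1) * (2 * r) / (1 + r\<^sup>2)\<^sup>2 \<le> 4 / r"
    using r one_plus_square_pos[of r] by (simp add: field_simps)
  thus ?thesis using r by (simp add: cutoff_deriv_def)
qed

lemma cutoff_deriv_bound: "t * cutoff_deriv t \<le> 4"
proof (cases "t > 1")
  case True
  define r where "r = t - 1"
  have r: "r > 0" "t = r + 1" using True by (simp_all add: r_def)
  \<comment> \<open>Again the exact difference of the two sides of the next inequality, with the
    negative linear term completed to a square.\<close>
  have "0 \<le> (r - 1)\<^sup>2 + 3 + 5 * r\<^sup>2 + 4 * r^4" using r by (auto intro!: add_nonneg_nonneg)
  hence "(r + 1) * (2 * r) \<le> 4 * (1 + r\<^sup>2)\<^sup>2"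
    by (simp add: power2_eq_square power4_eq_xxxx algebra_simps)
  hence "(r + 1) * (2 * r) / (1 + r\<^sup>2)\<^sup>2 \<le> 4"
    using one_plus_square_pos[of r] by (simp add: divide_le_eq)
  thus ?thesis using r by (simp add: cutoff_deriv_def)
qed (simp add: cutoff_deriv_def)

text \<open>On the left half |sin(cx)| \<le> cx and L - x is at least L/2; the right half follows by
  reflection, since cL is a multiple of pi. So the sine vanishes at both ends at the rate of the
  parabola used as cutoff argument.\<close>

lemma abs_sine_le_parabola:
  assumes L: "L > 0" and x: "x \<in> {0<..<L}" and c: "c = real n * pi / L"
  shows "\<bar>sin (c * x)\<bar> \<le> 2 * c / L * (x * (L - x))"
proof -
  have c0: "c \<ge> 0" using L c by simp
  have le: "\<bar>sin (c * y)\<bar> \<le> 2 * c / L * (y * (L - y))" if y: "0 < y" "y \<le> L / 2" for y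
  proof -
    have "\<bar>sin (c * y)\<bar> \<le> c * y" using abs_sin_x_le_abs_x[of "c * y"] c0 y by simp
    also have "\<dots> = 2 * c / L * (y * (L / 2))" using L by simp
    also have "\<dots> \<le> 2 * c / L * (y * (L - y))" using y c0 L by (intro mult_left_mono) auto
    finally show ?thesis .
  qed
  show ?thesis
  proof (cases "x \<le> L / 2")
    case False
    have "sin (c * x) = sin (real n * pi - c * (L - x))"
      using L c by (simp add: field_simps)
    hence "\<bar>sin (c * x)\<bar> = \<bar>sin (c * (L - x))\<bar>"
      by (simp add: sin_diff cos_npi abs_mult power_abs)
    also have "\<dots> \<le> 2 * c / L * ((L - x) * (L - (L - x)))" using x False by (intro le) auto
    finally show ?thesis by (simp add: mult_ac)
  next
    case True
    show ?thesis by (rule le) (use x True in auto)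
  qed
qed

text \<open>The sine is multiplied by a cutoff in T = (k+1) x (L-x). The dangerous part of the
  derivative is \<open>g\<close>, where differentiating the cutoff produces a factor k+1. As the
  sine is at most a constant times x (L-x), that part is at most 2c T cutoff'(T), which is bounded
  uniformly in k and tends to 0 pointwise. The uniform bound \<open>B\<close> is there for bounded
  convergence.\<close>

lemma sine_cutoff_approximation:
  fixes L :: real and n :: nat
  assumes L: "L > 0" and c: "c = real n * pi / L"
  obtains f f' :: "nat \<Rightarrow> real \<Rightarrow> real" and B :: real where
    "\<And>k x. (f k has_real_derivative f' k x) (at x)" "\<And>k. continuous_on UNIV (f' k)"
    "\<And>k. \<exists>r s. 0 < r \<and> s < L \<and> (\<forall>x. x \<notin> {r..s} \<longrightarrow> f k x = 0)"
    "\<And>k x. x \<in> {0<..<L} \<Longrightarrow> \<bar>f k x\<bar> \<le> B" "\<And>k x. x \<in> {0<..<L} \<Longrightarrow> \<bar>f' k x\<bar> \<le> B"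
    "\<And>x. x \<in> {0<..<L} \<Longrightarrow> (\<lambda>k. f k x) \<longlonglongrightarrow> sin (c * x)"
    "\<And>x. x \<in> {0<..<L} \<Longrightarrow> (\<lambda>k. f' k x) \<longlonglongrightarrow> c * cos (c * x)"
proof
  define T where "T k x = real (Suc k) * (x * (L - x))" for k x
  define f where "f k x = sin (c * x) * cutoff (T k x)" for k x
  define g where "g k x = sin (c * x) * (cutoff_deriv (T k x) * (real (Suc k) * (L - 2 * x)))" for k x
  define f' where "f' k x = c * cos (c * x) * cutoff (T k x) + g k x" for k x
  have c0: "c \<ge> 0" using L c by simp
  have T_deriv: "(T k has_real_derivative real (Suc k) * (L - 2 * x)) (at x)" for k x
    unfolding T_def[abs_def] by (auto intro!: derivative_eq_intros simp: algebra_simps)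
  show "(f k has_real_derivative f' k x) (at x)" for k x
    unfolding f_def[abs_def] f'_def g_def
    using DERIV_chain2[OF DERIV_cutoff T_deriv, of k x]
    by (auto intro!: derivative_eq_intros)
  have cT: "continuous_on UNIV (T k)" for k
    by (intro continuous_at_imp_continuous_on ballI DERIV_isCont[OF T_deriv])
  have ccut: "continuous_on UNIV cutoff"
    by (intro continuous_at_imp_continuous_on ballI DERIV_isCont[OF DERIV_cutoff])
  show "continuous_on UNIV (f' k)" for k
    unfolding f'_def[abs_def] g_def
    by (intro continuous_intros continuous_on_compose2[OF ccut cT]
        continuous_on_compose2[OF continuous_cutoff_deriv cT]) auto
  show "\<exists>r s. 0 < r \<and> s < L \<and> (\<forall>x. x \<notin> {r..s} \<longrightarrow> f k x = 0)" for k
  proof (intro exI conjI allI impI)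
    \<comment> \<open>Within this distance of an end point, x (L-x) is at most
      \<open>\<delta> * L\<close> = 1/(k+1), so \<open>T k x \<le> 1\<close> and the cutoff
      vanishes; outside the interval x (L-x) is not positive.\<close>
    define \<delta> where "\<delta> = 1 / (real (Suc k) * L)"
    show "0 < \<delta>" "L - \<delta> < L" using L by (auto simp: \<delta>_def)
    fix x assume x: "x \<notin> {\<delta>..L - \<delta>}"
    have "T k x \<le> 1"
    proof (rule ccontr)
      assume "\<not> T k x \<le> 1"
      moreover have "\<delta> * L = 1 / real (Suc k)" using L by (simp add: \<delta>_def)
      ultimately have gt: "x * (L - x) > \<delta> * L"
        by (simp add: T_def divide_less_eq mult.commute)
      moreover have "\<delta> * L > 0" using \<open>0 < \<delta>\<close> L by simp
      ultimately have "x * (L - x) > 0" by linarith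
      hence x0: "x > 0" "L - x > 0" using L by (auto simp: zero_less_mult_iff)
      have "\<delta> * L < x * L" "\<delta> * L < L * (L - x)"
        using gt mult_strict_left_mono[of "L - x" L x] mult_strict_right_mono[of x L "L - x"] x0
        by linarith+
      hence "\<delta> < x" "\<delta> < L - x" using L by (auto simp: mult.commute)
      thus False using x by auto
    qed
    thus "f k x = 0" by (simp add: f_def cutoff_eq_0)
  qed
  have f_bound: "\<bar>f k x\<bar> \<le> 1" for k x
  proof -
    have "\<bar>sin (c * x)\<bar> * \<bar>cutoff (T k x)\<bar> \<le> 1 * 1"
      using cutoff_bounds[of "T k x"] by (intro mult_mono) auto
    thus ?thesis by (simp add: f_def abs_mult)
  qed
  have g_le: "\<bar>g k x\<bar> \<le> 2 * c * (T k x * cutoff_deriv (T k x))" if x: "x \<in> {0<..<L}" for k x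
  proof -
    define Y where "Y = 2 * c / L * (x * (L - x))"
    have x0: "0 \<le> Y" "\<bar>sin (c * x)\<bar> \<le> Y"
      using x c0 L abs_sine_le_parabola[OF L x c] by (simp_all add: Y_def)
    have x1: "\<bar>L - 2 * x\<bar> \<le> L" using x by auto
    have "\<bar>g k x\<bar> = \<bar>sin (c * x)\<bar> * cutoff_deriv (T k x) * real (Suc k) * \<bar>L - 2 * x\<bar>"
      using cutoff_bounds(3)[of "T k x"] by (simp add: g_def abs_mult)
    also have "\<dots> \<le> Y * cutoff_deriv (T k x) * real (Suc k) * L"
      using cutoff_bounds(3)[of "T k x"] x0 x1
      by (intro mult_mono mult_nonneg_nonneg) auto
    also have "\<dots> = 2 * c * (T k x * cutoff_deriv (T k x))" using L by (simp add: T_def Y_def)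
    finally show ?thesis .
  qed
  have f'_bound: "\<bar>f' k x\<bar> \<le> c + 8 * c" if x: "x \<in> {0<..<L}" for k x
  proof -
    have "\<bar>c * cos (c * x) * cutoff (T k x)\<bar> \<le> c * 1 * 1"
      unfolding abs_mult using cutoff_bounds[of "T k x"] c0 by (intro mult_mono) auto
    moreover have "\<bar>g k x\<bar> \<le> 2 * c * 4"
      using g_le[OF x, of k] mult_left_mono[OF cutoff_deriv_bound[of "T k x"], of "2 * c"] c0 by linarith
    ultimately show ?thesis unfolding f'_def by linarith
  qed
  \<comment> \<open>One constant for both families: 1 bounds the functions, and c + 8c bounds the
    derivatives.\<close>
  show "\<bar>f k x\<bar> \<le> 1 + 9 * c" for k x using f_bound[of k x] c0 by linarith
  show "\<bar>f' k x\<bar> \<le> 1 + 9 * c" if "x \<in> {0<..<L}" for k x using f'_bound[OF that, of k] by linarith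
  fix x assume x: "x \<in> {0<..<L}"
  have "x * (L - x) > 0" using x by simp
  hence "filterlim (\<lambda>k. T k x) at_top sequentially"
    unfolding T_def
    by (intro filterlim_at_top_mult_tendsto_pos[OF tendsto_const]
        filterlim_compose[OF filterlim_real_sequentially filterlim_Suc])
  hence T1: "filterlim (\<lambda>k. T k x - 1) at_top sequentially"
    using filterlim_tendsto_add_at_top[OF tendsto_const, of "\<lambda>k. T k x" sequentially "-1"] by simp
  have T_gt: "\<forall>\<^sub>F k in sequentially. T k x > 1"
    using T1[unfolded filterlim_at_top_dense, rule_format, of 0] by (rule eventually_mono) simp
  have inv0: "(\<lambda>k. d / (T k x - 1)) \<longlonglongrightarrow> 0" for d
    by (rule real_tendsto_divide_at_top[OF tendsto_const T1])
  have cut1: "(\<lambda>k. cutoff (T k x)) \<longlonglongrightarrow> 1"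
  proof (rule LIM_zero_cancel, rule Lim_null_comparison)
    show "\<forall>\<^sub>F k in sequentially. norm (cutoff (T k x) - 1) \<le> 1 / (T k x - 1)"
      using T_gt by (rule eventually_mono) (simp add: cutoff_near_1)
  qed (rule inv0)
  have g0: "(\<lambda>k. g k x) \<longlonglongrightarrow> 0"
  proof (rule Lim_null_comparison)
    show "\<forall>\<^sub>F k in sequentially. norm (g k x) \<le> 8 * c / (T k x - 1)"
      using T_gt
    proof (rule eventually_mono)
      fix k assume "T k x > 1"
      from mult_left_mono[OF cutoff_deriv_decay[OF this], of "2 * c"] g_le[OF x, of k] c0
      show "norm (g k x) \<le> 8 * c / (T k x - 1)" by simp
    qed
  qed (rule inv0)
  show "(\<lambda>k. f k x) \<longlonglongrightarrow> sin (c * x)"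
    unfolding f_def using tendsto_mult[OF tendsto_const cut1] by simp
  show "(\<lambda>k. f' k x) \<longlonglongrightarrow> c * cos (c * x)"
    unfolding f'_def using tendsto_add[OF tendsto_mult[OF tendsto_const cut1] g0] by simp
qed

text \<open>Products of the one-dimensional approximants are supported in a compact rectangle;
  bounded convergence handles the function and both partial derivatives.\<close>

lemma sine_mode_H1_0:
  assumes ab: "a > 0" "b > 0"
  shows "H1_0 (rect a b) (\<lambda>x. of_real (sine_mode a b k x))
    (\<lambda>x. of_real (sine_mode_dx a b k x)) (\<lambda>x. of_real (sine_mode_dy a b k x))"
proof -
  obtain n m where k [simp]: "k = (n, m)" by (cases k)
  define c where "c = real n * pi / (2 * a)"
  define d where "d = real m * pi / (2 * b)"
  define A where "A = 1 / sqrt (a * b)"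
  have ab2: "2 * a > 0" "2 * b > 0" using ab by simp_all
  have mode: "sine_mode a b k z = A * sin (c * fst z) * sin (d * snd z)"
    and dx: "sine_mode_dx a b k z = A * (c * cos (c * fst z)) * sin (d * snd z)"
    and dy: "sine_mode_dy a b k z = A * sin (c * fst z) * (d * cos (d * snd z))" for z
    by (simp_all add: sine_mode_def sine_mode_dx_def sine_mode_dy_def A_def c_def d_def case_prod_unfold)
  obtain f f' B where f: "\<And>k x. (f k has_real_derivative f' k x) (at x)"
    "\<And>k. continuous_on UNIV (f' k)"
    "\<And>k. \<exists>r s. 0 < r \<and> s < 2 * a \<and> (\<forall>x. x \<notin> {r..s} \<longrightarrow> f k x = 0)"
    "\<And>k x. x \<in> {0<..<2*a} \<Longrightarrow> \<bar>f k x\<bar> \<le> B" "\<And>k x. x \<in> {0<..<2*a} \<Longrightarrow> \<bar>f' k x\<bar> \<le> B"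
    "\<And>x. x \<in> {0<..<2*a} \<Longrightarrow> (\<lambda>k. f k x) \<longlonglongrightarrow> sin (c * x)"
    "\<And>x. x \<in> {0<..<2*a} \<Longrightarrow> (\<lambda>k. f' k x) \<longlonglongrightarrow> c * cos (c * x)"
    by (fact sine_cutoff_approximation[OF ab2(1) c_def])
  obtain g g' D where g: "\<And>k x. (g k has_real_derivative g' k x) (at x)"
    "\<And>k. continuous_on UNIV (g' k)"
    "\<And>k. \<exists>r s. 0 < r \<and> s < 2 * b \<and> (\<forall>x. x \<notin> {r..s} \<longrightarrow> g k x = 0)"
    "\<And>k x. x \<in> {0<..<2*b} \<Longrightarrow> \<bar>g k x\<bar> \<le> D" "\<And>k x. x \<in> {0<..<2*b} \<Longrightarrow> \<bar>g' k x\<bar> \<le> D"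
    "\<And>x. x \<in> {0<..<2*b} \<Longrightarrow> (\<lambda>k. g k x) \<longlonglongrightarrow> sin (d * x)"
    "\<And>x. x \<in> {0<..<2*b} \<Longrightarrow> (\<lambda>k. g' k x) \<longlonglongrightarrow> d * cos (d * x)"
    by (fact sine_cutoff_approximation[OF ab2(2) d_def])
  define v :: "nat \<Rightarrow> wavefun" where "v k z = of_real (A * f k (fst z) * g k (snd z))" for k z
  define v1 :: "nat \<Rightarrow> wavefun" where "v1 k z = of_real (A * f' k (fst z) * g k (snd z))" for k z
  define v2 :: "nat \<Rightarrow> wavefun" where "v2 k z = of_real (A * f k (fst z) * g' k (snd z))" for k z
  have cf: "continuous_on UNIV (f k)" and cg: "continuous_on UNIV (g k)" for k
    by (intro continuous_at_imp_continuous_on ballI DERIV_isCont[OF f(1)] DERIV_isCont[OF g(1)])+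
  have cv: "continuous_on UNIV (v k)" "continuous_on UNIV (v1 k)" "continuous_on UNIV (v2 k)" for k
    unfolding v_def[abs_def] v1_def[abs_def] v2_def[abs_def]
    by (intro continuous_intros continuous_on_compose2[OF cf] continuous_on_compose2[OF cg]
        continuous_on_compose2[OF f(2)] continuous_on_compose2[OF g(2)] subset_UNIV)+
  have C1c: "C1c (rect a b) (v k) (v1 k) (v2 k)" for k
    unfolding C1c_def
  proof (intro conjI allI cv)
    show "((\<lambda>t. v k (t, y)) has_vector_derivative v1 k (x, y)) (at x)" for x y
      unfolding v_def v1_def fst_conv snd_conv
      by (intro has_vector_derivative_of_real DERIV_cmult DERIV_cmult_right f(1))
    show "((\<lambda>t. v k (x, t)) has_vector_derivative v2 k (x, y)) (at y)" for x y
      unfolding v_def v2_def fst_conv snd_conv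
      by (intro has_vector_derivative_of_real DERIV_cmult DERIV_cmult_right g(1))
    obtain r s r' s' where rs: "0 < r" "s < 2 * a" "\<And>x. x \<notin> {r..s} \<Longrightarrow> f k x = 0"
      "0 < r'" "s' < 2 * b" "\<And>x. x \<notin> {r'..s'} \<Longrightarrow> g k x = 0"
      using f(3)[of k] g(3)[of k] by blast
    show "\<exists>K. compact K \<and> K \<subseteq> rect a b \<and> (\<forall>z. z \<notin> K \<longrightarrow> v k z = 0)"
    proof (intro exI conjI allI impI)
      show "compact ({r..s} \<times> {r'..s'})" by (intro compact_Times compact_Icc)
      show "{r..s} \<times> {r'..s'} \<subseteq> rect a b" using rs by (auto simp: rect_def)
      show "v k z = 0" if "z \<notin> {r..s} \<times> {r'..s'}" for z
        using that rs(3)[of "fst z"] rs(6)[of "snd z"] by (auto simp: v_def mem_Times_iff)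
    qed
  qed
  have prod_bound: "\<bar>A * s * t\<bar> \<le> \<bar>A\<bar> * B * D" if "\<bar>s\<bar> \<le> B" "\<bar>t\<bar> \<le> D" for s t
  proof -
    have "0 \<le> B" "0 \<le> D" using that by linarith+
    thus ?thesis unfolding abs_mult using that by (intro mult_mono) auto
  qed
  have lim: "L2_tendsto (rect a b) v (\<lambda>x. of_real (sine_mode a b k x))"
    "L2_tendsto (rect a b) v1 (\<lambda>x. of_real (sine_mode_dx a b k x))"
    "L2_tendsto (rect a b) v2 (\<lambda>x. of_real (sine_mode_dy a b k x))"
  proof -
    have R: "fst z \<in> {0<..<2*a}" "snd z \<in> {0<..<2*b}" if "z \<in> rect a b" for z
      using that by (auto simp: rect_def)
    note bds = prod_bound f(4,5) g(4,5) R
    show "L2_tendsto (rect a b) v (\<lambda>x. of_real (sine_mode a b k x))"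
    proof (rule L2_tendsto_bounded_convergence[OF rect_lmeasurable])
      show "cmod (v k z) \<le> \<bar>A\<bar> * B * D" if "z \<in> rect a b" for k z
        unfolding v_def norm_of_real by (intro bds that)
      show "(\<lambda>k. v k z) \<longlonglongrightarrow> of_real (sine_mode a b k z)" if "z \<in> rect a b" for z
        unfolding v_def mode
        by (intro tendsto_of_real tendsto_mult tendsto_const f(6) g(6) R that)
    qed (rule continuous_measurable_rect[OF cv(1)])
    show "L2_tendsto (rect a b) v1 (\<lambda>x. of_real (sine_mode_dx a b k x))"
    proof (rule L2_tendsto_bounded_convergence[OF rect_lmeasurable])
      show "cmod (v1 k z) \<le> \<bar>A\<bar> * B * D" if "z \<in> rect a b" for k z
        unfolding v1_def norm_of_real by (intro bds that)
      show "(\<lambda>k. v1 k z) \<longlonglongrightarrow> of_real (sine_mode_dx a b k z)" if "z \<in> rect a b" for z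
        unfolding v1_def dx
        by (intro tendsto_of_real tendsto_mult[OF tendsto_mult] tendsto_const f(7) g(6) R that)
    qed (rule continuous_measurable_rect[OF cv(2)])
    show "L2_tendsto (rect a b) v2 (\<lambda>x. of_real (sine_mode_dy a b k x))"
    proof (rule L2_tendsto_bounded_convergence[OF rect_lmeasurable])
      show "cmod (v2 k z) \<le> \<bar>A\<bar> * B * D" if "z \<in> rect a b" for k z
        unfolding v2_def norm_of_real by (intro bds that)
      show "(\<lambda>k. v2 k z) \<longlonglongrightarrow> of_real (sine_mode_dy a b k z)" if "z \<in> rect a b" for z
        unfolding v2_def dy
        by (intro tendsto_of_real tendsto_mult[OF tendsto_mult] tendsto_const f(6) g(7) R that)
    qed (rule continuous_measurable_rect[OF cv(3)])
  qed
  show ?thesis unfolding H1_0_def using C1c lim by blast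
qed


section \<open>A polynomial kernel concentrating at the centre\<close>

text \<open>Binomial expansion of (e^(i\<theta>) + e^(-i\<theta>))^(2N+1), of which the real part is
  taken.\<close>

lemma cos_odd_power:
  fixes \<theta> :: real
  shows "4 ^ N * cos \<theta> ^ (2 * N + 1)
    = (\<Sum>s\<le>N. real ((2 * N + 1) choose (N - s)) * cos (real (2 * s + 1) * \<theta>))"
proof -
  define n where "n = 2 * N + 1"
  define t where "t k = real (n choose k) * cos ((real n - 2 * real k) * \<theta>)" for k
  have "complex_of_real (2 * cos \<theta>) = cis (- \<theta>) + cis \<theta>"
    by (simp add: complex_eq_iff)
  hence "complex_of_real ((2 * cos \<theta>) ^ n) = (cis (- \<theta>) + cis \<theta>) ^ n"
    by (simp only: of_real_power)
  also have "\<dots> = (\<Sum>k\<le>n. of_nat (n choose k) * cis (- \<theta>) ^ k * cis \<theta> ^ (n - k))"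
    by (rule binomial_ring)
  also have "\<dots> = (\<Sum>k\<le>n. of_nat (n choose k) * cis ((real n - 2 * real k) * \<theta>))"
  proof (intro sum.cong refl)
    fix k assume "k \<in> {..n}"
    hence "real k * (- \<theta>) + real (n - k) * \<theta> = (real n - 2 * real k) * \<theta>"
      by (simp add: of_nat_diff algebra_simps)
    hence "cis (- \<theta>) ^ k * cis \<theta> ^ (n - k) = cis ((real n - 2 * real k) * \<theta>)"
      by (simp only: Complex.DeMoivre cis_mult)
    thus "of_nat (n choose k) * cis (- \<theta>) ^ k * cis \<theta> ^ (n - k)
        = of_nat (n choose k) * cis ((real n - 2 * real k) * \<theta>)"
      by (simp only: mult.assoc)
  qed
  finally have "Re (complex_of_real ((2 * cos \<theta>) ^ n)) = Re (\<Sum>k\<le>n. of_nat (n choose k) * cis ((real n - 2 * real k) * \<theta>))"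
    by (rule arg_cong)
  hence "(2 * cos \<theta>) ^ n = (\<Sum>k\<le>n. t k)"
    by (simp add: t_def del: of_real_power of_real_mult)
  \<comment> \<open>\<open>n\<close> is odd, so there is no middle term: \<open>k\<close> and
    \<open>n - k\<close> pair the two halves, and their terms agree because the cosine is
    even.\<close>
  also have "{..n} = {..N} \<union> {N+1..n}" by (auto simp: n_def)
  also have "sum t ({..N} \<union> {N+1..n}) = sum t {..N} + sum t {N+1..n}"
    by (rule sum.union_disjoint) auto
  also have "sum t {N+1..n} = sum t {..N}"
  proof (rule sum.reindex_bij_witness[of _ "\<lambda>k. n - k" "\<lambda>k. n - k"])
    fix k assume k: "k \<in> {N+1..n}"
    hence "n choose (n - k) = n choose k" using binomial_symmetric[of k n] by simp
    moreover have "cos ((real n - 2 * real (n - k)) * \<theta>) = cos (- ((real n - 2 * real k) * \<theta>))"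
      using k by (simp add: of_nat_diff algebra_simps)
    ultimately show "t (n - k) = t k" by (simp add: t_def)
  qed (auto simp: n_def)
  also have "sum t {..N} = (\<Sum>s\<le>N. real (n choose (N - s)) * cos (real (2 * s + 1) * \<theta>))"
  proof (rule sum.reindex_bij_witness[of _ "\<lambda>s. N - s" "\<lambda>k. N - k"])
    fix k assume "k \<in> {..N}"
    thus "real (n choose (N - (N - k))) * cos (real (2 * (N - k) + 1) * \<theta>) = t k"
      by (simp add: t_def n_def of_nat_diff algebra_simps)
  qed auto
  finally have "(2 * cos \<theta>) ^ n
      = 2 * (\<Sum>s\<le>N. real (n choose (N - s)) * cos (real (2 * s + 1) * \<theta>))" by simp
  moreover have "(2 * cos \<theta>) ^ n = 2 * (4 ^ N * cos \<theta> ^ n)"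
    by (simp add: n_def power_mult_distrib power_mult)
  ultimately show ?thesis unfolding n_def by linarith
qed

text \<open>Fourier weights of a kernel of de la Vallee Poussin type for odd frequencies, divided by
  the central binomial so that the weight of the lowest frequency is 1. They serve as summation
  weights: between 0 and 1, zero beyond \<open>N\<close>, and tending to 1 for each fixed
  frequency.\<close>

definition kernel_coeff :: "nat \<Rightarrow> nat \<Rightarrow> real" where
  "kernel_coeff N s = (if s \<le> N then real ((2 * N + 1) choose (N - s)) / real ((2 * N + 1) choose N) else 0)"

text \<open>The value of the normalised kernel at its peak, where the sine is 1.\<close>

definition kernel_height :: "nat \<Rightarrow> real" where
  "kernel_height N = 4 ^ N / real ((2 * N + 1) choose N)"

text \<open>The quotient of neighbouring binomials. It lies in [0, 1] and tends to 1 as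
  \<open>N\<close> grows, so induction on \<open>s\<close> gives both the bounds and the limit of
  the weights.\<close>

lemma kernel_coeff_Suc:
  assumes "s < N"
  shows "kernel_coeff N (Suc s) = kernel_coeff N s * (real (N - s) / real (N + s + 2))"
proof -
  define k where "k = N - Suc s"
  have k: "N - s = Suc k" "2 * N + 1 - k = N + s + 2" using assms by (auto simp: k_def)
  \<comment> \<open>Both sides equal (2N+1) times the binomial of 2N over \<open>k\<close>.\<close>
  have "(2 * N + 1 - k) * ((2 * N + 1) choose k) = Suc k * ((2 * N + 1) choose Suc k)"
    using binomial_absorb_comp[of "2 * N + 1" k] binomial_absorption[of k "2 * N + 1"] by simp
  hence "real (N + s + 2) * real ((2 * N + 1) choose k) = real (N - s) * real ((2 * N + 1) choose (N - s))"
    unfolding k by (metis of_nat_mult)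
  hence "real ((2 * N + 1) choose k) = real ((2 * N + 1) choose (N - s)) * (real (N - s) / real (N + s + 2))"
    by (simp add: field_simps)
  thus ?thesis using assms by (simp add: kernel_coeff_def k_def)
qed

lemma kernel_coeff_0: "kernel_coeff N 0 = 1"
  by (simp add: kernel_coeff_def)

lemma kernel_coeff_bounds: "0 \<le> kernel_coeff N s" "kernel_coeff N s \<le> 1"
proof -
  show ge: "0 \<le> kernel_coeff N s" for s by (simp add: kernel_coeff_def)
  show "kernel_coeff N s \<le> 1"
  proof (induction s)
    case (Suc s)
    show ?case
    proof (cases "s < N")
      case True
      have "kernel_coeff N s * (real (N - s) / real (N + s + 2)) \<le> 1 * 1"
        using Suc.IH ge[of s] by (intro mult_mono) auto
      thus ?thesis by (simp add: kernel_coeff_Suc[OF True])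
    qed (simp add: kernel_coeff_def)
  qed (simp add: kernel_coeff_0)
qed

lemma kernel_coeff_tendsto: "(\<lambda>N. kernel_coeff N s) \<longlonglongrightarrow> 1"
proof (induction s)
  case (Suc s)
  have "(\<lambda>N. 1 - real (2 * s + 2) / real (N + (s + 2))) \<longlonglongrightarrow> 1 - 0"
    by (intro tendsto_diff tendsto_const LIMSEQ_ignore_initial_segment lim_const_over_n)
  from tendsto_mult[OF Suc.IH this]
  have "(\<lambda>N. kernel_coeff N s * (1 - real (2 * s + 2) / real (N + (s + 2)))) \<longlonglongrightarrow> 1" by simp
  moreover have "\<forall>\<^sub>F N in sequentially.
      kernel_coeff N s * (1 - real (2 * s + 2) / real (N + (s + 2))) = kernel_coeff N (Suc s)"
    using eventually_gt_at_top[of s]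
  proof (rule eventually_mono)
    fix N assume "s < N"
    thus "kernel_coeff N s * (1 - real (2 * s + 2) / real (N + (s + 2))) = kernel_coeff N (Suc s)"
      by (simp add: kernel_coeff_Suc of_nat_diff field_simps)
  qed
  ultimately show ?case by (rule Lim_transform_eventually)
qed (simp add: kernel_coeff_0)

lemma sin_odd_multiple_half_pi: "sin (real (2 * s + 1) * (pi / 2)) = (-1) ^ s"
proof -
  have eq: "real (2 * s + 1) * (pi / 2) = pi / 2 + real s * pi" by (simp add: field_simps)
  show ?thesis unfolding eq by (simp add: sin_add cos_npi)
qed

lemma cos_odd_multiple_half_pi: "cos (real (2 * s + 1) * (pi / 2)) = 0"
proof -
  have eq: "real (2 * s + 1) * (pi / 2) = pi / 2 + real s * pi" by (simp add: field_simps)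
  show ?thesis unfolding eq by (simp add: cos_add)
qed

text \<open>The cosine expansion at pi/2 - y. The factor (-1)^s that appears is the value of the odd
  mode at the midpoint, which is why the kernel pairs with values at the centre.\<close>

lemma sin_odd_power_kernel:
  "kernel_height N * sin y ^ (2 * N + 1)
    = (\<Sum>s\<le>N. kernel_coeff N s * ((-1) ^ s * sin (real (2 * s + 1) * y)))"
proof -
  have C: "real ((2 * N + 1) choose N) \<noteq> 0" by (simp add: binomial_eq_0_iff)
  have "cos (real (2 * s + 1) * (pi / 2 - y)) = (-1) ^ s * sin (real (2 * s + 1) * y)" for s
    unfolding right_diff_distrib cos_diff sin_odd_multiple_half_pi cos_odd_multiple_half_pi by simp
  hence "4 ^ N * cos (pi / 2 - y) ^ (2 * N + 1)
      = (\<Sum>s\<le>N. real ((2 * N + 1) choose (N - s)) * ((-1) ^ s * sin (real (2 * s + 1) * y)))"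
    by (simp only: cos_odd_power)
  hence "kernel_height N * sin y ^ (2 * N + 1)
      = (\<Sum>s\<le>N. real ((2 * N + 1) choose (N - s)) * ((-1) ^ s * sin (real (2 * s + 1) * y)))
        / real ((2 * N + 1) choose N)"
    by (simp add: kernel_height_def cos_diff)
  also have "\<dots> = (\<Sum>s\<le>N. kernel_coeff N s * ((-1) ^ s * sin (real (2 * s + 1) * y)))"
    unfolding sum_divide_distrib by (intro sum.cong) (auto simp: kernel_coeff_def)
  finally show ?thesis .
qed

lemma kernel_height_0: "kernel_height 0 = 1"
  by (simp add: kernel_height_def)

lemma kernel_height_pos: "kernel_height N > 0"
  by (simp add: kernel_height_def zero_less_binomial_iff)

text \<open>Two absorption identities connect the binomials of 2N+1 and 2N+3 through
  \<open>D\<close>, the binomial of 2N+2.\<close>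

lemma kernel_height_Suc:
  "kernel_height (Suc N) = kernel_height N * (2 * (real N + 2) / (2 * real N + 3))"
proof -
  define B where "B = real ((2 * N + 1) choose N)"
  define D where "D = real ((2 * N + 2) choose N)"
  define F where "F = real ((2 * N + 3) choose Suc N)"
  have pos: "B > 0" by (simp add: B_def zero_less_binomial_iff)
  have "(2 * N + 2 - N) * ((2 * N + 2) choose N) = (2 * N + 2) * ((2 * N + 1) choose N)"
    using binomial_absorb_comp[of "2 * N + 2" N] by simp
  hence "real (2 * N + 2 - N) * D = real (2 * N + 2) * B"
    unfolding B_def D_def by (metis of_nat_mult)
  hence D: "(real N + 2) * D = (2 * real N + 2) * B" by (simp add: add.commute)
  have "Suc N * ((2 * N + 3) choose Suc N) = (2 * N + 3) * ((2 * N + 2) choose N)"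
    using binomial_absorption[of N "2 * N + 3"] by simp
  hence "real (Suc N) * F = real (2 * N + 3) * D"
    unfolding F_def D_def by (metis of_nat_mult)
  hence "(real N + 1) * F = (2 * real N + 3) * D" by (simp add: add.commute)
  hence "(real N + 1) * ((real N + 2) * F) = (2 * real N + 3) * ((real N + 2) * D)" by simp
  also have "\<dots> = (real N + 1) * (2 * (2 * real N + 3) * B)"
    unfolding D by (simp add: algebra_simps)
  finally have F: "(real N + 2) * F = 2 * (2 * real N + 3) * B" by simp
  have "4 ^ N * (2 * (real N + 2)) * F = 4 ^ N * 2 * ((real N + 2) * F)" by simp
  also have "\<dots> = 4 ^ Suc N * (B * (2 * real N + 3))" unfolding F by simp
  finally have "4 ^ Suc N * (B * (2 * real N + 3)) = 4 ^ N * (2 * (real N + 2)) * F" ..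
  moreover have "F > 0" by (simp add: F_def zero_less_binomial_iff)
  ultimately have "4 ^ Suc N / F = 4 ^ N / B * (2 * (real N + 2) / (2 * real N + 3))"
    using pos unfolding times_divide_times_eq by (subst frac_eq_eq) auto
  thus ?thesis by (simp add: kernel_height_def B_def F_def numeral_3_eq_3)
qed

text \<open>A crude bound, since the true growth is of order sqrt N; geometric decay away from the
  peak beats any polynomial.\<close>

lemma kernel_height_le: "kernel_height N \<le> real N + 1"
proof (induction N)
  case (Suc N)
  have "kernel_height N * (2 * (real N + 2) / (2 * real N + 3)) \<le> (real N + 1) * (2 * (real N + 2) / (2 * real N + 3))"
    using Suc.IH by (intro mult_right_mono) auto
  also have "\<dots> \<le> real N + 2" by (simp add: divide_le_eq algebra_simps)
  finally show ?case unfolding kernel_height_Suc by simp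
qed (simp add: kernel_height_0)

text \<open>The Wallis recursion multiplies the integral by (2N+2)/(2N+3) and the height grows by
  (2N+4)/(2N+3). The product of the two factors is at most 1, so the mass never exceeds its value at
  N = 0, which is at most \<open>L\<close>.\<close>

lemma kernel_integral_le:
  assumes L: "L > 0"
  shows "kernel_height N * integral {0..L} (\<lambda>x. sin (pi * x / L) ^ (2 * N + 1)) \<le> L"
proof -
  define c where "c = pi / L"
  have c: "c > 0" "c * L = pi" using L by (auto simp: c_def)
  define J where "J N = integral {0..L} (\<lambda>x. sin (c * x) ^ (2 * N + 1))" for N
  have int: "(\<lambda>x. sin (c * x) ^ k) integrable_on {0..L}" for k
    by (intro integrable_continuous_real continuous_intros)
  have J_pos: "J N \<ge> 0" for N
    unfolding J_def using c L
    by (intro integral_nonneg int) (auto intro!: sin_ge_zero zero_le_power simp del: power_Suc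
        simp: field_simps c_def)
  have J_0: "J 0 \<le> L"
  proof -
    have "J 0 \<le> integral {0..L} (\<lambda>x. 1)"
      unfolding J_def using int[of 1] by (intro integral_le) auto
    thus ?thesis using L by simp
  qed
  have J_Suc: "(2 * real N + 3) * J (Suc N) = (2 * real N + 2) * J N" for N
  proof -
    \<comment> \<open>An antiderivative of the combination in the Wallis recursion, after cos^2 = 1
      - sin^2; it vanishes at both ends.\<close>
    define F where "F x = - (cos (c * x) * sin (c * x) ^ Suc (2 * N + 1))" for x
    have "((\<lambda>x. c * ((2 * real N + 3) * sin (c * x) ^ (2 * Suc N + 1) - (2 * real N + 2) * sin (c * x) ^ (2 * N + 1)))
        has_integral (F L - F 0)) {0..L}"
    proof (rule fundamental_theorem_of_calculus)
      fix x
      define s where "s = sin (c * x)"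
      define P where "P = s ^ (2 * N + 1)"
      have sq: "cos (c * x) * cos (c * x) = 1 - s * s"
        using sin_cos_squared_add[of "c * x"] by (simp add: power2_eq_square s_def)
      have ds: "((\<lambda>x. sin (c * x)) has_real_derivative c * cos (c * x)) (at x within {0..L})"
        and dc: "((\<lambda>x. cos (c * x)) has_real_derivative - (c * sin (c * x))) (at x within {0..L})"
        by (auto intro!: derivative_eq_intros)
      have "- (- (c * s) * s ^ Suc (2 * N + 1)
            + (1 + real (2 * N + 1)) * (c * cos (c * x) * s ^ (2 * N + 1)) * cos (c * x))
          = c * s * (s * P) - (2 * real N + 2) * c * P * (cos (c * x) * cos (c * x))"
        by (simp add: P_def algebra_simps)
      also have "\<dots> = c * ((2 * real N + 3) * (s * s * P) - (2 * real N + 2) * P)"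
        unfolding sq by (simp add: algebra_simps)
      also have "s * s * P = s ^ (2 * Suc N + 1)" by (simp add: P_def)
      finally have "- (- (c * s) * s ^ Suc (2 * N + 1)
            + (1 + real (2 * N + 1)) * (c * cos (c * x) * s ^ (2 * N + 1)) * cos (c * x))
          = c * ((2 * real N + 3) * s ^ (2 * Suc N + 1) - (2 * real N + 2) * s ^ (2 * N + 1))"
        unfolding P_def .
      from DERIV_cong[OF DERIV_minus[OF DERIV_mult[OF dc DERIV_power_Suc[OF ds]]] this[unfolded s_def]]
      show "(F has_vector_derivative
          c * ((2 * real N + 3) * sin (c * x) ^ (2 * Suc N + 1) - (2 * real N + 2) * sin (c * x) ^ (2 * N + 1)))
          (at x within {0..L})"
        unfolding F_def[abs_def] has_real_derivative_iff_has_vector_derivative s_def .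
    qed (use L in auto)
    moreover have "F L = 0" "F 0 = 0"
      unfolding F_def c(2) by simp_all
    ultimately have "integral {0..L} (\<lambda>x. c * ((2 * real N + 3) * sin (c * x) ^ (2 * Suc N + 1) - (2 * real N + 2) * sin (c * x) ^ (2 * N + 1))) = 0"
      by (simp only: integral_unique diff_self)
    moreover have "integral {0..L} (\<lambda>x. c * ((2 * real N + 3) * sin (c * x) ^ (2 * Suc N + 1) - (2 * real N + 2) * sin (c * x) ^ (2 * N + 1)))
        = c * ((2 * real N + 3) * J (Suc N) - (2 * real N + 2) * J N)"
      unfolding J_def integral_mult_right
      by (subst Henstock_Kurzweil_Integration.integral_diff)
         (intro integrable_on_mult_right int, intro integrable_on_mult_right int, simp only: integral_mult_right)
    ultimately show ?thesis using c by simp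
  qed
  have "kernel_height N * J N \<le> L"
  proof (induction N)
    case (Suc N)
    have J: "J (Suc N) = (2 * real N + 2) / (2 * real N + 3) * J N"
      using J_Suc[of N] by (simp add: field_simps)
    have "(2 * (real N + 2)) * (2 * real N + 2) \<le> (2 * real N + 3) * (2 * real N + 3)"
      by (simp add: algebra_simps)
    moreover have "0 < (2 * real N + 3) * (2 * real N + 3)" by (intro mult_pos_pos) simp_all
    ultimately have "2 * (real N + 2) / (2 * real N + 3) * ((2 * real N + 2) / (2 * real N + 3)) \<le> 1"
      unfolding times_divide_times_eq by (simp only: divide_le_eq_1_pos)
    moreover have "kernel_height (Suc N) * J (Suc N)
        = (2 * (real N + 2) / (2 * real N + 3) * ((2 * real N + 2) / (2 * real N + 3))) * (kernel_height N * J N)"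
      unfolding kernel_height_Suc J by simp
    ultimately have "kernel_height (Suc N) * J (Suc N) \<le> 1 * (kernel_height N * J N)"
      using J_pos[of N] kernel_height_pos[of N] by (metis mult_right_mono mult_nonneg_nonneg less_imp_le)
    thus ?case using Suc.IH by simp
  qed (simp add: kernel_height_0 J_0)
  thus ?thesis by (simp add: J_def c_def)
qed

section \<open>The two-dimensional kernel at the centre of the rectangle\<close>

lemma sin_eq_1_imp:
  assumes "0 \<le> z" "z \<le> pi" "sin z = 1"
  shows "z = pi / 2"
proof (cases z "pi / 2" rule: linorder_cases)
  case less
  thus ?thesis using sin_monotone_2pi[of z "pi / 2"] assms by simp
next
  case greater
  have "sin (pi - z) < sin (pi / 2)" using greater assms by (intro sin_monotone_2pi) auto
  thus ?thesis using assms by simp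
qed

text \<open>It plays the part of an approximate identity at the centre: nonnegative on the
  rectangle, of bounded mass, and concentrating. Odd exponents make it a combination of modes with
  both indices odd, the ones that are nonzero at the centre.\<close>

definition centre_kernel :: "real \<Rightarrow> real \<Rightarrow> nat \<Rightarrow> real \<times> real \<Rightarrow> real" where
  "centre_kernel a b N = (\<lambda>(x, y). kernel_height N * sin (pi * x / (2 * a)) ^ (2 * N + 1)
     * (kernel_height N * sin (pi * y / (2 * b)) ^ (2 * N + 1)))"

lemma continuous_centre_kernel: "continuous_on A (centre_kernel a b N)"
  unfolding centre_kernel_def case_prod_unfold divide_inverse by (intro continuous_intros)

lemma sin_rect_nonneg:
  assumes "a > 0" "0 \<le> x" "x \<le> 2 * a"
  shows "0 \<le> sin (pi * x / (2 * a))"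
proof (rule sin_ge_zero)
  show "pi * x / (2 * a) \<le> pi"
    using assms mult_left_mono[of x "2 * a" pi] by (simp add: divide_le_eq)
qed (use assms in auto)

lemma centre_kernel_nonneg:
  assumes "a > 0" "b > 0" "x \<in> cbox (0, 0) (2 * a, 2 * b)"
  shows "0 \<le> centre_kernel a b N x"
proof -
  obtain u v where x: "x = (u, v)" by (cases x)
  thus ?thesis using assms kernel_height_pos[of N] sin_rect_nonneg[of a u] sin_rect_nonneg[of b v]
    by (auto simp: centre_kernel_def intro!: mult_nonneg_nonneg)
qed

lemma LINT_centre_kernel_le:
  assumes ab: "a > 0" "b > 0"
  shows "(LINT x|lebesgue_on (rect a b). centre_kernel a b N x) \<le> 4 * a * b"
proof -
  define I where "I L = kernel_height N * integral {0..L} (\<lambda>x. sin (pi * x / L) ^ (2 * N + 1))" for L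
  have I: "0 \<le> I (2*c)" "I (2*c) \<le> 2 * c" if "c > 0" for c
  proof -
    have "0 \<le> integral {0..2*c} (\<lambda>x. sin (pi * x / (2*c)) ^ (2 * N + 1))"
      using that by (intro integral_nonneg integrable_continuous_real continuous_intros)
        (auto intro!: zero_le_power sin_rect_nonneg simp del: power_Suc)
    thus "0 \<le> I (2*c)" unfolding I_def using kernel_height_pos[of N] by simp
    show "I (2*c) \<le> 2 * c" unfolding I_def using that by (intro kernel_integral_le) simp
  qed
  have "(LINT x|lebesgue_on (rect a b). centre_kernel a b N x)
      = integral {0..2*a} (\<lambda>x. integral {0..2*b} (\<lambda>y. centre_kernel a b N (x, y)))"
    by (rule LINT_rect[OF continuous_centre_kernel])
  also have "\<dots> = I (2*a) * I (2*b)"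
    unfolding centre_kernel_def prod.case integral_mult_right integral_mult_left I_def by simp
  also have "\<dots> \<le> (2 * a) * (2 * b)" using I ab by (intro mult_mono) auto
  finally show ?thesis by simp
qed

text \<open>The product \<open>g\<close> of the two sines equals 1 on the closed rectangle only at
  the centre. By compactness it is at most some q < 1 off a ball, so the kernel is at most (N+1)^2
  q^(2N+1) there.\<close>

lemma centre_kernel_away:
  assumes ab: "a > 0" "b > 0" and \<delta>: "\<delta> > 0"
  obtains m where "m \<longlonglongrightarrow> 0"
    "\<And>N x. x \<in> rect a b \<Longrightarrow> \<delta> \<le> dist x (a, b) \<Longrightarrow> centre_kernel a b N x \<le> m N"
proof -
  define K where "K = cbox (0, 0) (2 * a, 2 * b) - ball (a, b) \<delta>"
  define g where "g z = sin (pi * fst z / (2 * a)) * sin (pi * snd z / (2 * b))" for z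
  have K: "compact K" unfolding K_def by (intro compact_diff compact_cbox open_ball)
  have g: "0 \<le> g z" "g z < 1" if z: "z \<in> K" for z
  proof -
    obtain x y where xy: "z = (x, y)" by (cases z)
    have r: "0 \<le> x" "x \<le> 2 * a" "0 \<le> y" "y \<le> 2 * b" and ne: "(x, y) \<noteq> (a, b)"
      using z \<delta> by (auto simp: K_def xy)
    have s: "0 \<le> sin (pi * x / (2 * a))" "0 \<le> sin (pi * y / (2 * b))"
      using r ab by (auto intro: sin_rect_nonneg)
    thus "0 \<le> g z" by (simp add: g_def xy)
    have le: "g z \<le> sin (pi * x / (2 * a))" "g z \<le> sin (pi * y / (2 * b))"
      using s mult_left_le[of "sin (pi * y / (2 * b))" "sin (pi * x / (2 * a))"]
        mult_left_le_one_le[of "sin (pi * y / (2 * b))" "sin (pi * x / (2 * a))"]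
      by (auto simp: g_def xy)
    show "g z < 1"
    proof (rule ccontr)
      assume "\<not> g z < 1"
      hence e: "sin (pi * x / (2 * a)) = 1" "sin (pi * y / (2 * b)) = 1"
        using le sin_le_one[of "pi * x / (2 * a)"] sin_le_one[of "pi * y / (2 * b)"] by linarith+
      have "pi * x / (2 * a) = pi / 2"
        by (rule sin_eq_1_imp[OF _ _ e(1)])
          (use r ab mult_left_mono[of x "2 * a" pi] in \<open>auto simp: divide_le_eq\<close>)
      moreover have "pi * y / (2 * b) = pi / 2"
        by (rule sin_eq_1_imp[OF _ _ e(2)])
          (use r ab mult_left_mono[of y "2 * b" pi] in \<open>auto simp: divide_le_eq\<close>)
      ultimately have "pi * x / (2 * a) = pi / 2" "pi * y / (2 * b) = pi / 2" .
      with ne ab show False by (auto simp: field_simps)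
    qed
  qed
  have "\<exists>q. 0 \<le> q \<and> q < 1 \<and> (\<forall>z\<in>K. g z \<le> q)"
  proof (cases "K = {}")
    case False
    have "continuous_on K g" unfolding g_def[abs_def] divide_inverse by (intro continuous_intros)
    then obtain z where "z \<in> K" "\<forall>y\<in>K. g y \<le> g z"
      using continuous_attains_sup[OF K False] by blast
    thus ?thesis using g by blast
  qed (auto intro: exI[of _ 0])
  then obtain q where q: "0 \<le> q" "q < 1" "\<And>z. z \<in> K \<Longrightarrow> g z \<le> q" by blast
  define m where "m N = ((real N * q ^ N) + q ^ N)\<^sup>2 * q" for N
  have "m \<longlonglongrightarrow> (0 + 0)\<^sup>2 * q"
    unfolding m_def using q
    by (intro tendsto_mult tendsto_power tendsto_add tendsto_const powser_times_n_limit_0 LIMSEQ_power_zero) auto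
  hence "m \<longlonglongrightarrow> 0" by simp
  moreover have "centre_kernel a b N x \<le> m N" if x: "x \<in> rect a b" "\<delta> \<le> dist x (a, b)" for N x
  proof -
    have xK: "x \<in> K" using x rect_subset_cbox[of a b] by (auto simp: K_def dist_commute)
    have "centre_kernel a b N x = (kernel_height N)\<^sup>2 * g x ^ (2 * N + 1)"
      by (cases x) (simp add: centre_kernel_def g_def power_mult_distrib power2_eq_square)
    also have "\<dots> \<le> (real N + 1)\<^sup>2 * q ^ (2 * N + 1)"
      using kernel_height_le[of N] kernel_height_pos[of N] g[OF xK] q(3)[OF xK]
      by (intro mult_mono power_mono) auto
    also have "\<dots> = m N"
      by (simp add: m_def power2_eq_square power_mult algebra_simps power_mult_distrib)
    finally show ?thesis .
  qed
  ultimately show thesis using that by blast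
qed

text \<open>Near the centre \<open>w\<close> is small and the mass of the kernel is at most 4ab;
  away from it the kernel is uniformly small and \<open>u\<close>, though possibly unbounded, is
  integrable.\<close>

lemma L2_inner_centre_kernel_tendsto:
  assumes ab: "a > 0" "b > 0" and u: "u \<in> L2 (rect a b)"
    and w: "continuous_on (rect a b) w" "AE x in lebesgue_on (rect a b). u x = w x" "w (a, b) = 0"
  shows "(\<lambda>N. L2_inner (rect a b) u (\<lambda>x. of_real (centre_kernel a b N x))) \<longlonglongrightarrow> 0"
proof (rule tendstoI)
  fix r :: real assume r: "r > 0"
  \<comment> \<open>Chosen so that the part near the centre contributes at most r/2.\<close>
  define \<epsilon> where "\<epsilon> = r / (2 * (4 * a * b))"
  have \<epsilon>: "\<epsilon> > 0" "\<epsilon> * (4 * a * b) = r / 2" using r ab by (simp_all add: \<epsilon>_def)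
  define U where "U = (LINT x|lebesgue_on (rect a b). cmod (u x))"
  have one: "(\<lambda>x. 1) \<in> L2 (rect a b)" by (rule continuous_in_L2[OF continuous_on_const])
  have u_int: "integrable (lebesgue_on (rect a b)) (\<lambda>x. cmod (u x))"
    using L2_product_integrable[OF u one] by simp
  have U: "U \<ge> 0" by (simp add: U_def)
  have p: "(a, b) \<in> rect a b" using ab by (simp add: rect_def)
  then obtain \<delta> where \<delta>: "\<delta> > 0"
    "\<And>x. x \<in> rect a b \<Longrightarrow> dist x (a, b) < \<delta> \<Longrightarrow> cmod (w x) < \<epsilon>"
    using w(1,3) \<epsilon>(1) unfolding continuous_on_iff by (metis dist_0_norm dist_commute)
  obtain m where m: "m \<longlonglongrightarrow> 0"
    "\<And>N x. x \<in> rect a b \<Longrightarrow> \<delta> \<le> dist x (a, b) \<Longrightarrow> centre_kernel a b N x \<le> m N"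
    using centre_kernel_away[OF ab \<delta>(1)] by blast
  have "(\<lambda>N. \<bar>m N\<bar> * U) \<longlonglongrightarrow> 0 * U"
    by (intro tendsto_mult tendsto_const tendsto_rabs_zero m)
  hence "\<forall>\<^sub>F N in sequentially. \<bar>m N\<bar> * U < r / 2"
    using r by (intro order_tendstoD(2)[where y = "0 * U"]) auto
  thus "\<forall>\<^sub>F N in sequentially. dist (L2_inner (rect a b) u (\<lambda>x. of_real (centre_kernel a b N x))) 0 < r"
  proof (rule eventually_mono)
    fix N assume N: "\<bar>m N\<bar> * U < r / 2"
    define k where "k = centre_kernel a b N"
    have kL2: "(\<lambda>x. of_real (k x)) \<in> L2 (rect a b)"
      unfolding k_def by (intro continuous_in_L2 continuous_on_of_real continuous_centre_kernel)
    have k0: "k x \<ge> 0" if "x \<in> rect a b" for x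
      unfolding k_def using that rect_subset_cbox[of a b] by (intro centre_kernel_nonneg ab) auto
    have k_int: "integrable (lebesgue_on (rect a b)) k"
      unfolding k_def by (rule continuous_integrable_rect[OF continuous_centre_kernel])
    have "cmod (L2_inner (rect a b) u (\<lambda>x. of_real (k x)))
        \<le> (LINT x|lebesgue_on (rect a b). cmod (cnj (u x) * of_real (k x)))"
      unfolding L2_inner_def by (rule integral_norm_bound)
    also have "\<dots> = (LINT x|lebesgue_on (rect a b). cmod (u x) * k x)"
      by (intro Bochner_Integration.integral_cong) (auto simp: norm_mult k0)
    also have "\<dots> \<le> (LINT x|lebesgue_on (rect a b). \<epsilon> * k x + \<bar>m N\<bar> * cmod (u x))"
    proof (rule integral_mono_AE)
      have "integrable (lebesgue_on (rect a b)) (\<lambda>x. cmod (u x) * cmod (of_real (k x)))"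
        by (rule L2_product_integrable[OF u kL2])
      thus "integrable (lebesgue_on (rect a b)) (\<lambda>x. cmod (u x) * k x)"
        by (rule Bochner_Integration.integrable_cong[THEN iffD1, rotated 2]) (auto simp: k0)
      show "integrable (lebesgue_on (rect a b)) (\<lambda>x. \<epsilon> * k x + \<bar>m N\<bar> * cmod (u x))"
        by (intro Bochner_Integration.integrable_add integrable_mult_right k_int u_int)
      show "AE x in lebesgue_on (rect a b). cmod (u x) * k x \<le> \<epsilon> * k x + \<bar>m N\<bar> * cmod (u x)"
        using w(2)
      proof (rule AE_mp, intro AE_I2 impI)
        fix x assume "x \<in> space (lebesgue_on (rect a b))" and e: "u x = w x"
        hence x: "x \<in> rect a b" by simp
        show "cmod (u x) * k x \<le> \<epsilon> * k x + \<bar>m N\<bar> * cmod (u x)"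
        proof (cases "dist x (a, b) < \<delta>")
          case True
          hence "cmod (u x) * k x \<le> \<epsilon> * k x"
            using \<delta>(2)[OF x] k0[OF x] e by (intro mult_right_mono) auto
          moreover have "0 \<le> \<bar>m N\<bar> * cmod (u x)" by simp
          ultimately show ?thesis by linarith
        next
          case False
          hence "k x \<le> \<bar>m N\<bar>" using m(2)[OF x, of N] by (simp add: k_def)
          hence "cmod (u x) * k x \<le> cmod (u x) * \<bar>m N\<bar>" by (intro mult_left_mono) auto
          moreover have "0 \<le> \<epsilon> * k x" using \<epsilon> k0[OF x] by simp
          ultimately show ?thesis by (simp add: mult.commute)
        qed
      qed
    qed
    also have "\<dots> = \<epsilon> * (LINT x|lebesgue_on (rect a b). k x) + \<bar>m N\<bar> * U"
      using k_int u_int by (simp add: U_def)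
    also have "\<dots> \<le> \<epsilon> * (4 * a * b) + \<bar>m N\<bar> * U"
      unfolding k_def using LINT_centre_kernel_le[OF ab, of N] \<epsilon> by (intro add_right_mono mult_left_mono) auto
    also have "\<dots> < r" using N \<epsilon> by simp
    finally show "dist (L2_inner (rect a b) u (\<lambda>x. of_real (centre_kernel a b N x))) 0 < r"
      by (simp add: k_def)
  qed
qed


section \<open>The simple part of the spectrum\<close>

text \<open>The Weierstrass test gives a continuous sum, and the sum of the majorants bounds all
  partial sums, so convergence in the mean follows by bounded convergence.\<close>

lemma continuous_series_L2_tendsto:
  fixes h :: "nat \<Rightarrow> wavefun"
  assumes cont: "\<And>j. continuous_on UNIV (h j)" and bound: "\<And>j x. cmod (h j x) \<le> M j"
    and M: "summable M"
  shows "continuous_on UNIV (\<lambda>x. \<Sum>j. h j x)"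
    "L2_tendsto (rect a b) (\<lambda>N x. \<Sum>j<N. h j x) (\<lambda>x. \<Sum>j. h j x)"
proof -
  have unif: "uniform_limit UNIV (\<lambda>N x. \<Sum>j<N. h j x) (\<lambda>x. \<Sum>j. h j x) sequentially"
    by (rule Weierstrass_m_test[OF _ M]) (rule bound)
  have cont_sum: "continuous_on UNIV (\<lambda>x. \<Sum>j<N. h j x)" for N
    by (intro continuous_on_sum cont)
  show "continuous_on UNIV (\<lambda>x. \<Sum>j. h j x)"
    by (rule uniform_limit_theorem[OF _ unif]) (simp_all add: cont_sum)
  have M0: "0 \<le> M j" for j using bound[of j undefined] norm_ge_zero[of "h j undefined"] by linarith
  show "L2_tendsto (rect a b) (\<lambda>N x. \<Sum>j<N. h j x) (\<lambda>x. \<Sum>j. h j x)"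
  proof (rule L2_tendsto_bounded_convergence[OF rect_lmeasurable])
    show "(\<lambda>x. \<Sum>j<N. h j x) \<in> borel_measurable (lebesgue_on (rect a b))" for N
      by (rule continuous_measurable_rect[OF cont_sum])
    show "cmod (\<Sum>j<N. h j x) \<le> suminf M" for N x
    proof -
      have "cmod (\<Sum>j<N. h j x) \<le> (\<Sum>j<N. M j)" by (rule sum_norm_le) (rule bound)
      also have "\<dots> \<le> suminf M" by (rule sum_le_suminf[OF M]) (simp_all add: M0)
      finally show ?thesis .
    qed
    show "(\<lambda>N. \<Sum>j<N. h j x) \<longlonglongrightarrow> (\<Sum>j. h j x)" for x
      by (rule tendsto_uniform_limitI[OF unif]) simp
  qed
qed

lemma mode_energy_odd: "mode_energy a b (2 * s + 1, 2 * t + 1) = energy a b s t"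
proof -
  have "(real (2 * s + 1))\<^sup>2 = 4 * (real s + 1/2)\<^sup>2" "(real (2 * t + 1))\<^sup>2 = 4 * (real t + 1/2)\<^sup>2"
    by (simp_all add: power2_eq_square algebra_simps)
  thus ?thesis by (simp only: mode_energy_def energy_def prod.case) simp
qed

lemma mode_frequency_le:
  "real n * pi / (2 * a) \<le> sqrt (mode_energy a b (n, m))"
  "real m * pi / (2 * b) \<le> sqrt (mode_energy a b (n, m))"
proof -
  have "(real n * pi / (2 * a))\<^sup>2 \<le> mode_energy a b (n, m)"
    "(real m * pi / (2 * b))\<^sup>2 \<le> mode_energy a b (n, m)"
    by (simp_all add: mode_energy_def power_mult_distrib power_divide distrib_left mult.commute)
  thus "real n * pi / (2 * a) \<le> sqrt (mode_energy a b (n, m))"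
    "real m * pi / (2 * b) \<le> sqrt (mode_energy a b (n, m))"
    by (auto intro: real_le_rsqrt)
qed

text \<open>The energy is the sum of the squared frequencies, so each frequency is at most its
  square root. This supplies the majorant for series of gradients.\<close>

lemma abs_sine_mode_grad_le:
  assumes ab: "a > 0" "b > 0"
  shows "\<bar>sine_mode_dx a b k x\<bar> \<le> 1 / sqrt (a * b) * sqrt (mode_energy a b k)"
    "\<bar>sine_mode_dy a b k x\<bar> \<le> 1 / sqrt (a * b) * sqrt (mode_energy a b k)"
proof -
  obtain n m u v where kx: "k = (n, m)" "x = (u, v)" by (cases k, cases x) auto
  have le: "A * c * \<bar>s\<bar> * \<bar>t\<bar> \<le> A * e" if "0 \<le> A" "0 \<le> c" "c \<le> e" "\<bar>s\<bar> \<le> 1" "\<bar>t\<bar> \<le> 1" for A c s t e :: real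
  proof -
    have "c * (\<bar>s\<bar> * \<bar>t\<bar>) \<le> e * (1 * 1)"
      using that by (intro mult_mono mult_nonneg_nonneg) auto
    from mult_left_mono[OF this that(1)] show ?thesis by (simp add: mult.assoc)
  qed
  show "\<bar>sine_mode_dx a b k x\<bar> \<le> 1 / sqrt (a * b) * sqrt (mode_energy a b k)"
    "\<bar>sine_mode_dy a b k x\<bar> \<le> 1 / sqrt (a * b) * sqrt (mode_energy a b k)"
    using ab le[OF _ _ mode_frequency_le(1)[of n a b m], of "1 / sqrt (a * b)"
        "cos (real n * pi * u / (2 * a))" "sin (real m * pi * v / (2 * b))"]
      le[OF _ _ mode_frequency_le(2)[of m b a n], of "1 / sqrt (a * b)"
        "sin (real n * pi * u / (2 * a))" "cos (real m * pi * v / (2 * b))"]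
    unfolding kx sine_mode_dx_def sine_mode_dy_def prod.case abs_mult
    by simp_all
qed

lemma Bessel_inequality:
  assumes e: "\<And>j. e j \<in> L2 \<Omega>"
    and orth: "\<And>i j. L2_inner \<Omega> (e i) (e j) = (if i = j then 1 else 0)"
    and f: "f \<in> L2 \<Omega>" and F: "finite F"
  shows "(\<Sum>j\<in>F. (cmod (L2_inner \<Omega> (e j) f))\<^sup>2) \<le> (L2_norm \<Omega> f)\<^sup>2"
proof -
  define S where "S = (\<lambda>x. \<Sum>j\<in>F. L2_inner \<Omega> (e j) f * e j x)"
  have S: "S \<in> L2 \<Omega>" unfolding S_def by (intro L2_sum L2_scale e)
  have norm: "(L2_norm \<Omega> S)\<^sup>2 = (\<Sum>j\<in>F. (cmod (L2_inner \<Omega> (e j) f))\<^sup>2)"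
    unfolding S_def by (rule L2_orthonormal_norm_power2[OF e orth F])
  have "L2_inner \<Omega> f S = (\<Sum>j\<in>F. L2_inner \<Omega> (e j) f * L2_inner \<Omega> f (e j))"
    unfolding S_def by (subst L2_inner_sum_right) (simp_all add: f e L2_scale L2_inner_scale_right)
  also have "\<dots> = (\<Sum>j\<in>F. of_real ((cmod (L2_inner \<Omega> (e j) f))\<^sup>2))"
    by (simp only: complex_norm_square L2_inner_cnj[where g = f])
  also have "\<dots> = of_real (\<Sum>j\<in>F. (cmod (L2_inner \<Omega> (e j) f))\<^sup>2)" by simp
  finally have "Re (L2_inner \<Omega> f S) = (L2_norm \<Omega> S)\<^sup>2" unfolding norm by simp
  hence "(L2_norm \<Omega> (\<lambda>x. f x - S x))\<^sup>2 = (L2_norm \<Omega> f)\<^sup>2 - (L2_norm \<Omega> S)\<^sup>2"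
    using L2_norm_diff_power2[OF f S] by simp
  moreover have "0 \<le> (L2_norm \<Omega> (\<lambda>x. f x - S x))\<^sup>2" by simp
  ultimately show ?thesis unfolding norm by linarith
qed

text \<open>The situation once degeneracies are excluded: each index corresponds to one pair of
  quantum numbers, and each listed eigenfunction is a sine mode up to the sign \<open>sg\<close>.
  The bijection carries sums over the ordered spectrum to sums over pairs.\<close>

locale rectangle_spectrum =
  fixes a b :: real and E :: "nat \<Rightarrow> real" and \<Phi> :: "nat \<Rightarrow> real \<times> real \<Rightarrow> real"
    and S T :: "nat \<Rightarrow> nat" and sg :: "nat \<Rightarrow> real"
  assumes ab: "a > 0" "b > 0" and E_mono: "strict_mono E"
    and E_eq: "\<And>j. E j = energy a b (S j) (T j)"
    and \<Phi>_eq: "\<And>j x. \<Phi> j x = sg j * sine_mode a b (2 * S j + 1, 2 * T j + 1) x"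
    and sg: "\<And>j. sg j = 1 \<or> sg j = -1"
    and bij: "bij (\<lambda>j. (S j, T j))"
begin

abbreviation "\<Omega> \<equiv> rect a b"

abbreviation "\<Phi>c j \<equiv> (\<lambda>x. complex_of_real (\<Phi> j x))"

abbreviation "\<Phi>p j \<equiv> \<Phi> j (a, b)"

definition "dx j x = sg j * sine_mode_dx a b (2 * S j + 1, 2 * T j + 1) x"

definition "dy j x = sg j * sine_mode_dy a b (2 * S j + 1, 2 * T j + 1) x"

lemma sg_square: "sg j * sg j = 1" "\<bar>sg j\<bar> = 1"
  using sg[of j] by auto

lemma sqrt_ab_pos: "sqrt (a * b) > 0"
  using ab by simp

lemma continuous_\<Phi>: "continuous_on A (\<Phi> j)"
  unfolding \<Phi>_eq[abs_def] by (intro continuous_on_mult continuous_on_const continuous_sine_mode)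

lemma continuous_dx: "continuous_on A (dx j)"
  unfolding dx_def[abs_def] by (intro continuous_on_mult continuous_on_const continuous_sine_mode_dx)

lemma continuous_dy: "continuous_on A (dy j)"
  unfolding dy_def[abs_def] by (intro continuous_on_mult continuous_on_const continuous_sine_mode_dy)

lemma abs_\<Phi>_le: "\<bar>\<Phi> j x\<bar> \<le> 1 / sqrt (a * b)"
  using abs_sine_mode_le[OF ab] by (simp only: \<Phi>_eq abs_mult sg_square mult_1_left)

lemma abs_dx_le: "\<bar>dx j x\<bar> \<le> 1 / sqrt (a * b) * sqrt (E j)"
  unfolding dx_def abs_mult sg_square E_eq mode_energy_odd[symmetric] mult_1_left
  by (rule abs_sine_mode_grad_le[OF ab])

lemma abs_dy_le: "\<bar>dy j x\<bar> \<le> 1 / sqrt (a * b) * sqrt (E j)"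
  unfolding dy_def abs_mult sg_square E_eq mode_energy_odd[symmetric] mult_1_left
  by (rule abs_sine_mode_grad_le[OF ab])

lemma \<Phi>c_L2: "\<Phi>c j \<in> L2 \<Omega>"
  by (intro continuous_in_L2 continuous_on_of_real continuous_\<Phi>)

lemma ST_eq_iff: "(S i, T i) = (S j, T j) \<longleftrightarrow> i = j"
  by (rule inj_eq[OF bij_is_inj[OF bij]])

lemma inj_on_ST: "inj_on (\<lambda>j. (S j, T j)) A"
  by (rule inj_on_subset[OF bij_is_inj[OF bij] subset_UNIV])

lemma \<Phi>c_orthonormal: "L2_inner \<Omega> (\<Phi>c i) (\<Phi>c j) = (if i = j then 1 else 0)"
proof -
  have "L2_inner \<Omega> (\<Phi>c i) (\<Phi>c j) = of_real (LINT x|lebesgue_on \<Omega>. \<Phi> i x * \<Phi> j x)"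
    unfolding L2_inner_def integral_complex_of_real[symmetric] by simp
  also have "(LINT x|lebesgue_on \<Omega>. \<Phi> i x * \<Phi> j x) = (LINT x|lebesgue_on \<Omega>. (sg i * sg j) *
      (sine_mode a b (2 * S i + 1, 2 * T i + 1) x * sine_mode a b (2 * S j + 1, 2 * T j + 1) x))"
    by (simp only: \<Phi>_eq mult_ac)
  also have "\<dots> = (sg i * sg j) * (LINT x|lebesgue_on \<Omega>.
      sine_mode a b (2 * S i + 1, 2 * T i + 1) x * sine_mode a b (2 * S j + 1, 2 * T j + 1) x)"
    by (rule integral_mult_right_zero)
  also have "\<dots> = (sg i * sg j) * (if (S i, T i) = (S j, T j) then 1 else 0)"
    by (subst sine_mode_orthonormal[OF ab]) auto
  also have "\<dots> = (if i = j then 1 else 0)" unfolding ST_eq_iff by (simp add: sg_square)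
  finally show ?thesis by simp
qed

lemma \<Phi>c_H1_0: "H1_0 \<Omega> (\<Phi>c j) (\<lambda>x. of_real (dx j x)) (\<lambda>x. of_real (dy j x))"
  using H1_0_scale[OF sine_mode_H1_0[OF ab], of "of_real (sg j)" "(2 * S j + 1, 2 * T j + 1)"]
  by (simp only: \<Phi>_eq dx_def dy_def of_real_mult)

lemma \<Phi>c_integration_by_parts:
  assumes "C1c \<Omega> \<eta> \<eta>1 \<eta>2"
  shows "L2_inner \<Omega> \<eta>1 (\<lambda>x. of_real (dx j x)) + L2_inner \<Omega> \<eta>2 (\<lambda>x. of_real (dy j x))
    = of_real (E j) * L2_inner \<Omega> \<eta> (\<Phi>c j)"
  using arg_cong[OF sine_mode_integration_by_parts[OF ab assms, of "(2 * S j + 1, 2 * T j + 1)"],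
      of "\<lambda>z. of_real (sg j) * z"]
  unfolding \<Phi>_eq dx_def dy_def of_real_mult L2_inner_scale_right mode_energy_odd E_eq[symmetric]
  by (simp only: distrib_left mult.left_commute)

text \<open>The unknown sign of the eigenfunction occurs twice and cancels, which leaves exactly the
  terms of the centre kernel.\<close>

lemma \<Phi>_product_centre: "\<Phi>p j * \<Phi> j (x, y) = 1 / (a * b) *
    ((-1) ^ S j * sin (real (2 * S j + 1) * (pi * x / (2 * a)))) *
    ((-1) ^ T j * sin (real (2 * T j + 1) * (pi * y / (2 * b))))"
proof -
  define X where "X = sin (real (2 * S j + 1) * (pi * x / (2 * a)))"
  define Y where "Y = sin (real (2 * T j + 1) * (pi * y / (2 * b)))"
  have half: "real (2 * n + 1) * (pi * c / (2 * c)) = real (2 * n + 1) * (pi / 2)" if "c > 0" for n c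
    using that by simp
  have r: "real n * pi * x / (2 * c) = real n * (pi * x / (2 * c))" for n x c by simp
  have 1: "\<Phi>p j = sg j * (1 / sqrt (a * b) * (-1) ^ S j * (-1) ^ T j)"
    unfolding \<Phi>_eq sine_mode_def prod.case r half[OF ab(1)] half[OF ab(2)] sin_odd_multiple_half_pi ..
  have 2: "\<Phi> j (x, y) = sg j * (1 / sqrt (a * b) * X * Y)"
    unfolding \<Phi>_eq sine_mode_def prod.case r X_def Y_def ..
  have "\<Phi>p j * \<Phi> j (x, y) = (sg j * sg j) * (1 / sqrt (a * b) * (1 / sqrt (a * b)))
      * ((-1) ^ S j * X) * ((-1) ^ T j * Y)"
    unfolding 1 2 by (simp only: mult_ac)
  also have "1 / sqrt (a * b) * (1 / sqrt (a * b)) = 1 / (a * b)"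
    using ab by (simp add: real_sqrt_mult[symmetric])
  finally show ?thesis unfolding sg_square X_def Y_def by simp
qed

lemma \<Phi>p_square: "(\<Phi>p j)\<^sup>2 = 1 / (a * b)"
proof -
  have c: "real (2 * n + 1) * (pi * c / (2 * c)) = real (2 * n + 1) * (pi / 2)" if "c > 0" for n c
    using that by simp
  show ?thesis
    unfolding power2_eq_square \<Phi>_product_centre c[OF ab(1)] c[OF ab(2)] sin_odd_multiple_half_pi
    by (simp add: power_mult_distrib[symmetric])
qed

lemma \<Phi>p_nz: "\<Phi>p j \<noteq> 0"
  using \<Phi>p_square[of j] ab by (auto simp: power2_eq_square)

lemma abs_\<Phi>p: "\<bar>\<Phi>p j\<bar> = 1 / sqrt (a * b)"
proof -
  have "\<bar>\<Phi>p j\<bar> = sqrt ((\<Phi>p j)\<^sup>2)" by simp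
  thus ?thesis unfolding \<Phi>p_square by (simp add: real_sqrt_divide)
qed

section \<open>Growth and summability of the eigenvalues\<close>

lemma E_pos: "E j > 0"
proof -
  have "0 < (real (S j) + 1/2)\<^sup>2 / a\<^sup>2" "0 < (real (T j) + 1/2)\<^sup>2 / b\<^sup>2"
    using ab by (intro divide_pos_pos zero_less_power add_nonneg_pos; simp)+
  from mult_pos_pos[OF zero_less_power[OF pi_gt_zero] add_pos_pos[OF this]]
  show ?thesis unfolding E_eq energy_def .
qed

lemma E_le: "i \<le> j \<Longrightarrow> E i \<le> E j"
  using E_mono by (simp add: strict_mono_less_eq)

text \<open>Arithmetic-geometric mean: \<open>x\<^sup>2/a\<^sup>2 + y\<^sup>2/b\<^sup>2 \<ge> 2xy/(ab)\<close>.\<close>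

lemma E_lower: "pi\<^sup>2 / (2 * a * b) * ((real (S j) + 1) * (real (T j) + 1)) \<le> E j"
proof -
  define x where "x = (real (S j) + 1/2) / a"
  define y where "y = (real (T j) + 1/2) / b"
  have "2 * (x * y) \<le> x\<^sup>2 + y\<^sup>2" using sum_squares_bound[of x y] by simp
  hence "pi\<^sup>2 * (2 * (x * y)) \<le> E j"
    unfolding E_eq energy_def x_def y_def power_divide by (intro mult_left_mono) auto
  moreover have "(real (S j) + 1) * (real (T j) + 1) / (2 * a * b) \<le> 2 * (x * y)"
  proof -
    have "(real (S j) + 1) * (real (T j) + 1) \<le> (2 * real (S j) + 1) * (2 * real (T j) + 1)"
      by (intro mult_mono) auto
    hence "(real (S j) + 1) * (real (T j) + 1) / (2 * a * b)
        \<le> (2 * real (S j) + 1) * (2 * real (T j) + 1) / (2 * a * b)"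
      using ab by (intro divide_right_mono) auto
    also have "\<dots> = 2 * (x * y)" using ab by (simp add: x_def y_def field_simps)
    finally show ?thesis .
  qed
  ultimately show ?thesis
    using mult_left_mono[of "(real (S j) + 1) * (real (T j) + 1) / (2 * a * b)" "2 * (x * y)" "pi\<^sup>2"]
    by simp
qed

text \<open>The product form of \<open>E_lower\<close> majorises the double series by a product of
  two series with terms (n+1)^(-\<theta>), each convergent for \<theta> > 1.\<close>

lemma summable_E_powr:
  assumes \<theta>: "\<theta> > 1"
  shows "summable (\<lambda>j. E j powr (-\<theta>))"
proof -
  define \<kappa> where "\<kappa> = pi\<^sup>2 / (2 * a * b)"
  have \<kappa>: "\<kappa> > 0" using ab by (simp add: \<kappa>_def)
  define f where "f n = (real n + 1) powr (-\<theta>)" for n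
  have f: "summable f"
    unfolding f_def using \<theta> summable_real_powr_iff[of "-\<theta>"] summable_iff_shift[of "\<lambda>n. real n powr (-\<theta>)" 1]
    by (simp add: add.commute)
  have f0: "f n \<ge> 0" for n by (simp add: f_def)
  have term_le: "E j powr (-\<theta>) \<le> \<kappa> powr (-\<theta>) * (f (S j) * f (T j))" for j
  proof -
    have "0 < \<kappa> * ((real (S j) + 1) * (real (T j) + 1))"
      using \<kappa> by (intro mult_pos_pos add_nonneg_pos) auto
    hence "E j powr (-\<theta>) \<le> (\<kappa> * ((real (S j) + 1) * (real (T j) + 1))) powr (-\<theta>)"
      using \<theta> by (intro powr_mono2' E_lower[of j, folded \<kappa>_def]) auto
    thus ?thesis using \<kappa> by (simp add: powr_mult f_def)
  qed
  show ?thesis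
  proof (rule summableI_nonneg_bounded)
    fix N
    \<comment> \<open>A square of side \<open>M\<close> that contains the quantum numbers of the
      first \<open>N\<close> eigenvalues.\<close>
    obtain M where M: "\<And>j. j < N \<Longrightarrow> S j < M \<and> T j < M"
    proof -
      have "finite (S ` {..<N} \<union> T ` {..<N})" by simp
      then obtain M where "\<forall>k\<in>S ` {..<N} \<union> T ` {..<N}. k < M"
        unfolding finite_nat_set_iff_bounded by (rule exE)
      thus thesis by (intro that[of M]) simp
    qed
    have "(\<Sum>j<N. E j powr (-\<theta>)) \<le> (\<Sum>j<N. \<kappa> powr (-\<theta>) * (f (S j) * f (T j)))"
      by (intro sum_mono term_le)
    also have "\<dots> = \<kappa> powr (-\<theta>) * (\<Sum>j<N. f (S j) * f (T j))" by (simp add: sum_distrib_left)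
    also have "(\<Sum>j<N. f (S j) * f (T j)) = (\<Sum>(s, t)\<in>(\<lambda>j. (S j, T j)) ` {..<N}. f s * f t)"
      by (subst sum.reindex[OF inj_on_ST]) (simp add: o_def)
    also have "\<kappa> powr (-\<theta>) * \<dots> \<le> \<kappa> powr (-\<theta>) * (\<Sum>(s, t)\<in>{..<M} \<times> {..<M}. f s * f t)"
      using M by (intro mult_left_mono sum_mono2) (auto simp: f0)
    also have "(\<Sum>(s, t)\<in>{..<M} \<times> {..<M}. f s * f t) = (\<Sum>s<M. f s) * (\<Sum>t<M. f t)"
      by (simp add: sum_product sum.cartesian_product)
    also have "\<kappa> powr (-\<theta>) * \<dots> \<le> \<kappa> powr (-\<theta>) * (suminf f * suminf f)"
      using sum_le_suminf[OF f, of "{..<M}"] sum_nonneg[of "{..<M}" f] f0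
      by (intro mult_left_mono mult_mono) auto
    finally show "(\<Sum>j<N. E j powr (-\<theta>)) \<le> \<kappa> powr (-\<theta>) * (suminf f * suminf f)" .
  qed simp
qed

lemma summable_inverse_E_power2: "summable (\<lambda>j. 1 / (E j)\<^sup>2)"
proof -
  have "1 / (E j)\<^sup>2 = E j powr (-2)" for j
    using E_pos[of j] by (simp add: powr_minus powr_numeral divide_inverse)
  thus ?thesis using summable_E_powr[of 2] by simp
qed

lemma square_summable_coeff:
  assumes "\<And>j. cmod (c j) \<le> C / E j"
  shows "summable (\<lambda>j. (cmod (c j))\<^sup>2)"
proof (rule summable_comparison_test')
  show "summable (\<lambda>j. C\<^sup>2 * (1 / (E j)\<^sup>2))" by (intro summable_mult summable_inverse_E_power2)
  show "norm ((cmod (c j))\<^sup>2) \<le> C\<^sup>2 * (1 / (E j)\<^sup>2)" for j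
    using power_mono[OF assms[of j] norm_ge_zero, of 2] by (simp add: power_divide)
qed

lemma spectral_series_exists:
  assumes "\<And>j. cmod (c j) \<le> C / E j"
  shows "\<exists>g. L2_tendsto \<Omega> (\<lambda>N x. \<Sum>j<N. c j * \<Phi>c j x) g"
  by (rule L2_orthonormal_series_converges[OF rect_lmeasurable \<Phi>c_L2 \<Phi>c_orthonormal
        square_summable_coeff[OF assms]])

text \<open>Three rates of decay are at work. The terms of the series are O(E^(-2)) and those of its
  gradient O(E^(-3/2)), so both converge uniformly. The coefficients of the Laplacian are only
  O(1/E), which is square summable, so that series is obtained from Riesz-Fischer.\<close>

lemma neg_Laplacian_series:
  assumes c: "\<And>j. cmod (c j) \<le> C / (E j)\<^sup>2"
  defines "u \<equiv> \<lambda>x. \<Sum>j. c j * \<Phi>c j x"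
  shows "continuous_on UNIV u" "L2_tendsto \<Omega> (\<lambda>N x. \<Sum>j<N. c j * \<Phi>c j x) u"
    "\<exists>f. neg_Laplacian \<Omega> u f"
proof -
  have "0 \<le> C / (E 0)\<^sup>2" using c[of 0] norm_ge_zero[of "c 0"] by linarith
  hence C: "C \<ge> 0" using E_pos[of 0] by (simp add: zero_le_divide_iff)
  define D where "D = C / sqrt (a * b)"
  have D: "D \<ge> 0" using C sqrt_ab_pos by (simp add: D_def)
  define M where "M j = D * E j powr (- (3/2))" for j
  have M: "summable M" unfolding M_def by (intro summable_mult summable_E_powr) simp
  have bd: "cmod (c j * of_real r) \<le> M j" if "\<bar>r\<bar> \<le> 1 / sqrt (a * b) * sqrt (E j)" for j r
  proof -
    have "cmod (c j * of_real r) \<le> C / (E j)\<^sup>2 * (1 / sqrt (a * b) * sqrt (E j))"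
      unfolding norm_mult norm_of_real using that c[of j] C by (intro mult_mono) auto
    also have "\<dots> = D * (E j powr (1/2) / E j powr 2)"
      using E_pos[of j] by (simp add: D_def powr_half_sqrt powr_numeral)
    also have "\<dots> = M j" unfolding powr_diff[symmetric] by (simp add: M_def)
    finally show ?thesis .
  qed
  define M0 where "M0 j = D * (1 / (E j)\<^sup>2)" for j
  have M0: "summable M0" unfolding M0_def by (intro summable_mult summable_inverse_E_power2)
  have bd0: "cmod (c j * \<Phi>c j x) \<le> M0 j" for j x
  proof -
    have "cmod (c j * \<Phi>c j x) \<le> C / (E j)\<^sup>2 * (1 / sqrt (a * b))"
      unfolding norm_mult norm_of_real using c[of j] C abs_\<Phi>_le by (intro mult_mono) auto
    thus ?thesis by (simp add: M0_def D_def mult.commute)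
  qed
  note cts = continuous_on_mult continuous_on_const continuous_on_of_real
  have lim_u: "continuous_on UNIV u" "L2_tendsto \<Omega> (\<lambda>N x. \<Sum>j<N. c j * \<Phi>c j x) u"
    unfolding u_def
    by (rule continuous_series_L2_tendsto[OF _ bd0 M0], intro cts continuous_\<Phi>)+
  thus "continuous_on UNIV u" "L2_tendsto \<Omega> (\<lambda>N x. \<Sum>j<N. c j * \<Phi>c j x) u" .
  define G1 where "G1 = (\<lambda>x. \<Sum>j. c j * of_real (dx j x))"
  define G2 where "G2 = (\<lambda>x. \<Sum>j. c j * of_real (dy j x))"
  have lim1: "L2_tendsto \<Omega> (\<lambda>N x. \<Sum>j<N. c j * of_real (dx j x)) G1"
    unfolding G1_def
    by (rule continuous_series_L2_tendsto(2)[OF _ bd M]) (intro cts continuous_dx, rule abs_dx_le)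
  have lim2: "L2_tendsto \<Omega> (\<lambda>N x. \<Sum>j<N. c j * of_real (dy j x)) G2"
    unfolding G2_def
    by (rule continuous_series_L2_tendsto(2)[OF _ bd M]) (intro cts continuous_dy, rule abs_dy_le)
  have "cmod (c j * of_real (E j)) \<le> C / E j" for j
  proof -
    have "cmod (c j) * E j \<le> C / (E j)\<^sup>2 * E j"
      using c[of j] E_pos[of j] by (intro mult_right_mono) auto
    thus ?thesis using E_pos[of j] by (simp add: norm_mult power2_eq_square)
  qed
  then obtain f where lim_f: "L2_tendsto \<Omega> (\<lambda>N x. \<Sum>j<N. (c j * of_real (E j)) * \<Phi>c j x) f"
    using spectral_series_exists[of "\<lambda>j. c j * of_real (E j)" C] by blast
  have dL2: "(\<lambda>x. of_real (dx j x)) \<in> L2 \<Omega>" "(\<lambda>x. of_real (dy j x)) \<in> L2 \<Omega>" for j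
    by (intro continuous_in_L2 continuous_on_of_real continuous_dx continuous_dy)+
  have "H1_0 \<Omega> u G1 G2"
    by (rule H1_0_closed[OF H1_0_sum[OF H1_0_scale[OF \<Phi>c_H1_0]] lim_u(2) lim1 lim2])
  moreover have "L2_inner \<Omega> \<eta>1 G1 + L2_inner \<Omega> \<eta>2 G2 = L2_inner \<Omega> \<eta> f"
    \<comment> \<open>Both sides are limits of partial sums, for which the identity is integration
      by parts mode by mode.\<close>
    if \<eta>: "C1c \<Omega> \<eta> \<eta>1 \<eta>2" for \<eta> \<eta>1 \<eta>2
  proof (rule LIMSEQ_unique)
    note L2s = C1c_in_L2[OF \<eta>]
    show "(\<lambda>N. L2_inner \<Omega> \<eta> (\<lambda>x. \<Sum>j<N. (c j * of_real (E j)) * \<Phi>c j x)) \<longlonglongrightarrow> L2_inner \<Omega> \<eta> f"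
      by (rule L2_tendsto_inner[OF L2s(1) lim_f])
    have "L2_inner \<Omega> \<eta>1 (\<lambda>x. \<Sum>j<N. c j * of_real (dx j x)) + L2_inner \<Omega> \<eta>2 (\<lambda>x. \<Sum>j<N. c j * of_real (dy j x))
        = (\<Sum>j<N. c j * (L2_inner \<Omega> \<eta>1 (\<lambda>x. of_real (dx j x)) + L2_inner \<Omega> \<eta>2 (\<lambda>x. of_real (dy j x))))" for N
      by (subst (1 2) L2_inner_sum_right)
        (simp_all add: L2s dL2 L2_scale L2_inner_scale_right distrib_left sum.distrib)
    also have "\<dots> N = L2_inner \<Omega> \<eta> (\<lambda>x. \<Sum>j<N. (c j * of_real (E j)) * \<Phi>c j x)" for N
      unfolding \<Phi>c_integration_by_parts[OF \<eta>]
      by (subst L2_inner_sum_right) (simp_all add: L2s \<Phi>c_L2 L2_scale L2_inner_scale_right mult.assoc)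
    finally show "(\<lambda>N. L2_inner \<Omega> \<eta> (\<lambda>x. \<Sum>j<N. (c j * of_real (E j)) * \<Phi>c j x))
        \<longlonglongrightarrow> L2_inner \<Omega> \<eta>1 G1 + L2_inner \<Omega> \<eta>2 G2"
      using tendsto_add[OF L2_tendsto_inner[OF L2s(2) lim1] L2_tendsto_inner[OF L2s(3) lim2]] by simp
  qed
  ultimately have "neg_Laplacian \<Omega> u f"
    using lim_f unfolding neg_Laplacian_def L2_tendsto_def by blast
  thus "\<exists>f. neg_Laplacian \<Omega> u f" by blast
qed

lemma neg_Laplacian_L2:
  assumes "neg_Laplacian \<Omega> u f"
  shows "u \<in> L2 \<Omega>" "f \<in> L2 \<Omega>"
  using assms by (auto simp: neg_Laplacian_def H1_0_def L2_tendsto_def)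

text \<open>The gradients of \<open>u\<close> and of the eigenfunction are paired and evaluated
  twice: with compactly supported approximants of the eigenfunction as test functions for
  \<open>u\<close>, and with approximants of \<open>u\<close> as test functions for the
  eigenfunction.\<close>

lemma neg_Laplacian_coefficient:
  assumes "neg_Laplacian \<Omega> u f"
  shows "L2_inner \<Omega> (\<Phi>c j) f = of_real (E j) * L2_inner \<Omega> (\<Phi>c j) u"
proof -
  obtain G1 G2 where H: "H1_0 \<Omega> u G1 G2" and f: "f \<in> L2 \<Omega>"
    and weak: "\<And>\<eta> \<eta>1 \<eta>2. C1c \<Omega> \<eta> \<eta>1 \<eta>2 \<Longrightarrow>
      L2_inner \<Omega> \<eta>1 G1 + L2_inner \<Omega> \<eta>2 G2 = L2_inner \<Omega> \<eta> f"
    using assms unfolding neg_Laplacian_def by blast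
  obtain v v1 v2 where v: "\<And>n. C1c \<Omega> (v n) (v1 n) (v2 n)" "L2_tendsto \<Omega> v u"
    "L2_tendsto \<Omega> v1 G1" "L2_tendsto \<Omega> v2 G2"
    using H unfolding H1_0_def by blast
  obtain \<eta> \<eta>1 \<eta>2 where \<eta>: "\<And>n. C1c \<Omega> (\<eta> n) (\<eta>1 n) (\<eta>2 n)" "L2_tendsto \<Omega> \<eta> (\<Phi>c j)"
    "L2_tendsto \<Omega> \<eta>1 (\<lambda>x. of_real (dx j x))" "L2_tendsto \<Omega> \<eta>2 (\<lambda>x. of_real (dy j x))"
    using \<Phi>c_H1_0[of j] unfolding H1_0_def by blast
  have G: "G1 \<in> L2 \<Omega>" "G2 \<in> L2 \<Omega>" using v(3,4) by (auto simp: L2_tendsto_def)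
  have d: "(\<lambda>x. of_real (dx j x)) \<in> L2 \<Omega>" "(\<lambda>x. of_real (dy j x)) \<in> L2 \<Omega>"
    using \<eta>(3,4) by (auto simp: L2_tendsto_def)
  have "L2_inner \<Omega> (\<lambda>x. of_real (dx j x)) G1 + L2_inner \<Omega> (\<lambda>x. of_real (dy j x)) G2 = L2_inner \<Omega> (\<Phi>c j) f"
  proof (rule LIMSEQ_unique)
    show "(\<lambda>n. L2_inner \<Omega> (\<eta> n) f) \<longlonglongrightarrow> L2_inner \<Omega> (\<Phi>c j) f"
      by (rule L2_tendsto_inner_left[OF f \<eta>(2)])
    show "(\<lambda>n. L2_inner \<Omega> (\<eta> n) f) \<longlonglongrightarrow>
        L2_inner \<Omega> (\<lambda>x. of_real (dx j x)) G1 + L2_inner \<Omega> (\<lambda>x. of_real (dy j x)) G2"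
      using tendsto_add[OF L2_tendsto_inner_left[OF G(1) \<eta>(3)] L2_tendsto_inner_left[OF G(2) \<eta>(4)]]
      by (simp add: weak[OF \<eta>(1)])
  qed
  moreover have "L2_inner \<Omega> (\<lambda>x. of_real (dx j x)) G1 + L2_inner \<Omega> (\<lambda>x. of_real (dy j x)) G2
      = of_real (E j) * L2_inner \<Omega> (\<Phi>c j) u"
  proof (rule LIMSEQ_unique)
    show "(\<lambda>n. of_real (E j) * L2_inner \<Omega> (\<Phi>c j) (v n)) \<longlonglongrightarrow> of_real (E j) * L2_inner \<Omega> (\<Phi>c j) u"
      by (intro tendsto_mult tendsto_const L2_tendsto_inner[OF \<Phi>c_L2 v(2)])
    have "of_real (E j) * L2_inner \<Omega> (\<Phi>c j) (v n)
        = L2_inner \<Omega> (\<lambda>x. of_real (dx j x)) (v1 n) + L2_inner \<Omega> (\<lambda>x. of_real (dy j x)) (v2 n)" for n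
      using arg_cong[OF \<Phi>c_integration_by_parts[OF v(1), of n j], of cnj]
      unfolding complex_cnj_add complex_cnj_mult complex_cnj_complex_of_real L2_inner_cnj[symmetric] by simp
    thus "(\<lambda>n. of_real (E j) * L2_inner \<Omega> (\<Phi>c j) (v n)) \<longlonglongrightarrow>
        L2_inner \<Omega> (\<lambda>x. of_real (dx j x)) G1 + L2_inner \<Omega> (\<lambda>x. of_real (dy j x)) G2"
      using tendsto_add[OF L2_tendsto_inner[OF d(1) v(3)] L2_tendsto_inner[OF d(2) v(4)]] by simp
  qed
  ultimately show ?thesis by simp
qed

text \<open>Testing against the centre kernel makes the completeness of the sine modes unnecessary.\<close>

lemma centre_expansion:
  assumes u: "u \<in> L2 \<Omega>" and w: "continuous_on \<Omega> w" "AE x in lebesgue_on \<Omega>. u x = w x" "w (a, b) = 0"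
    and sum: "summable (\<lambda>j. cmod (L2_inner \<Omega> u (\<Phi>c j)))"
  shows "(\<lambda>j. of_real (\<Phi>p j) * L2_inner \<Omega> u (\<Phi>c j)) sums 0"
proof -
  \<comment> \<open>The factor by which the centre kernel damps the mode \<open>j\<close>: zero
    outside the finite set \<open>F N\<close>, in [0, 1], and tending to 1 for fixed
    \<open>j\<close>.\<close>
  define r where "r N j = kernel_coeff N (S j) * kernel_coeff N (T j)" for N j
  define t where "t j N = of_real (r N j * \<Phi>p j) * L2_inner \<Omega> u (\<Phi>c j)" for N j
  define F where "F N = (\<lambda>j. (S j, T j)) -` ({..N} \<times> {..N})" for N
  have finF: "finite (F N)" for N
    unfolding F_def by (intro finite_vimageI inj_on_ST) simp
  have F0: "r N j = 0" if "j \<notin> F N" for N j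
    using that by (auto simp: F_def r_def kernel_coeff_def)
  have r1: "0 \<le> r N j" "r N j \<le> 1" for N j
    using kernel_coeff_bounds[of N "S j"] kernel_coeff_bounds[of N "T j"]
    by (auto simp: r_def mult_le_one)
  have kernel: "(\<Sum>j\<in>F N. r N j * \<Phi>p j * \<Phi> j x) = 1 / (a * b) * centre_kernel a b N x" for N x
  proof -
    obtain y z where x: "x = (y, z)" by (cases x)
    define p where "p s = kernel_coeff N s * ((-1) ^ s * sin (real (2 * s + 1) * (pi * y / (2 * a))))" for s
    define q where "q s = kernel_coeff N s * ((-1) ^ s * sin (real (2 * s + 1) * (pi * z / (2 * b))))" for s
    have img: "(\<lambda>j. (S j, T j)) ` F N = {..N} \<times> {..N}"
      unfolding F_def by (rule surj_image_vimage_eq[OF bij_is_surj[OF bij]])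
    have "(\<Sum>j\<in>F N. r N j * \<Phi>p j * \<Phi> j x) = (\<Sum>j\<in>F N. 1 / (a * b) * (p (S j) * q (T j)))"
      unfolding mult.assoc x \<Phi>_product_centre r_def p_def q_def by (intro sum.cong refl) simp
    also have "\<dots> = 1 / (a * b) * (\<Sum>j\<in>F N. p (S j) * q (T j))" by (simp add: sum_distrib_left)
    also have "(\<Sum>j\<in>F N. p (S j) * q (T j)) = (\<Sum>(s, t)\<in>{..N} \<times> {..N}. p s * q t)"
      unfolding img[symmetric] by (subst sum.reindex[OF inj_on_ST]) (simp add: o_def)
    also have "\<dots> = (\<Sum>s\<le>N. p s) * (\<Sum>s\<le>N. q s)"
      by (simp add: sum_product sum.cartesian_product)
    also have "\<dots> = centre_kernel a b N x"
      unfolding p_def q_def sin_odd_power_kernel[symmetric] by (simp add: centre_kernel_def x)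
    finally show ?thesis .
  qed
  have kL2: "(\<lambda>x. complex_of_real (centre_kernel a b N x)) \<in> L2 \<Omega>" for N
    by (intro continuous_in_L2 continuous_on_of_real continuous_centre_kernel)
  \<comment> \<open>The damped series is finite and equals, up to 1/(ab), the pairing of
    \<open>u\<close> with the kernel, which tends to 0.\<close>
  have "(\<Sum>j. t j N) = of_real (1 / (a * b)) * L2_inner \<Omega> u (\<lambda>x. of_real (centre_kernel a b N x))" for N
  proof -
    have "(\<Sum>j. t j N) = (\<Sum>j\<in>F N. t j N)"
      by (rule suminf_finite[OF finF]) (simp_all add: t_def F0)
    also have "\<dots> = L2_inner \<Omega> u (\<lambda>x. \<Sum>j\<in>F N. of_real (r N j * \<Phi>p j) * \<Phi>c j x)"
      unfolding t_def
      by (subst L2_inner_sum_right) (simp_all add: u \<Phi>c_L2 L2_scale L2_inner_scale_right del: of_real_mult)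
    also have "(\<lambda>x. \<Sum>j\<in>F N. of_real (r N j * \<Phi>p j) * \<Phi>c j x)
        = (\<lambda>x. of_real (1 / (a * b)) * complex_of_real (centre_kernel a b N x))"
      unfolding of_real_mult[symmetric] of_real_sum[symmetric] kernel ..
    finally show ?thesis by (simp only: L2_inner_scale_right)
  qed
  hence lim0: "(\<lambda>N. \<Sum>j. t j N) \<longlonglongrightarrow> 0"
    using tendsto_mult[OF tendsto_const L2_inner_centre_kernel_tendsto[OF ab u w], of "of_real (1 / (a * b))"]
    by simp
  define M where "M j = 1 / sqrt (a * b) * cmod (L2_inner \<Omega> u (\<Phi>c j))" for j
  have M: "summable M" unfolding M_def by (intro summable_mult sum)
  have "cmod (t j N) \<le> M j" for j N
  proof -
    have "\<bar>r N j\<bar> * \<bar>\<Phi>p j\<bar> \<le> 1 * (1 / sqrt (a * b))"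
      using r1[of N j] unfolding abs_\<Phi>p by (intro mult_right_mono) (auto simp: ab less_imp_le)
    from mult_right_mono[OF this norm_ge_zero, of "L2_inner \<Omega> u (\<Phi>c j)"]
    show ?thesis by (simp add: t_def M_def norm_mult abs_mult)
  qed
  hence bound: "\<forall>\<^sub>F (j, N) in at_top \<times>\<^sub>F sequentially. norm (t j N) \<le> M j"
    by (intro always_eventually allI) (simp add: case_prod_unfold)
  define \<alpha> where "\<alpha> j = of_real (\<Phi>p j) * L2_inner \<Omega> u (\<Phi>c j)" for j
  have lim: "(\<lambda>N. t j N) \<longlonglongrightarrow> \<alpha> j" for j
  proof -
    have "(\<lambda>N. r N j) \<longlonglongrightarrow> 1 * 1"
      unfolding r_def by (intro tendsto_mult kernel_coeff_tendsto)
    hence "(\<lambda>N. of_real (r N j * \<Phi>p j) * L2_inner \<Omega> u (\<Phi>c j)) \<longlonglongrightarrow> of_real ((1 * 1) * \<Phi>p j) * L2_inner \<Omega> u (\<Phi>c j)"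
      by (intro tendsto_mult tendsto_of_real tendsto_const)
    thus ?thesis by (simp add: t_def \<alpha>_def)
  qed
  \<comment> \<open>Absolute summability of the coefficients allows the limit \<open>N\<close> to
    infinity inside the sum, so the undamped series has the limit of the damped ones.\<close>
  from tannerys_theorem[OF lim bound M sequentially_bot]
  have sum\<alpha>: "summable (\<lambda>j. norm (\<alpha> j))" and lim\<alpha>: "(\<lambda>N. \<Sum>j. t j N) \<longlonglongrightarrow> suminf \<alpha>" by simp_all
  have "summable \<alpha>" by (rule summable_norm_cancel[OF sum\<alpha>])
  moreover have "suminf \<alpha> = 0" by (rule LIMSEQ_unique[OF lim\<alpha> lim0])
  ultimately have "\<alpha> sums 0" by (simp add: sums_iff)
  thus ?thesis unfolding \<alpha>_def[abs_def] .
qed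

section \<open>Eigenvectors of the point scatterer\<close>

text \<open>The subtracted E_j/(E_j^2 + 1) is the mean of 1/(E_j - i) and 1/(E_j + i). It encodes
  the condition that both deficiency coefficients agree, and it makes the terms O(1/E_j^2).\<close>

definition secular_term :: "nat \<Rightarrow> real \<Rightarrow> real" where
  "secular_term j x = 1 / (E j - x) - E j / ((E j)\<^sup>2 + 1)"

lemma secular_term_eq:
  assumes "E j \<noteq> x"
  shows "secular_term j x = (x * E j + 1) / ((E j - x) * ((E j)\<^sup>2 + 1))"
proof -
  have "E j - x \<noteq> 0" "(E j)\<^sup>2 + 1 \<noteq> 0" using assms zero_le_power2[of "E j"] by linarith+
  from diff_frac_eq[OF this, of 1 "E j"]
  have "secular_term j x = (1 * ((E j)\<^sup>2 + 1) - E j * (E j - x)) / ((E j - x) * ((E j)\<^sup>2 + 1))"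
    by (simp only: secular_term_def)
  also have "1 * ((E j)\<^sup>2 + 1) - E j * (E j - x) = x * E j + 1"
    by (simp add: power2_eq_square algebra_simps)
  finally show ?thesis .
qed

text \<open>Over a common denominator the quadratic terms of the numerator cancel and x E_j + 1 is
  left, while the denominator is cubic in E_j by the relative gap. The summand 1 is absorbed by 1
  \<le> E_j/E_0.\<close>

lemma abs_secular_term_le:
  assumes \<gamma>: "\<gamma> > 0" "\<gamma> * E j \<le> \<bar>E j - x\<bar>" and x: "x \<ge> 0"
  shows "\<bar>secular_term j x\<bar> \<le> (x + 1 / E 0) / \<gamma> / (E j)\<^sup>2"
proof -
  have ne: "E j \<noteq> x" using \<gamma>(2) mult_pos_pos[OF \<gamma>(1) E_pos[of j]] by auto
  have "1 \<le> E j / E 0" using E_le[of 0 j] E_pos[of 0] by simp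
  hence num: "x * E j + 1 \<le> (x + 1 / E 0) * E j" by (simp add: distrib_right)
  have den: "\<gamma> * E j * (E j)\<^sup>2 \<le> \<bar>E j - x\<bar> * ((E j)\<^sup>2 + 1)"
    using \<gamma> E_pos[of j] by (intro mult_mono) auto
  have "\<bar>secular_term j x\<bar> = (x * E j + 1) / (\<bar>E j - x\<bar> * ((E j)\<^sup>2 + 1))"
    using x E_pos[of j] by (simp add: secular_term_eq[OF ne] abs_divide abs_mult abs_of_nonneg)
  also have "\<dots> \<le> ((x + 1 / E 0) * E j) / (\<gamma> * E j * (E j)\<^sup>2)"
  proof (rule frac_le[OF _ num _ den])
    show "0 \<le> (x + 1 / E 0) * E j"
      using x E_pos[of 0] E_pos[of j] by (intro mult_nonneg_nonneg add_nonneg_nonneg) auto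
    show "0 < \<gamma> * E j * (E j)\<^sup>2" using \<gamma>(1) E_pos[of j] by simp
  qed
  also have "\<dots> = (x + 1 / E 0) / \<gamma> / (E j)\<^sup>2"
    using E_pos[of j] \<gamma> by (simp add: field_simps)
  finally show ?thesis .
qed

text \<open>The Green function is \<open>w\<close> plus \<tau>/2 times each of the two deficiency
  vectors, where \<open>w\<close> has the coefficients \<open>c\<close> and vanishes at the centre
  by the secular equation. The free factor \<tau> is used later to fix norm and sign. Membership in
  the adjoint reduces to the vanishing of an expansion at the centre, which is
  \<open>centre_expansion\<close>.\<close>

lemma H_pi_eigenvector:
  fixes \<tau> :: complex
  assumes \<gamma>: "\<gamma> > 0" "\<And>j. \<gamma> * E j \<le> \<bar>E j - \<mu>\<bar>" and \<mu>: "\<mu> \<ge> 0"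
    and secular: "(\<lambda>j. secular_term j \<mu>) sums 0"
  shows "\<exists>\<psi>. L2_tendsto \<Omega> (\<lambda>N x. \<Sum>j<N. \<tau> * of_real (\<Phi>p j / (E j - \<mu>)) * \<Phi>c j x) \<psi>
    \<and> H_pi a b E \<Phi> \<psi> (\<lambda>x. of_real \<mu> * \<psi> x)"
proof -
  have ne: "E j \<noteq> \<mu>" for j using \<gamma>(2)[of j] mult_pos_pos[OF \<gamma>(1) E_pos[of j]] by auto
  define gc where "gc z j = of_real (\<Phi>p j) / (of_real (E j) - z)" for z :: complex and j
  have green: "\<exists>g. is_green a b E \<Phi> z g" if z: "Re z = 0" for z
  proof -
    have "cmod (gc z j) \<le> (1 / sqrt (a * b)) / E j" for j
    proof -
      have "E j \<le> cmod (of_real (E j) - z)" using abs_Re_le_cmod[of "of_real (E j) - z"] z E_pos[of j] by simp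
      moreover from this have "0 < cmod (of_real (E j) - z)" using E_pos[of j] by linarith
      ultimately show ?thesis unfolding gc_def norm_divide norm_of_real abs_\<Phi>p
        using E_pos[of j] sqrt_ab_pos by (intro divide_left_mono mult_pos_pos) auto
    qed
    from spectral_series_exists[OF this] show ?thesis by (simp add: is_green_def gc_def)
  qed
  obtain gp gm where gp: "is_green a b E \<Phi> \<i> gp" and gm: "is_green a b E \<Phi> (- \<i>) gm"
    using green[of \<i>] green[of "- \<i>"] by auto
  define c where "c j = \<tau> * of_real (\<Phi>p j * secular_term j \<mu>)" for j
  define C where "C = cmod \<tau> * (1 / sqrt (a * b)) * ((\<mu> + 1 / E 0) / \<gamma>)"
  have c: "cmod (c j) \<le> C / (E j)\<^sup>2" for j
  proof -
    have "cmod (c j) = cmod \<tau> * (1 / sqrt (a * b)) * \<bar>secular_term j \<mu>\<bar>"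
      unfolding c_def norm_mult norm_of_real abs_mult abs_\<Phi>p by simp
    also have "\<dots> \<le> cmod \<tau> * (1 / sqrt (a * b)) * ((\<mu> + 1 / E 0) / \<gamma> / (E j)\<^sup>2)"
      using sqrt_ab_pos by (intro mult_left_mono abs_secular_term_le \<gamma> \<mu>) auto
    finally show ?thesis by (simp add: C_def)
  qed
  define w where "w = (\<lambda>x. \<Sum>j. c j * \<Phi>c j x)"
  note w = neg_Laplacian_series[OF c, folded w_def]
  have w_p: "w (a, b) = 0"
  proof -
    have "c j * \<Phi>c j (a, b) = \<tau> * of_real (1 / (a * b)) * of_real (secular_term j \<mu>)" for j
      unfolding c_def \<Phi>p_square[of j, symmetric] by (simp add: power2_eq_square)
    moreover have "(\<lambda>j. \<tau> * of_real (1 / (a * b)) * of_real (secular_term j \<mu>)) sums (\<tau> * of_real (1 / (a * b)) * of_real 0)"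
      by (intro sums_mult sums_of_real secular)
    ultimately show ?thesis unfolding w_def by (simp add: sums_iff)
  qed
  define \<psi> where "\<psi> x = w x + (\<tau> / 2) * gp x + (\<tau> / 2) * gm x" for x
  \<comment> \<open>The partial fraction identity behind the decomposition: adding back the mean of
    the two resolvents at i and -i restores 1/(E_j - \<mu>).\<close>
  have pf: "of_real (secular_term j \<mu>) + 1 / 2 * (1 / (of_real (E j) - \<i>) + 1 / (of_real (E j) + \<i>))
      = of_real (1 / (E j - \<mu>))" for j
  proof -
    have nz: "of_real (E j) - \<i> \<noteq> 0" "of_real (E j) + \<i> \<noteq> 0" by (auto simp: complex_eq_iff)
    have prod: "(of_real (E j) - \<i>) * (of_real (E j) + \<i>) = of_real ((E j)\<^sup>2 + 1)"
      by (simp add: algebra_simps power2_eq_square)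
    have "1 / (of_real (E j) - \<i>) + 1 / (of_real (E j) + \<i>) = of_real (2 * E j / ((E j)\<^sup>2 + 1))"
      unfolding add_frac_eq[OF nz] prod of_real_divide by (simp only: mult_1_left) simp
    hence "of_real (secular_term j \<mu>) + 1 / 2 * (1 / (of_real (E j) - \<i>) + 1 / (of_real (E j) + \<i>))
        = of_real (secular_term j \<mu> + 1 / 2 * (2 * E j / ((E j)\<^sup>2 + 1)))"
      by (simp only: of_real_add of_real_mult of_real_divide of_real_1 of_real_numeral)
    also have "secular_term j \<mu> + 1 / 2 * (2 * E j / ((E j)\<^sup>2 + 1)) = 1 / (E j - \<mu>)"
      by (simp add: secular_term_def)
    finally show ?thesis .
  qed
  have \<psi>_lim: "L2_tendsto \<Omega> (\<lambda>N x. \<Sum>j<N. \<tau> * of_real (\<Phi>p j / (E j - \<mu>)) * \<Phi>c j x) \<psi>"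
  proof -
    have "L2_tendsto \<Omega> (\<lambda>N x. (\<Sum>j<N. c j * \<Phi>c j x)
        + (\<tau> / 2) * (\<Sum>j<N. of_real (\<Phi>p j) / (of_real (E j) - \<i>) * of_real (\<Phi> j x))
        + (\<tau> / 2) * (\<Sum>j<N. of_real (\<Phi>p j) / (of_real (E j) - (- \<i>)) * of_real (\<Phi> j x))) \<psi>"
      unfolding \<psi>_def[abs_def]
      by (intro L2_tendsto_add L2_tendsto_scale w gp[unfolded is_green_def] gm[unfolded is_green_def])
    moreover have "(\<Sum>j<N. c j * \<Phi>c j x)
        + (\<tau> / 2) * (\<Sum>j<N. of_real (\<Phi>p j) / (of_real (E j) - \<i>) * of_real (\<Phi> j x))
        + (\<tau> / 2) * (\<Sum>j<N. of_real (\<Phi>p j) / (of_real (E j) - (- \<i>)) * of_real (\<Phi> j x))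
        = (\<Sum>j<N. \<tau> * of_real (\<Phi>p j / (E j - \<mu>)) * \<Phi>c j x)" for N x
    proof -
      have "c j * \<Phi>c j x
          + (\<tau> / 2) * (of_real (\<Phi>p j) / (of_real (E j) - \<i>) * of_real (\<Phi> j x))
          + (\<tau> / 2) * (of_real (\<Phi>p j) / (of_real (E j) - (- \<i>)) * of_real (\<Phi> j x))
          = \<tau> * of_real (\<Phi>p j) * (of_real (secular_term j \<mu>)
              + 1 / 2 * (1 / (of_real (E j) - \<i>) + 1 / (of_real (E j) + \<i>))) * \<Phi>c j x" for j
        by (simp add: c_def algebra_simps)
      also have "\<dots> j = \<tau> * of_real (\<Phi>p j / (E j - \<mu>)) * \<Phi>c j x" for j
        unfolding pf by simp
      finally show ?thesis by (simp only: sum_distrib_left sum.distrib[symmetric])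
    qed
    ultimately show ?thesis by simp
  qed
  have \<psi>: "\<psi> \<in> L2 \<Omega>" using \<psi>_lim by (simp add: L2_tendsto_def)
  have "H0 \<Omega> (a, b) w f" if "neg_Laplacian \<Omega> w f" for f
    unfolding H0_def using that w_p continuous_on_subset[OF w(1) subset_UNIV] by blast
  then obtain f0 where "H0 \<Omega> (a, b) w f0" using w(3) by blast
  hence coeffs: "deficiency_coeffs a b E \<Phi> \<psi> (\<tau> / 2) (\<tau> / 2)"
    unfolding deficiency_coeffs_def using gp gm
    by (intro exI[of _ w] exI[of _ f0] exI[of _ gp] exI[of _ gm]) (simp add: \<psi>_def)
  have "L2_inner \<Omega> u (\<lambda>x. of_real \<mu> * \<psi> x) = L2_inner \<Omega> f \<psi>" if H: "H0 \<Omega> (a, b) u f" for u f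
  proof -
    have Lap: "neg_Laplacian \<Omega> u f" using H by (simp add: H0_def)
    obtain v where v: "continuous_on \<Omega> v" "AE x in lebesgue_on \<Omega>. u x = v x" "v (a, b) = 0"
      using H unfolding H0_def by blast
    note uf = neg_Laplacian_L2[OF Lap]
    define \<alpha> where "\<alpha> j = L2_inner \<Omega> u (\<Phi>c j)" for j
    have fE: "L2_inner \<Omega> f (\<Phi>c j) = of_real (E j) * \<alpha> j" for j
      using arg_cong[OF neg_Laplacian_coefficient[OF Lap, of j], of cnj]
      unfolding complex_cnj_mult complex_cnj_complex_of_real L2_inner_cnj[symmetric] \<alpha>_def .
    \<comment> \<open>Each coefficient of \<open>u\<close> is the corresponding one of
      \<open>f\<close> divided by E_j. Bessel for \<open>f\<close> and summability of E_j^(-2)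
      combine through p e \<le> p^2 + e^2.\<close>
    have "summable (\<lambda>j. cmod (\<alpha> j))"
    proof (rule summable_comparison_test')
      have "summable (\<lambda>j. (cmod (L2_inner \<Omega> (\<Phi>c j) f))\<^sup>2)"
        by (rule summableI_nonneg_bounded[where x = "(L2_norm \<Omega> f)\<^sup>2"])
           (simp_all add: Bessel_inequality[OF \<Phi>c_L2 \<Phi>c_orthonormal uf(2)])
      thus "summable (\<lambda>j. (cmod (L2_inner \<Omega> (\<Phi>c j) f))\<^sup>2 + 1 / (E j)\<^sup>2)"
        by (rule summable_add[OF _ summable_inverse_E_power2])
      fix j
      have "cmod (L2_inner \<Omega> (\<Phi>c j) f) = E j * cmod (\<alpha> j)"
        using arg_cong[OF fE[of j], of cmod] E_pos[of j] L2_inner_cnj[of \<Omega> f "\<Phi>c j"]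
        by (simp add: norm_mult)
      hence "cmod (\<alpha> j) = cmod (L2_inner \<Omega> (\<Phi>c j) f) * (1 / E j)" using E_pos[of j] by simp
      also have "\<dots> \<le> (cmod (L2_inner \<Omega> (\<Phi>c j) f))\<^sup>2 + (1 / E j)\<^sup>2"
      proof -
        have sq: "p * e \<le> p\<^sup>2 + e\<^sup>2" if "0 \<le> p" "0 \<le> e" for p e :: real
          using sum_squares_bound[of p e] mult_nonneg_nonneg[OF that] by linarith
        show ?thesis by (rule sq) (use E_pos[of j] in auto)
      qed
      finally show "norm (cmod (\<alpha> j)) \<le> (cmod (L2_inner \<Omega> (\<Phi>c j) f))\<^sup>2 + 1 / (E j)\<^sup>2"
        by (simp add: power_divide)
    qed
    hence zero: "(\<lambda>j. of_real (\<Phi>p j) * \<alpha> j) sums 0"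
      unfolding \<alpha>_def by (rule centre_expansion[OF uf(1) v])
    define ps where "ps N x = (\<Sum>j<N. \<tau> * of_real (\<Phi>p j / (E j - \<mu>)) * \<Phi>c j x)" for N x
    have lim: "(\<lambda>N. of_real \<mu> * L2_inner \<Omega> u (ps N) - L2_inner \<Omega> f (ps N))
        \<longlonglongrightarrow> of_real \<mu> * L2_inner \<Omega> u \<psi> - L2_inner \<Omega> f \<psi>"
      using \<psi>_lim unfolding ps_def[symmetric]
      by (intro tendsto_diff tendsto_mult tendsto_const L2_tendsto_inner uf)
    \<comment> \<open>The factor \<mu> - E_j cancels the denominators, so the defect in the adjoint
      relation is a partial sum of the expansion of \<open>u\<close> at the centre.\<close>
    have "of_real \<mu> * L2_inner \<Omega> u (ps N) - L2_inner \<Omega> f (ps N)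
        = - \<tau> * (\<Sum>j<N. of_real (\<Phi>p j) * \<alpha> j)" for N
    proof -
      have i: "L2_inner \<Omega> h (ps N) = (\<Sum>j<N. \<tau> * of_real (\<Phi>p j / (E j - \<mu>)) * L2_inner \<Omega> h (\<Phi>c j))"
        if "h \<in> L2 \<Omega>" for h
        unfolding ps_def[abs_def]
        by (subst L2_inner_sum_right[OF that]) (simp_all only: \<Phi>c_L2 L2_scale L2_inner_scale_right)
      have "of_real \<mu> * (\<tau> * of_real (\<Phi>p j / (E j - \<mu>)) * \<alpha> j)
          - \<tau> * of_real (\<Phi>p j / (E j - \<mu>)) * (of_real (E j) * \<alpha> j) = - \<tau> * (of_real (\<Phi>p j) * \<alpha> j)" for j
      proof -
        have "complex_of_real (\<Phi>p j / (E j - \<mu>)) * (of_real \<mu> - of_real (E j)) = of_real (\<Phi>p j / (E j - \<mu>) * (\<mu> - E j))"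
          by simp
        also have "\<Phi>p j / (E j - \<mu>) * (\<mu> - E j) = - \<Phi>p j" using ne[of j] by (simp add: field_simps)
        finally have e: "complex_of_real (\<Phi>p j / (E j - \<mu>)) * (of_real \<mu> - of_real (E j)) = - of_real (\<Phi>p j)" by simp
        have "of_real \<mu> * (\<tau> * of_real (\<Phi>p j / (E j - \<mu>)) * \<alpha> j)
          - \<tau> * of_real (\<Phi>p j / (E j - \<mu>)) * (of_real (E j) * \<alpha> j)
          = \<tau> * (complex_of_real (\<Phi>p j / (E j - \<mu>)) * (of_real \<mu> - of_real (E j))) * \<alpha> j"
          by (simp only: algebra_simps)
        thus ?thesis unfolding e by simp
      qed
      thus ?thesis unfolding i[OF uf(1)] i[OF uf(2)] fE \<alpha>_def[symmetric]
        by (simp only: sum_distrib_left sum_subtractf[symmetric])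
    qed
    hence "(\<lambda>N. of_real \<mu> * L2_inner \<Omega> u (ps N) - L2_inner \<Omega> f (ps N)) \<longlonglongrightarrow> - \<tau> * 0"
      using tendsto_mult[OF tendsto_const zero[unfolded sums_def], of "- \<tau>"] by simp
    from LIMSEQ_unique[OF lim this] show ?thesis by (simp add: L2_inner_scale_right)
  qed
  hence "adjoint_op \<Omega> (H0 \<Omega> (a, b)) \<psi> (\<lambda>x. of_real \<mu> * \<psi> x)"
    unfolding adjoint_op_def using \<psi> L2_scale[OF \<psi>] by simp
  hence "H_pi a b E \<Phi> \<psi> (\<lambda>x. of_real \<mu> * \<psi> x)"
    unfolding H_pi_def by (intro conjI exI[of _ "\<tau> / 2"] coeffs refl)
  with \<psi>_lim show ?thesis by (intro exI[of _ \<psi>] conjI)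
qed

end


section \<open>The secular equation\<close>

context rectangle_spectrum
begin

text \<open>The relative distance |E_j - x|/E_j is smallest at one of the two neighbours of
  \<open>x\<close>: below \<open>x\<close> it is x/E_j - 1, above it is 1 - x/E_j, and both are
  monotone in E_j.\<close>

lemma spectral_gap:
  assumes x: "E i < x" "x < E (Suc i)"
  shows "\<exists>\<gamma>>0. \<forall>j. \<gamma> * E j \<le> \<bar>E j - x\<bar>"
proof -
  define \<gamma> where "\<gamma> = min ((x - E i) / E i) (1 - x / E (Suc i))"
  have "\<gamma> > 0" using x E_pos[of i] E_pos[of "Suc i"] by (simp add: \<gamma>_def)
  moreover have "\<gamma> * E j \<le> \<bar>E j - x\<bar>" for j
  proof (cases "j \<le> i")
    case True
    have "\<gamma> * E j \<le> (x - E i) / E i * E i"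
      using x E_le[OF True] E_pos[of i] E_pos[of j] \<open>\<gamma> > 0\<close>
      by (intro mult_mono) (auto simp: \<gamma>_def)
    thus ?thesis using E_le[OF True] E_pos[of i] by simp
  next
    case False
    hence le: "E (Suc i) \<le> E j" by (intro E_le) simp
    have "\<gamma> * E j \<le> (1 - x / E (Suc i)) * E j"
      using E_pos[of j] by (intro mult_right_mono) (auto simp: \<gamma>_def)
    moreover have "x \<le> x / E (Suc i) * E j"
    proof -
      have "x * E (Suc i) \<le> x * E j" using x E_pos[of i] le by (intro mult_left_mono) auto
      thus ?thesis using E_pos[of "Suc i"] by (simp add: le_divide_eq)
    qed
    ultimately have "\<gamma> * E j \<le> E j - x" by (simp add: algebra_simps)
    thus ?thesis by linarith
  qed
  ultimately show ?thesis by blast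
qed

definition regular_term :: "nat \<Rightarrow> nat \<Rightarrow> real \<Rightarrow> real" where
  "regular_term i j x = (if j = i \<or> j = Suc i then 0 else secular_term j x)"

text \<open>Without the two end points the nearest poles are E_(i-1) and E_(i+2), which keep a
  positive relative distance from the whole closed interval. The bound is therefore uniform up to
  the ends.\<close>

lemma regular_term_bound:
  "\<exists>C. \<forall>j. \<forall>x\<in>{E i..E (Suc i)}. \<bar>regular_term i j x\<bar> \<le> C * (1 / (E j)\<^sup>2)"
proof -
  \<comment> \<open>For \<open>i = 0\<close> there is no lower neighbour and \<open>i - 1\<close>
    would be 0 again; the value 1 is a placeholder.\<close>
  define \<gamma>1 where "\<gamma>1 = (if i = 0 then 1 else (E i - E (i - 1)) / E i)"
  define \<gamma>2 where "\<gamma>2 = 1 - E (Suc i) / E (Suc (Suc i))"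
  define \<gamma> where "\<gamma> = min \<gamma>1 \<gamma>2"
  have mono: "m < n \<Longrightarrow> E m < E n" for m n using E_mono by (simp add: strict_mono_def)
  have \<gamma>: "\<gamma> > 0" "\<gamma> \<le> \<gamma>1" "\<gamma> \<le> \<gamma>2"
    using mono[of "i - 1" i] mono[of "Suc i" "Suc (Suc i)"] E_pos
    by (auto simp: \<gamma>_def \<gamma>1_def \<gamma>2_def)
  have gap: "\<gamma> * E j \<le> \<bar>E j - x\<bar>" if x: "x \<in> {E i..E (Suc i)}" and j: "j \<noteq> i" "j \<noteq> Suc i" for j x
  proof (cases "j < i")
    case True
    hence le: "E j \<le> E (i - 1)" "i \<noteq> 0" by (auto intro: E_le)
    have "\<gamma> * E j \<le> \<gamma>1 * E i"
      using \<gamma> mono[OF True] E_pos[of j] by (intro mult_mono) auto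
    also have "\<dots> = E i - E (i - 1)" using le E_pos[of i] by (simp add: \<gamma>1_def)
    finally show ?thesis using x le by auto
  next
    case False
    hence le: "E (Suc (Suc i)) \<le> E j" using j by (intro E_le) auto
    have "\<gamma> * E j \<le> \<gamma>2 * E j" using \<gamma> E_pos[of j] by (intro mult_right_mono) auto
    moreover have "E (Suc i) \<le> E (Suc i) / E (Suc (Suc i)) * E j"
      using mult_left_mono[OF le, of "E (Suc i)"] E_pos[of "Suc i"] E_pos[of "Suc (Suc i)"]
      by (simp add: le_divide_eq)
    ultimately have "\<gamma> * E j \<le> E j - E (Suc i)" by (simp add: \<gamma>2_def algebra_simps)
    thus ?thesis using x by auto
  qed
  define C where "C = (E (Suc i) + 1 / E 0) / \<gamma>"
  have "\<bar>regular_term i j x\<bar> \<le> C * (1 / (E j)\<^sup>2)" if x: "x \<in> {E i..E (Suc i)}" for j x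
  proof (cases "j = i \<or> j = Suc i")
    case True
    thus ?thesis using \<gamma>(1) E_pos[of "Suc i"] E_pos[of 0]
      by (auto simp: regular_term_def C_def intro!: divide_nonneg_nonneg add_nonneg_nonneg less_imp_le)
  next
    case False
    have "\<bar>secular_term j x\<bar> \<le> (x + 1 / E 0) / \<gamma> / (E j)\<^sup>2"
      using \<gamma>(1) gap[OF x] False x E_pos[of i] by (intro abs_secular_term_le) auto
    also have "\<dots> \<le> C / (E j)\<^sup>2"
      unfolding C_def using x \<gamma>(1) by (intro divide_right_mono) auto
    finally show ?thesis using False by (simp add: regular_term_def)
  qed
  thus ?thesis by blast
qed

text \<open>Multiplying the secular function by \<open>(x - E\<^sub>i)(E\<^sub>i\<^sub>+\<^sub>1 - x)\<close> removes its two poles; the product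
  is continuous on the closed interval and has opposite signs at the end points.\<close>

lemma secular_root_exists:
  "\<exists>x. E i < x \<and> x < E (Suc i) \<and> (\<lambda>j. secular_term j x) sums 0"
proof -
  let ?I = "{E i..E (Suc i)}"
  have lt: "E i < E (Suc i)" using E_mono by (simp add: strict_mono_def)
  obtain C where C: "\<And>j x. x \<in> ?I \<Longrightarrow> \<bar>regular_term i j x\<bar> \<le> C * (1 / (E j)\<^sup>2)"
    using regular_term_bound[of i] by blast
  have sumC: "summable (\<lambda>j. C * (1 / (E j)\<^sup>2))"
    by (intro summable_mult summable_inverse_E_power2)
  define R where "R x = (\<Sum>j. regular_term i j x)" for x
  have unif: "uniform_limit ?I (\<lambda>N x. \<Sum>j<N. regular_term i j x) R sequentially"
    unfolding R_def by (rule Weierstrass_m_test[OF _ sumC]) (simp only: real_norm_def C)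
  have ne: "E j - x \<noteq> 0" if "x \<in> ?I" "j \<noteq> i" "j \<noteq> Suc i" for j x
  proof -
    have "E j < E i \<or> E (Suc i) < E j"
      using that(2,3) E_mono by (cases "j < i") (auto simp: strict_mono_less)
    thus ?thesis using that(1) by auto
  qed
  have cont_term: "continuous_on ?I (regular_term i j)" for j
  proof (cases "j = i \<or> j = Suc i")
    case True
    hence "regular_term i j = (\<lambda>x. 0)" by (auto simp: regular_term_def)
    thus ?thesis by simp
  next
    case False
    hence "regular_term i j = (\<lambda>x. 1 / (E j - x) - E j / ((E j)\<^sup>2 + 1))"
      by (auto simp: regular_term_def secular_term_def)
    thus ?thesis using ne False by (auto intro!: continuous_intros)
  qed
  have cont_R: "continuous_on ?I R"
    by (rule uniform_limit_theorem[OF _ unif]) (auto intro!: always_eventually continuous_on_sum cont_term)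
  define e where "e j = E j / ((E j)\<^sup>2 + 1)" for j
  \<comment> \<open>The first two differences are what the poles 1/(E_i - x) and 1/(E_(i+1) - x)
    leave after the multiplication; their regularising parts are the \<open>e\<close> terms.\<close>
  define P where "P x = (x - E i) - (E (Suc i) - x) + (x - E i) * (E (Suc i) - x) * (R x - e i - e (Suc i))" for x
  have "continuous_on ?I P"
    unfolding P_def[abs_def] by (intro continuous_intros cont_R)
  moreover have "P (E i) \<le> 0" "0 \<le> P (E (Suc i))" using lt by (simp_all add: P_def)
  ultimately obtain x where x: "E i \<le> x" "x \<le> E (Suc i)" "P x = 0"
    using IVT'[of P "E i" 0 "E (Suc i)"] lt by (metis less_imp_le)
  \<comment> \<open>At the ends \<open>P\<close> is minus and plus the length of the gap, so the
    zero is interior and division by the prefactor is allowed.\<close>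
  have "x \<noteq> E i" "x \<noteq> E (Suc i)" using x(3) lt by (auto simp: P_def)
  hence lx: "E i < x" "x < E (Suc i)" using x by auto
  have "summable (\<lambda>j. regular_term i j x)"
    by (rule summable_comparison_test'[OF sumC]) (use C x in auto)
  hence "(\<lambda>j. regular_term i j x) sums R x" unfolding R_def by (rule summable_sums)
  moreover have "(\<lambda>j. if j \<in> {i, Suc i} then secular_term j x else 0) sums (\<Sum>j\<in>{i, Suc i}. secular_term j x)"
    by (rule sums_If_finite_set) simp
  ultimately have "(\<lambda>j. regular_term i j x + (if j \<in> {i, Suc i} then secular_term j x else 0))
      sums (R x + (\<Sum>j\<in>{i, Suc i}. secular_term j x))" by (rule sums_add)
  moreover have "regular_term i j x + (if j \<in> {i, Suc i} then secular_term j x else 0) = secular_term j x" for j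
    by (auto simp: regular_term_def)
  moreover have "R x + (\<Sum>j\<in>{i, Suc i}. secular_term j x) = 0"
  proof -
    define u v A B where "u = x - E i" and "v = E (Suc i) - x"
      and "A = 1 / (E i - x)" and "B = 1 / (E (Suc i) - x)"
    have uv: "u > 0" "v > 0" using lx by (simp_all add: u_def v_def)
    have S: "(\<Sum>j\<in>{i, Suc i}. secular_term j x) = A + B - e i - e (Suc i)"
      by (simp add: secular_term_def e_def A_def B_def)
    have "A = - 1 / u" using lx by (simp add: A_def u_def field_simps)
    hence A: "u * A = -1" using uv by simp
    have B: "v * B = 1" using uv by (simp add: B_def v_def)
    have "u * v * (R x + (A + B - e i - e (Suc i))) = u * v * (R x - e i - e (Suc i)) + v * (u * A) + u * (v * B)"
      by (simp add: algebra_simps)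
    also have "\<dots> = P x" unfolding A B by (simp add: P_def u_def v_def)
    finally have "u * v * (R x + (\<Sum>j\<in>{i, Suc i}. secular_term j x)) = 0" unfolding S x(3) .
    thus ?thesis using uv by simp
  qed
  ultimately have "(\<lambda>j. secular_term j x) sums 0" by simp
  thus ?thesis using lx by blast
qed

section \<open>Counting eigenvalues in short windows\<close>

text \<open>For fixed \<open>s\<close> two admissible values of \<open>t\<close> differ by at most \<open>b/\<pi>\<close>, because
  \<open>(t' + 1/2)\<^sup>2 - (t + 1/2)\<^sup>2 \<ge> (t' - t)\<^sup>2\<close>.\<close>

lemma window_card:
  "\<exists>K>0. \<forall>z Z. E 0 \<le> Z \<longrightarrow> z \<le> Z \<longrightarrow>
    finite {j. z \<le> E j \<and> E j \<le> z + 1} \<and> real (card {j. z \<le> E j \<and> E j \<le> z + 1}) \<le> K * sqrt Z"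
proof -
  \<comment> \<open>Counted from the smallest admissible \<open>t\<close>, which the
    \<open>+ 1\<close> includes.\<close>
  define B where "B = nat \<lfloor>b / pi\<rfloor> + 1"
  define W where "W z s = {j. S j = s \<and> z \<le> E j \<and> E j \<le> z + 1}" for z s
  have fibre: "finite (W z s)" "card (W z s) \<le> B" for z s
  proof -
    have "\<exists>t0. T ` W z s \<subseteq> {t0..<t0 + B}"
    proof (cases "W z s = {}")
      case False
      then obtain j0 where j0: "j0 \<in> W z s" "\<And>j. j \<in> W z s \<Longrightarrow> T j0 \<le> T j"
        using ex_has_least_nat[of "\<lambda>j. j \<in> W z s" _ T] by blast
      have "T j < T j0 + B" if j: "j \<in> W z s" for j
      proof -
        define d where "d = real (T j) - real (T j0)"
        have d: "d \<ge> 0" using j0(2)[OF j] by (simp add: d_def)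
        have "d\<^sup>2 \<le> d\<^sup>2 + d * (2 * real (T j0) + 1)" using d by simp
        also have "\<dots> = (real (T j) + 1/2)\<^sup>2 - (real (T j0) + 1/2)\<^sup>2"
          by (simp add: d_def power2_eq_square algebra_simps)
        finally have "pi\<^sup>2 * (d\<^sup>2 / b\<^sup>2) \<le> pi\<^sup>2 * (((real (T j) + 1/2)\<^sup>2 - (real (T j0) + 1/2)\<^sup>2) / b\<^sup>2)"
          by (intro mult_left_mono divide_right_mono) auto
        also have "\<dots> = E j - E j0"
          using j j0(1) by (simp add: E_eq energy_def W_def algebra_simps diff_divide_distrib)
        also have "\<dots> \<le> 1" using j j0(1) by (auto simp: W_def)
        finally have "(pi * d / b)\<^sup>2 \<le> 1\<^sup>2" by (simp add: power_mult_distrib power_divide)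
        hence "pi * d / b \<le> 1" by (rule power2_le_imp_le) simp
        hence "d \<le> b / pi" using ab by (simp add: field_simps)
        hence "int (T j) - int (T j0) \<le> \<lfloor>b / pi\<rfloor>" by (simp add: d_def le_floor_iff)
        thus ?thesis by (simp add: B_def)
      qed
      thus ?thesis using j0(2) by (intro exI[of _ "T j0"]) auto
    qed auto
    then obtain t0 where sub: "T ` W z s \<subseteq> {t0..<t0 + B}" by blast
    have inj: "inj_on T (W z s)"
    proof (rule inj_onI)
      fix i j assume "i \<in> W z s" "j \<in> W z s" "T i = T j"
      hence "(S i, T i) = (S j, T j)" by (simp add: W_def)
      thus "i = j" by (simp only: ST_eq_iff)
    qed
    show "finite (W z s)" using finite_imageD[OF finite_subset[OF sub] inj] by simp
    have "card (T ` W z s) \<le> card {t0..<t0 + B}" by (rule card_mono[OF _ sub]) simp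
    thus "card (W z s) \<le> B" using inj by (simp add: card_image)
  qed
  \<comment> \<open>The values of \<open>s\<close> number at most a sqrt(Z+1)/pi + 1. Both summands
    become multiples of sqrt Z by means of \<open>E 0 \<le> Z\<close>, and each \<open>s\<close>
    contributes at most \<open>B\<close> eigenvalues.\<close>
  define K where "K = (a / pi * sqrt (1 + 1 / E 0) + 1 / sqrt (E 0)) * real B"
  have "0 < B" by (simp add: B_def)
  hence "0 < real B" by (simp only: of_nat_0_less_iff)
  moreover have "0 \<le> a / pi * sqrt (1 + 1 / E 0)" "0 < 1 / sqrt (E 0)"
    using ab E_pos[of 0] by simp_all
  ultimately have "K > 0" unfolding K_def by (intro mult_pos_pos add_nonneg_pos)
  moreover have "finite {j. z \<le> E j \<and> E j \<le> z + 1} \<and> real (card {j. z \<le> E j \<and> E j \<le> z + 1}) \<le> K * sqrt Z"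
    if Z: "E 0 \<le> Z" and z: "z \<le> Z" for z Z
  proof -
    define n where "n = nat \<lfloor>a * sqrt (Z + 1) / pi\<rfloor> + 1"
    have sub: "{j. z \<le> E j \<and> E j \<le> z + 1} \<subseteq> (\<Union>s<n. W z s)"
    proof
      fix j assume j: "j \<in> {j. z \<le> E j \<and> E j \<le> z + 1}"
      have "(real (S j))\<^sup>2 \<le> (real (S j) + 1/2)\<^sup>2" by (intro power_mono) auto
      hence "pi\<^sup>2 * ((real (S j))\<^sup>2 / a\<^sup>2) \<le> pi\<^sup>2 * ((real (S j) + 1/2)\<^sup>2 / a\<^sup>2)"
        by (intro mult_left_mono divide_right_mono) auto
      also have "\<dots> \<le> E j" by (simp add: E_eq energy_def distrib_left)
      also have "\<dots> \<le> Z + 1" using j z by simp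
      finally have "(pi * real (S j) / a)\<^sup>2 \<le> Z + 1" by (simp add: power_mult_distrib power_divide)
      hence "pi * real (S j) / a \<le> sqrt (Z + 1)" by (rule real_le_rsqrt)
      hence "real (S j) \<le> a * sqrt (Z + 1) / pi" using ab by (simp add: field_simps)
      hence "int (S j) \<le> \<lfloor>a * sqrt (Z + 1) / pi\<rfloor>" by (simp add: le_floor_iff)
      hence "S j < n" by (simp add: n_def)
      thus "j \<in> (\<Union>s<n. W z s)" using j by (auto simp: W_def)
    qed
    have fin: "finite (\<Union>s<n. W z s)" using fibre by blast
    have "card {j. z \<le> E j \<and> E j \<le> z + 1} \<le> card (\<Union>s<n. W z s)" by (rule card_mono[OF fin sub])
    also have "\<dots> \<le> (\<Sum>s<n. card (W z s))" by (rule card_UN_le) simp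
    also have "\<dots> \<le> (\<Sum>s<n. B)" by (intro sum_mono fibre)
    finally have "real (card {j. z \<le> E j \<and> E j \<le> z + 1}) \<le> real n * real B"
      by (metis sum_constant card_lessThan of_nat_mult of_nat_le_iff of_nat_id)
    also have "\<dots> \<le> (a / pi * sqrt (1 + 1 / E 0) + 1 / sqrt (E 0)) * sqrt Z * real B"
    proof (rule mult_right_mono)
      have Z0: "Z > 0" using Z E_pos[of 0] by linarith
      have "real n \<le> a * sqrt (Z + 1) / pi + 1"
        using ab Z0 by (simp add: n_def)
      moreover have "sqrt (Z + 1) \<le> sqrt (1 + 1 / E 0) * sqrt Z"
        using Z E_pos[of 0] by (simp add: real_sqrt_mult[symmetric] field_simps)
      hence "a * sqrt (Z + 1) / pi \<le> a / pi * sqrt (1 + 1 / E 0) * sqrt Z"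
        using mult_left_mono[of "sqrt (Z + 1)" "sqrt (1 + 1 / E 0) * sqrt Z" "a / pi"] ab by simp
      moreover have "1 \<le> 1 / sqrt (E 0) * sqrt Z"
        using Z E_pos[of 0] by simp
      ultimately show "real n \<le> (a / pi * sqrt (1 + 1 / E 0) + 1 / sqrt (E 0)) * sqrt Z"
        by (simp add: distrib_right)
    qed simp
    finally show ?thesis using finite_subset[OF sub fin] by (simp add: K_def mult_ac)
  qed
  ultimately show ?thesis by blast
qed

text \<open>The bound for eigenvalues close to \<open>x\<close>, where no cancellation between the
  two parts of the term is to be had.\<close>

lemma secular_term_le:
  assumes "E j \<noteq> x"
  shows "\<bar>secular_term j x\<bar> \<le> 1 / \<bar>E j - x\<bar> + 1 / E j"
proof -
  have "E j / ((E j)\<^sup>2 + 1) \<le> E j / (E j)\<^sup>2"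
    using E_pos[of j] by (intro divide_left_mono) (auto intro!: mult_pos_pos add_pos_pos)
  hence "\<bar>E j / ((E j)\<^sup>2 + 1)\<bar> \<le> 1 / E j"
    using E_pos[of j] by (simp add: power2_eq_square)
  moreover have "\<bar>secular_term j x\<bar> \<le> \<bar>1 / (E j - x)\<bar> + \<bar>E j / ((E j)\<^sup>2 + 1)\<bar>"
    unfolding secular_term_def by (rule abs_triangle_ineq4)
  ultimately show ?thesis by (simp add: abs_divide)
qed

text \<open>Three ranges. For E_j \<ge> 2x a term is O(x/E_j^2), at most a multiple of x^\<theta>
  E_j^(-1-\<theta>). For E_j < 2x at distance at least 1, the eigenvalues are grouped by the integer
  part m of the distance, with O(sqrt x) in each group, and 1/m \<le> x^\<theta> m^(-1-\<theta>)
  replaces a harmonic sum. The O(sqrt x) eigenvalues at distance below 1 contribute O(1/\<delta>)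
  each.\<close>

lemma secular_sum_bound:
  assumes \<theta>: "0 < \<theta>" "\<theta> \<le> 1"
  shows "\<exists>K>0. \<forall>x \<delta> F. E 0 \<le> x \<longrightarrow> 0 < \<delta> \<longrightarrow> \<delta> \<le> 1 \<longrightarrow> finite F \<longrightarrow> (\<forall>j\<in>F. \<delta> \<le> \<bar>E j - x\<bar>) \<longrightarrow>
    (\<Sum>j\<in>F. \<bar>secular_term j x\<bar>) \<le> K * (x powr (1/2 + \<theta>) + sqrt x / \<delta>)"
proof -
  obtain K where K: "K > 0" "\<And>z Z. E 0 \<le> Z \<Longrightarrow> z \<le> Z \<Longrightarrow> finite {j. z \<le> E j \<and> E j \<le> z + 1}"
    "\<And>z Z. E 0 \<le> Z \<Longrightarrow> z \<le> Z \<Longrightarrow> real (card {j. z \<le> E j \<and> E j \<le> z + 1}) \<le> K * sqrt Z"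
    using window_card by blast
  define H where "H = (\<Sum>j. E j powr (- (1 + \<theta>)))"
  have sumH: "summable (\<lambda>j. E j powr (- (1 + \<theta>)))" using \<theta> by (intro summable_E_powr) simp
  have H0: "H \<ge> 0" unfolding H_def by (intro suminf_nonneg sumH) simp
  have H_le: "(\<Sum>j\<in>F. E j powr (- (1 + \<theta>))) \<le> H" if "finite F" for F
    unfolding H_def by (intro sum_le_suminf sumH that) simp
  define h where "h m = real m powr (- (1 + \<theta>))" for m
  define N where "N = (\<Sum>m. h m)"
  have sumN: "summable h" unfolding h_def using \<theta> summable_real_powr_iff[of "- (1 + \<theta>)"] by simp
  have N_le: "(\<Sum>m\<in>A. h m) \<le> N" if "finite A" for A
    unfolding N_def by (intro sum_le_suminf sumN that) (simp add: h_def)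
  have N0: "N \<ge> 0" unfolding N_def by (intro suminf_nonneg sumN) (simp add: h_def)
  \<comment> \<open>Eigenvalues at distance between m and m+1 from \<open>x\<close> fill one unit
    window on each side, hence the factor 2.\<close>
  have window2: "real (card A) \<le> 2 * (K * sqrt Z)"
    if "A \<subseteq> {j. z \<le> E j \<and> E j \<le> z + 1} \<union> {j. z' \<le> E j \<and> E j \<le> z' + 1}" "E 0 \<le> Z" "z \<le> Z" "z' \<le> Z"
    for A z z' Z
  proof -
    have "card A \<le> card ({j. z \<le> E j \<and> E j \<le> z + 1} \<union> {j. z' \<le> E j \<and> E j \<le> z' + 1})"
      using that K(2) by (intro card_mono) auto
    also have "\<dots> \<le> card {j. z \<le> E j \<and> E j \<le> z + 1} + card {j. z' \<le> E j \<and> E j \<le> z' + 1}"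
      by (rule card_Un_le)
    finally show ?thesis using K(3)[of Z z] K(3)[of Z z'] that by linarith
  qed
  define C1 where "C1 = (1 + 1 / (E 0)\<^sup>2) * 2 * H"
  define C2 where "C2 = 2 * H"
  define C3 where "C3 = 4 * K * N"
  define C4 where "C4 = 2 * K * (1 + 1 / E 0)"
  define L where "L = (C1 + C2) / sqrt (E 0) + C3 + C4"
  have C: "C1 \<ge> 0" "C2 \<ge> 0" "C3 \<ge> 0" "C4 > 0"
    using H0 N0 K(1) E_pos[of 0] by (auto simp: C1_def C2_def C3_def C4_def intro!: mult_nonneg_nonneg mult_pos_pos add_pos_pos)
  have "L > 0" unfolding L_def using C E_pos[of 0] by (intro add_nonneg_pos add_nonneg_nonneg divide_nonneg_nonneg) auto
  moreover have "(\<Sum>j\<in>F. \<bar>secular_term j x\<bar>) \<le> L * (x powr (1/2 + \<theta>) + sqrt x / \<delta>)"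
    if x: "E 0 \<le> x" and \<delta>: "0 < \<delta>" "\<delta> \<le> 1" and F: "finite F" "\<forall>j\<in>F. \<delta> \<le> \<bar>E j - x\<bar>" for x \<delta> F
  proof -
    have x0: "x > 0" using x E_pos[of 0] by linarith
    have ne: "E j \<noteq> x" if "j \<in> F" for j using F(2) that \<delta> by force
    define F1 where "F1 = {j\<in>F. 1 \<le> \<bar>E j - x\<bar> \<and> 2 * x \<le> E j}"
    define F2 where "F2 = {j\<in>F. 1 \<le> \<bar>E j - x\<bar> \<and> E j < 2 * x}"
    define F3 where "F3 = {j\<in>F. \<bar>E j - x\<bar> < 1}"
    have fin: "finite F1" "finite F2" "finite F3" using F by (auto simp: F1_def F2_def F3_def)
    have powr_E: "1 / E j = E j powr \<theta> * E j powr (- (1 + \<theta>))" for j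
      using E_pos[of j] by (simp add: powr_add[symmetric] powr_minus divide_inverse)
    have S1: "(\<Sum>j\<in>F1. \<bar>secular_term j x\<bar>) \<le> C1 * x powr \<theta>"
    proof -
      have "\<bar>secular_term j x\<bar> \<le> (1 + 1 / (E 0)\<^sup>2) * 2 * x powr \<theta> * E j powr (- (1 + \<theta>))" if j: "j \<in> F1" for j
      proof -
        have E2: "2 * x \<le> E j" using j by (simp add: F1_def)
        have "\<bar>secular_term j x\<bar> \<le> (x + 1 / E 0) / (1/2) / (E j)\<^sup>2"
          using E2 x0 by (intro abs_secular_term_le) auto
        also have "\<dots> \<le> (1 + 1 / (E 0)\<^sup>2) * 2 * (x / (E j)\<^sup>2)"
        proof -
          have "1 / E 0 \<le> x / (E 0)\<^sup>2" using x E_pos[of 0] by (simp add: power2_eq_square field_simps)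
          hence "x + 1 / E 0 \<le> (1 + 1 / (E 0)\<^sup>2) * x" by (simp add: distrib_right)
          hence "(x + 1 / E 0) * (2 / (E j)\<^sup>2) \<le> (1 + 1 / (E 0)\<^sup>2) * x * (2 / (E j)\<^sup>2)"
            by (rule mult_right_mono) simp
          also have "\<dots> = (1 + 1 / (E 0)\<^sup>2) * 2 * (x / (E j)\<^sup>2)" by simp
          also have "(x + 1 / E 0) * (2 / (E j)\<^sup>2) = (x + 1 / E 0) / (1/2) / (E j)\<^sup>2" by simp
          finally show ?thesis .
        qed
        also have "x / (E j)\<^sup>2 \<le> x powr \<theta> * E j powr (- (1 + \<theta>))"
        proof -
          \<comment> \<open>Here \<theta> \<le> 1 enters: x^(1-\<theta>) is monotone in the base,
            and x \<le> E_j in this range.\<close>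
          have "x = x powr \<theta> * x powr (1 - \<theta>)" using x0 by (simp add: powr_add[symmetric])
          also have "\<dots> \<le> x powr \<theta> * E j powr (1 - \<theta>)"
            using E2 x0 \<theta> by (intro mult_left_mono powr_mono2) auto
          finally have "x / (E j)\<^sup>2 \<le> x powr \<theta> * E j powr (1 - \<theta>) / E j powr 2"
            using E_pos[of j] by (simp add: powr_numeral divide_right_mono)
          also have "\<dots> = x powr \<theta> * E j powr (1 - \<theta> - 2)"
            by (simp only: powr_diff[of "E j" "1 - \<theta>" 2] times_divide_eq_right)
          finally show ?thesis by (simp add: algebra_simps)
        qed
        finally show ?thesis using E_pos[of 0] by (simp add: mult_left_mono mult.assoc)
      qed
      hence "(\<Sum>j\<in>F1. \<bar>secular_term j x\<bar>) \<le> (1 + 1 / (E 0)\<^sup>2) * 2 * x powr \<theta> * (\<Sum>j\<in>F1. E j powr (- (1 + \<theta>)))"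
        unfolding sum_distrib_left by (rule sum_mono)
      also have "\<dots> \<le> (1 + 1 / (E 0)\<^sup>2) * 2 * x powr \<theta> * H"
        using H_le[OF fin(1)] by (intro mult_left_mono mult_nonneg_nonneg add_nonneg_nonneg) auto
      finally show ?thesis by (simp add: C1_def mult_ac)
    qed
    have S2: "(\<Sum>j\<in>F2. \<bar>secular_term j x\<bar>) \<le> C3 * x powr (1/2 + \<theta>) + C2 * x powr \<theta>"
    proof -
      define m where "m j = nat \<lfloor>\<bar>E j - x\<bar>\<rfloor>" for j
      have m: "1 \<le> m j" "real (m j) \<le> \<bar>E j - x\<bar>" "\<bar>E j - x\<bar> < real (m j) + 1" "real (m j) \<le> x" if j: "j \<in> F2" for j
      proof -
        have ge: "1 \<le> \<bar>E j - x\<bar>" and le: "\<bar>E j - x\<bar> \<le> x" using j E_pos[of j] by (auto simp: F2_def)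
        have fl: "1 \<le> \<lfloor>\<bar>E j - x\<bar>\<rfloor>" using ge by (simp add: le_floor_iff)
        have r: "1 \<le> m j" "real (m j) = real_of_int \<lfloor>\<bar>E j - x\<bar>\<rfloor>"
          using nat_mono[OF fl] fl by (simp_all add: m_def)
        show "1 \<le> m j" by (rule r)
        show "real (m j) \<le> \<bar>E j - x\<bar>" "\<bar>E j - x\<bar> < real (m j) + 1" unfolding r by linarith+
        thus "real (m j) \<le> x" using le by linarith
      qed
      have "\<bar>secular_term j x\<bar> \<le> x powr \<theta> * h (m j) + 2 * x powr \<theta> * E j powr (- (1 + \<theta>))" if j: "j \<in> F2" for j
      proof -
        have "1 / \<bar>E j - x\<bar> \<le> 1 / real (m j)"
          using m[OF j] by (intro divide_left_mono mult_pos_pos) auto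
        \<comment> \<open>The step that avoids the logarithm: m^\<theta> is at most x^\<theta>,
          since E_j < 2x keeps the distance below \<open>x\<close>.\<close>
        also have "\<dots> = real (m j) powr \<theta> * h (m j)"
          using m(1)[OF j] by (simp add: h_def powr_add[symmetric] powr_minus divide_inverse)
        also have "\<dots> \<le> x powr \<theta> * h (m j)"
          using m[OF j] \<theta> by (intro mult_right_mono powr_mono2) (auto simp: h_def)
        finally have A: "1 / \<bar>E j - x\<bar> \<le> x powr \<theta> * h (m j)" .
        have "E j powr \<theta> \<le> (2 * x) powr \<theta>"
          using j \<theta> E_pos[of j] by (intro powr_mono2) (auto simp: F2_def)
        also have "\<dots> = 2 powr \<theta> * x powr \<theta>" using x0 by (simp add: powr_mult)
        also have "\<dots> \<le> 2 * x powr \<theta>"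
          using \<theta> powr_mono[of \<theta> 1 2] by (intro mult_right_mono) auto
        finally have "1 / E j \<le> 2 * x powr \<theta> * E j powr (- (1 + \<theta>))"
          unfolding powr_E by (intro mult_right_mono) auto
        with A secular_term_le[OF ne] j show ?thesis by (fastforce simp: F2_def)
      qed
      hence "(\<Sum>j\<in>F2. \<bar>secular_term j x\<bar>) \<le> x powr \<theta> * (\<Sum>j\<in>F2. h (m j))
          + 2 * x powr \<theta> * (\<Sum>j\<in>F2. E j powr (- (1 + \<theta>)))"
        unfolding sum_distrib_left sum.distrib[symmetric] by (rule sum_mono)
      moreover have "2 * x powr \<theta> * (\<Sum>j\<in>F2. E j powr (- (1 + \<theta>))) \<le> 2 * x powr \<theta> * H"
        using H_le[OF fin(2)] by (intro mult_left_mono) auto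
      moreover have "x powr \<theta> * (\<Sum>j\<in>F2. h (m j)) \<le> C3 * x powr (1/2 + \<theta>)"
      proof -
        have "(\<Sum>j\<in>F2. h (m j)) = (\<Sum>n\<in>m ` F2. \<Sum>j\<in>{j\<in>F2. m j = n}. h (m j))"
          by (rule sum.image_gen[OF fin(2)])
        also have "\<dots> = (\<Sum>n\<in>m ` F2. real (card {j\<in>F2. m j = n}) * h n)"
          by (intro sum.cong refl) simp
        also have "\<dots> \<le> (\<Sum>n\<in>m ` F2. (4 * K * sqrt x) * h n)"
        proof (intro sum_mono mult_right_mono)
          fix n assume "n \<in> m ` F2"
          then obtain i where i: "i \<in> F2" "n = m i" by blast
          have "{j\<in>F2. m j = n} \<subseteq> {j. x + real n \<le> E j \<and> E j \<le> x + real n + 1}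
              \<union> {j. x - real n - 1 \<le> E j \<and> E j \<le> x - real n - 1 + 1}"
          proof
            fix j assume "j \<in> {j\<in>F2. m j = n}"
            hence j: "j \<in> F2" "m j = n" by auto
            show "j \<in> {j. x + real n \<le> E j \<and> E j \<le> x + real n + 1}
              \<union> {j. x - real n - 1 \<le> E j \<and> E j \<le> x - real n - 1 + 1}"
              using m(2,3)[OF j(1)] unfolding j(2) by auto
          qed
          \<comment> \<open>The upper window starts at x + n with n \<le> x, so the count is taken
            with the bound 2x.\<close>
          hence "real (card {j\<in>F2. m j = n}) \<le> 2 * (K * sqrt (2 * x))"
            by (rule window2) (use x x0 m(4)[OF i(1)] i in auto)
          also have "\<dots> \<le> 2 * (K * (2 * sqrt x))"
          proof -
            have "sqrt 2 \<le> 2" by (rule real_le_lsqrt) auto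
            thus ?thesis using K(1) x0 by (intro mult_left_mono) (auto simp: real_sqrt_mult intro!: mult_right_mono)
          qed
          finally show "real (card {j\<in>F2. m j = n}) \<le> 4 * K * sqrt x" by simp
        qed (simp add: h_def)
        also have "\<dots> = (4 * K * sqrt x) * (\<Sum>n\<in>m ` F2. h n)" by (simp add: sum_distrib_left)
        also have "\<dots> \<le> (4 * K * sqrt x) * N"
          using N_le[of "m ` F2"] fin(2) K(1) x0 by (intro mult_left_mono) auto
        finally have "x powr \<theta> * (\<Sum>j\<in>F2. h (m j)) \<le> x powr \<theta> * ((4 * K * sqrt x) * N)"
          by (rule mult_left_mono) simp
        also have "\<dots> = C3 * x powr (1/2 + \<theta>)"
          using x0 by (simp add: C3_def powr_add powr_half_sqrt mult_ac)
        finally show ?thesis .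
      qed
      ultimately show ?thesis by (simp add: C2_def mult_ac)
    qed
    have S3: "(\<Sum>j\<in>F3. \<bar>secular_term j x\<bar>) \<le> C4 * (sqrt x / \<delta>)"
    proof -
      have "\<bar>secular_term j x\<bar> \<le> (1 + 1 / E 0) / \<delta>" if j: "j \<in> F3" for j
      proof -
        have jF: "j \<in> F" using j by (simp add: F3_def)
        have "1 / \<bar>E j - x\<bar> \<le> 1 / \<delta>" using F(2) jF \<delta> by (intro divide_left_mono mult_pos_pos) auto
        moreover have "1 / E j \<le> 1 / E 0" using E_le[of 0 j] E_pos by (intro divide_left_mono mult_pos_pos) auto
        moreover have "1 / E 0 \<le> 1 / E 0 / \<delta>"
          using \<delta> E_pos[of 0] mult_left_le[of \<delta> "1 / E 0"] by (simp add: le_divide_eq)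
        ultimately show ?thesis using secular_term_le[OF ne[OF jF]] by (simp add: add_divide_distrib)
      qed
      hence "(\<Sum>j\<in>F3. \<bar>secular_term j x\<bar>) \<le> real (card F3) * ((1 + 1 / E 0) / \<delta>)"
        by (rule sum_bounded_above)
      moreover have "real (card F3) \<le> 2 * (K * sqrt x)"
      proof (rule window2)
        show "F3 \<subseteq> {j. x - 1 \<le> E j \<and> E j \<le> x - 1 + 1} \<union> {j. x \<le> E j \<and> E j \<le> x + 1}"
          by (auto simp: F3_def)
      qed (use x in auto)
      hence "real (card F3) * ((1 + 1 / E 0) / \<delta>) \<le> 2 * (K * sqrt x) * ((1 + 1 / E 0) / \<delta>)"
        using \<delta> E_pos[of 0] by (intro mult_right_mono) auto
      moreover have "2 * (K * sqrt x) * ((1 + 1 / E 0) / \<delta>) = C4 * (sqrt x / \<delta>)"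
        by (simp add: C4_def)
      ultimately show ?thesis by linarith
    qed
    have "F = F1 \<union> (F2 \<union> F3)" by (auto simp: F1_def F2_def F3_def)
    moreover have "F1 \<inter> (F2 \<union> F3) = {}" "F2 \<inter> F3 = {}" by (auto simp: F1_def F2_def F3_def)
    ultimately have "(\<Sum>j\<in>F. \<bar>secular_term j x\<bar>) = (\<Sum>j\<in>F1. \<bar>secular_term j x\<bar>)
        + ((\<Sum>j\<in>F2. \<bar>secular_term j x\<bar>) + (\<Sum>j\<in>F3. \<bar>secular_term j x\<bar>))"
      using fin by (simp add: sum.union_disjoint)
    also have "\<dots> \<le> (C1 + C2) * x powr \<theta> + C3 * x powr (1/2 + \<theta>) + C4 * (sqrt x / \<delta>)"
      using S1 S2 S3 by (simp add: distrib_right)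
    \<comment> \<open>The weaker power is absorbed into the stronger one, as \<open>x\<close> is
      bounded below by \<open>E 0\<close>.\<close>
    also have "x powr \<theta> \<le> x powr (1/2 + \<theta>) / sqrt (E 0)"
    proof -
      have "x powr \<theta> * sqrt (E 0) \<le> x powr \<theta> * sqrt x" using x by (intro mult_left_mono) auto
      also have "\<dots> = x powr (1/2 + \<theta>)" using x0 by (simp add: powr_add powr_half_sqrt)
      finally show ?thesis using E_pos[of 0] by (simp add: le_divide_eq)
    qed
    hence "(C1 + C2) * x powr \<theta> + C3 * x powr (1/2 + \<theta>) + C4 * (sqrt x / \<delta>)
        \<le> (C1 + C2) * (x powr (1/2 + \<theta>) / sqrt (E 0)) + C3 * x powr (1/2 + \<theta>) + C4 * (sqrt x / \<delta>)"
      using C by (intro add_right_mono mult_left_mono) auto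
    also have "\<dots> \<le> L * (x powr (1/2 + \<theta>) + sqrt x / \<delta>)"
    proof -
      have "0 \<le> C4 * x powr (1/2 + \<theta>)" "0 \<le> ((C1 + C2) / sqrt (E 0) + C3) * (sqrt x / \<delta>)"
        using C E_pos[of 0] x0 \<delta> by (auto intro!: mult_nonneg_nonneg add_nonneg_nonneg divide_nonneg_nonneg)
      thus ?thesis by (simp add: L_def algebra_simps)
    qed
    finally show ?thesis .
  qed
  ultimately show ?thesis by blast
qed

end


section \<open>Eigenfunctions near a close pair of eigenvalues\<close>

lemma sum_power2_le_power2_sum:
  fixes f :: "'a \<Rightarrow> real"
  assumes "\<And>i. i \<in> A \<Longrightarrow> 0 \<le> f i"
  shows "(\<Sum>i\<in>A. (f i)\<^sup>2) \<le> (\<Sum>i\<in>A. f i)\<^sup>2"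
  using assms
proof (induction A rule: infinite_finite_induct)
  case (insert i A)
  have "0 \<le> f i * (\<Sum>i\<in>A. f i)" using insert.prems by (intro mult_nonneg_nonneg sum_nonneg) auto
  moreover have "(\<Sum>i\<in>A. (f i)\<^sup>2) \<le> (\<Sum>i\<in>A. f i)\<^sup>2" using insert by simp
  ultimately show ?case using insert.hyps by (simp add: power2_sum)
qed simp_all

context rectangle_spectrum
begin

text \<open>This is \<open>a * b\<close> times the squared norm of the Green function at
  \<open>x\<close>, because all values at the centre have modulus 1/sqrt(ab).\<close>

definition resolvent_sum :: "real \<Rightarrow> real" where
  "resolvent_sum x = (\<Sum>j. 1 / (E j - x)\<^sup>2)"

lemma summable_resolvent:
  assumes x: "E i < x" "x < E (Suc i)"
  shows "summable (\<lambda>j. 1 / (E j - x)\<^sup>2)"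
proof -
  obtain \<gamma> where \<gamma>: "\<gamma> > 0" "\<And>j. \<gamma> * E j \<le> \<bar>E j - x\<bar>" using spectral_gap[OF x] by blast
  show ?thesis
  proof (rule summable_comparison_test')
    show "summable (\<lambda>j. 1 / \<gamma>\<^sup>2 * (1 / (E j)\<^sup>2))" by (intro summable_mult summable_inverse_E_power2)
    fix j
    have pos: "0 < \<gamma> * E j" using \<gamma>(1) E_pos[of j] by simp
    have "(\<gamma> * E j)\<^sup>2 \<le> \<bar>E j - x\<bar>\<^sup>2" using \<gamma>(2)[of j] pos by (intro power_mono) auto
    hence q: "(\<gamma> * E j)\<^sup>2 \<le> (E j - x)\<^sup>2" by simp
    have p: "0 < (\<gamma> * E j)\<^sup>2" using pos by (rule zero_less_power)
    have "0 < (E j - x)\<^sup>2" using p q by linarith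
    hence "1 / (E j - x)\<^sup>2 \<le> 1 / (\<gamma> * E j)\<^sup>2"
      by (intro divide_left_mono mult_pos_pos q p) simp_all
    thus "norm (1 / (E j - x)\<^sup>2) \<le> 1 / \<gamma>\<^sup>2 * (1 / (E j)\<^sup>2)"
      by (simp add: power_mult_distrib)
  qed
qed

text \<open>The coefficients of the normalised Green function. The leading sign makes the
  coefficient at \<open>i\<close> positive, where E_i - x is negative.\<close>

definition eigen_coeff :: "nat \<Rightarrow> real \<Rightarrow> nat \<Rightarrow> real" where
  "eigen_coeff i x j = - sgn (\<Phi>p i) * (\<Phi>p j * sqrt (a * b)) / ((E j - x) * sqrt (resolvent_sum x))"

definition is_eigenpair :: "nat \<Rightarrow> real \<Rightarrow> wavefun \<Rightarrow> bool" where
  "is_eigenpair i x \<phi> \<longleftrightarrow> E i < x \<and> x < E (Suc i) \<and> (\<lambda>j. secular_term j x) sums 0 \<and>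
     normalised_eigenfunction \<Omega> (H_pi a b E \<Phi>) x \<phi> \<and> \<phi> \<in> L2 \<Omega> \<and>
     (\<forall>j. L2_inner \<Omega> (\<Phi>c j) \<phi> = of_real (eigen_coeff i x j))"

lemma abs_\<Phi>p_sqrt: "\<bar>\<Phi>p j\<bar> * sqrt (a * b) = 1"
  unfolding abs_\<Phi>p using ab by simp

lemma eigenpair_exists: "\<exists>x \<phi>. is_eigenpair i x \<phi>"
proof -
  obtain x where x: "E i < x" "x < E (Suc i)" and secular: "(\<lambda>j. secular_term j x) sums 0"
    using secular_root_exists[of i] by blast
  obtain \<gamma> where \<gamma>: "\<gamma> > 0" "\<And>j. \<gamma> * E j \<le> \<bar>E j - x\<bar>" using spectral_gap[OF x] by blast
  have ne: "E j \<noteq> x" for j using \<gamma>(2)[of j] mult_pos_pos[OF \<gamma>(1) E_pos[of j]] by auto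
  define Q where "Q = resolvent_sum x"
  have Q_sums: "(\<lambda>j. 1 / (E j - x)\<^sup>2) sums Q"
    unfolding Q_def resolvent_sum_def by (rule summable_sums[OF summable_resolvent[OF x]])
  have Q: "Q > 0"
    unfolding Q_def resolvent_sum_def by (rule suminf_pos[OF summable_resolvent[OF x]]) (simp add: ne)
  \<comment> \<open>The scaling that gives norm 1 and the sign convention of
    \<open>eigen_coeff\<close>.\<close>
  define \<tau> where "\<tau> = - sgn (\<Phi>p i) * sqrt (a * b) / sqrt Q"
  have coeff: "of_real \<tau> * complex_of_real (\<Phi>p j / (E j - x)) = of_real (eigen_coeff i x j)" for j
    unfolding of_real_mult[symmetric] by (simp add: \<tau>_def eigen_coeff_def Q_def mult_ac)
  have "x \<ge> 0" using x E_pos[of i] by linarith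
  from H_pi_eigenvector[OF \<gamma> this secular, of "of_real \<tau>"] obtain \<phi> where
    lim: "L2_tendsto \<Omega> (\<lambda>N x'. \<Sum>j<N. of_real (eigen_coeff i x j) * \<Phi>c j x') \<phi>"
    and H: "H_pi a b E \<Phi> \<phi> (\<lambda>x'. of_real x * \<phi> x')"
    unfolding coeff by blast
  have inner: "L2_inner \<Omega> (\<Phi>c j) \<phi> = of_real (eigen_coeff i x j)" for j
  proof (rule LIMSEQ_unique[OF L2_tendsto_inner[OF \<Phi>c_L2 lim]])
    have *: "L2_inner \<Omega> (\<Phi>c j) (\<lambda>x'. \<Sum>l<N. of_real (eigen_coeff i x l) * \<Phi>c l x')
        = (\<Sum>l<N. if j = l then of_real (eigen_coeff i x l) else 0)" for N
    proof -
      have "L2_inner \<Omega> (\<Phi>c j) (\<lambda>x'. \<Sum>l<N. of_real (eigen_coeff i x l) * \<Phi>c l x')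
          = (\<Sum>l<N. of_real (eigen_coeff i x l) * (if j = l then 1 else 0))"
        by (subst L2_inner_sum_right) (simp_all only: \<Phi>c_L2 L2_scale L2_inner_scale_right \<Phi>c_orthonormal)
      also have "\<dots> = (\<Sum>l<N. if j = l then of_real (eigen_coeff i x l) else 0)"
        by (intro sum.cong) simp_all
      finally show ?thesis .
    qed
    have "\<forall>\<^sub>F N in sequentially. of_real (eigen_coeff i x j)
        = L2_inner \<Omega> (\<Phi>c j) (\<lambda>x'. \<Sum>l<N. of_real (eigen_coeff i x l) * \<Phi>c l x')"
      using eventually_gt_at_top[of j] by (rule eventually_mono) (simp add: *)
    thus "(\<lambda>N. L2_inner \<Omega> (\<Phi>c j) (\<lambda>x'. \<Sum>l<N. of_real (eigen_coeff i x l) * \<Phi>c l x'))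
        \<longlonglongrightarrow> of_real (eigen_coeff i x j)"
      by (rule Lim_transform_eventually[OF tendsto_const])
  qed
  have "(L2_norm \<Omega> \<phi>)\<^sup>2 = 1"
  proof (rule LIMSEQ_unique[OF tendsto_power[OF L2_tendsto_norm[OF lim]]])
    have "(eigen_coeff i x j)\<^sup>2 = 1 / Q * (1 / (E j - x)\<^sup>2)" for j
    proof -
      have "(sgn (\<Phi>p i))\<^sup>2 = 1" using \<Phi>p_nz[of i] by (simp add: sgn_if)
      moreover have "(\<Phi>p j * sqrt (a * b))\<^sup>2 = 1"
      proof -
        have "(\<Phi>p j * sqrt (a * b))\<^sup>2 = (\<bar>\<Phi>p j\<bar> * sqrt (a * b))\<^sup>2" by (simp add: power_mult_distrib)
        thus ?thesis unfolding abs_\<Phi>p_sqrt by simp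
      qed
      ultimately show ?thesis
        using Q by (simp add: eigen_coeff_def Q_def[symmetric] power_divide power_mult_distrib)
    qed
    hence "(L2_norm \<Omega> (\<lambda>x'. \<Sum>j<N. of_real (eigen_coeff i x j) * \<Phi>c j x'))\<^sup>2
        = (\<Sum>j<N. 1 / Q * (1 / (E j - x)\<^sup>2))" for N
      by (subst L2_orthonormal_norm_power2[OF \<Phi>c_L2 \<Phi>c_orthonormal]) simp_all
    moreover have "(\<lambda>N. \<Sum>j<N. 1 / Q * (1 / (E j - x)\<^sup>2)) \<longlonglongrightarrow> 1 / Q * Q"
      using sums_mult[OF Q_sums, of "1 / Q"] by (simp only: sums_def)
    ultimately show "(\<lambda>N. (L2_norm \<Omega> (\<lambda>x'. \<Sum>j<N. of_real (eigen_coeff i x j) * \<Phi>c j x'))\<^sup>2) \<longlonglongrightarrow> 1"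
      using Q by simp
  qed
  hence "L2_norm \<Omega> \<phi> = 1" using L2_norm_nonneg[of \<Omega> \<phi>] by (simp add: power2_eq_1_iff)
  hence "is_eigenpair i x \<phi>"
    using x secular H inner lim by (simp add: is_eigenpair_def normalised_eigenfunction_def L2_tendsto_def)
  thus ?thesis by blast
qed

text \<open>Between the two eigenvalues the resolvent factors 1/(E_i - x) and 1/(E_(i+1) - x) have
  opposite signs. Equal signs at the centre therefore lead to the difference of the eigenfunctions,
  opposite signs to their sum.\<close>

definition pair_superposition :: "nat \<Rightarrow> wavefun" where
  "pair_superposition i x = of_real (1 / sqrt 2 * (\<Phi> i x + - sgn (\<Phi>p i * \<Phi>p (Suc i)) * \<Phi> (Suc i) x))"

text \<open>Both vectors have norm 1, so only their inner product counts; by the choice of signs its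
  two contributions are positive and add up.\<close>

lemma eigenpair_distance:
  assumes "is_eigenpair i x \<phi>"
  shows "(L2_norm \<Omega> (\<lambda>z. \<phi> z - pair_superposition i z))\<^sup>2
    = 2 - 2 * ((1 / (x - E i) + 1 / (E (Suc i) - x)) / sqrt (2 * resolvent_sum x))"
proof -
  have x: "E i < x" "x < E (Suc i)" and \<phi>: "\<phi> \<in> L2 \<Omega>" "L2_norm \<Omega> \<phi> = 1"
    and inner: "\<And>j. L2_inner \<Omega> (\<Phi>c j) \<phi> = of_real (eigen_coeff i x j)"
    using assms by (auto simp: is_eigenpair_def normalised_eigenfunction_def)
  define \<sigma> where "\<sigma> = - sgn (\<Phi>p i * \<Phi>p (Suc i))"
  have \<sigma>: "\<sigma> * \<sigma> = 1" using \<Phi>p_nz[of i] \<Phi>p_nz[of "Suc i"] by (auto simp: \<sigma>_def sgn_if)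
  define d where "d j = (if j = i then 1 else \<sigma>) / sqrt 2" for j
  have sup: "pair_superposition i = (\<lambda>z. \<Sum>j\<in>{i, Suc i}. of_real (d j) * \<Phi>c j z)"
    by (rule ext) (simp add: pair_superposition_def d_def \<sigma>_def[symmetric] distrib_left mult_ac)
  have S: "pair_superposition i \<in> L2 \<Omega>"
    unfolding sup by (intro L2_sum L2_scale \<Phi>c_L2)
  have "(L2_norm \<Omega> (pair_superposition i))\<^sup>2 = (\<Sum>j\<in>{i, Suc i}. (cmod (of_real (d j)))\<^sup>2)"
    unfolding sup by (rule L2_orthonormal_norm_power2[OF \<Phi>c_L2 \<Phi>c_orthonormal]) simp
  also have "\<dots> = (\<Sum>j\<in>{i, Suc i}. (d j)\<^sup>2)" by simp
  also have "\<dots> = 1"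
    using \<sigma> by (simp add: d_def power_divide) (simp add: power2_eq_square)
  finally have norm: "(L2_norm \<Omega> (pair_superposition i))\<^sup>2 = 1" .
  have e1: "eigen_coeff i x i = 1 / (x - E i) / sqrt (resolvent_sum x)"
  proof -
    have "sgn (\<Phi>p i) * (\<Phi>p i * sqrt (a * b)) = 1"
      using abs_\<Phi>p_sqrt[of i] by (simp add: abs_sgn mult_ac)
    hence "eigen_coeff i x i = - 1 / ((E i - x) * sqrt (resolvent_sum x))"
      by (simp add: eigen_coeff_def)
    also have "(E i - x) * sqrt (resolvent_sum x) = - ((x - E i) * sqrt (resolvent_sum x))"
      by (simp add: algebra_simps)
    finally show ?thesis by simp
  qed
  have e2: "\<sigma> * eigen_coeff i x (Suc i) = 1 / (E (Suc i) - x) / sqrt (resolvent_sum x)"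
  proof -
    have "\<Phi>p (Suc i) * sqrt (a * b) = sgn (\<Phi>p (Suc i))"
    proof -
      have "\<Phi>p (Suc i) * sqrt (a * b) = sgn (\<Phi>p (Suc i)) * (\<bar>\<Phi>p (Suc i)\<bar> * sqrt (a * b))"
        by (simp add: sgn_mult_abs flip: mult.assoc)
      thus ?thesis by (simp add: abs_\<Phi>p_sqrt)
    qed
    hence "\<sigma> * eigen_coeff i x (Suc i) = \<sigma> * \<sigma> / ((E (Suc i) - x) * sqrt (resolvent_sum x))"
      by (simp add: eigen_coeff_def \<sigma>_def sgn_mult)
    thus ?thesis by (simp add: \<sigma>)
  qed
  have "L2_inner \<Omega> \<phi> (pair_superposition i) = (\<Sum>j\<in>{i, Suc i}. of_real (d j) * L2_inner \<Omega> \<phi> (\<Phi>c j))"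
    unfolding sup by (subst L2_inner_sum_right) (simp_all add: \<phi> \<Phi>c_L2 L2_scale L2_inner_scale_right)
  also have "\<dots> = (\<Sum>j\<in>{i, Suc i}. of_real (d j * eigen_coeff i x j))"
    by (intro sum.cong refl, subst L2_inner_cnj) (simp add: inner)
  also have "\<dots> = of_real ((eigen_coeff i x i + \<sigma> * eigen_coeff i x (Suc i)) / sqrt 2)"
    by (simp add: d_def add_divide_distrib)
  finally have I: "L2_inner \<Omega> \<phi> (pair_superposition i)
      = of_real ((eigen_coeff i x i + \<sigma> * eigen_coeff i x (Suc i)) / sqrt 2)" .
  have alg: "(A / s + B / s) / t = (A + B) / (t * s)" for A B s t :: real
    by (simp add: add_divide_distrib mult.commute)
  have "Re (L2_inner \<Omega> \<phi> (pair_superposition i))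
      = (1 / (x - E i) + 1 / (E (Suc i) - x)) / sqrt (2 * resolvent_sum x)"
    unfolding I e1 e2 alg real_sqrt_mult by (rule Re_complex_of_real)
  thus ?thesis using L2_norm_diff_power2[OF \<phi>(1) S] norm \<phi>(2) by simp
qed

text \<open>With \<open>X = 1/(x - E\<^sub>i)\<close> and \<open>Y = 1/(E\<^sub>i\<^sub>+\<^sub>1 - x)\<close> the secular equation says that \<open>X - Y\<close> is the sum
  of the remaining terms, so it is small compared with \<open>X + Y \<ge> 1/(E\<^sub>i\<^sub>+\<^sub>1 - E\<^sub>i)\<close>.\<close>

lemma eigenpair_distance_le:
  "\<exists>C>0. \<forall>i x \<phi> D. is_eigenpair i x \<phi> \<longrightarrow>
    (\<forall>F. finite F \<longrightarrow> i \<notin> F \<longrightarrow> Suc i \<notin> F \<longrightarrow> (\<Sum>j\<in>F. \<bar>secular_term j x\<bar>) \<le> D) \<longrightarrow>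
    L2_norm \<Omega> (\<lambda>z. \<phi> z - pair_superposition i z) \<le> C * ((1 + D) * (E (Suc i) - E i))"
proof -
  define W where "W = (\<Sum>j. 1 / (E j)\<^sup>2)"
  have W0: "W \<ge> 0" unfolding W_def by (intro suminf_nonneg summable_inverse_E_power2) simp
  have W_le: "(\<Sum>j\<in>F. 1 / (E j)\<^sup>2) \<le> W" if "finite F" for F
    unfolding W_def by (intro sum_le_suminf summable_inverse_E_power2 that) simp
  define e where "e j = E j / ((E j)\<^sup>2 + 1)" for j
  have e: "0 \<le> e j" "e j \<le> 1 / 2" "(e j)\<^sup>2 \<le> 1 / (E j)\<^sup>2" for j
  proof -
    have pos: "0 < (E j)\<^sup>2 + 1" using zero_le_power2[of "E j"] by linarith
    show "0 \<le> e j" using E_pos[of j] pos by (simp add: e_def)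
    show "e j \<le> 1 / 2" using pos sum_squares_bound[of "E j" 1] by (simp add: e_def divide_le_eq)
    have "e j \<le> 1 / E j"
      using E_pos[of j] pos by (simp add: e_def divide_le_eq power2_eq_square field_simps)
    from power_mono[OF this \<open>0 \<le> e j\<close>, of 2] show "(e j)\<^sup>2 \<le> 1 / (E j)\<^sup>2"
      by (simp add: power_divide)
  qed
  \<comment> \<open>The square root of twice the constant in \<open>\<kappa>\<close> below.\<close>
  define C where "C = sqrt (2 * (5 + 4 * W))"
  have "C > 0" using W0 by (simp add: C_def)
  moreover have "L2_norm \<Omega> (\<lambda>z. \<phi> z - pair_superposition i z) \<le> C * ((1 + D) * (E (Suc i) - E i))"
    if pair: "is_eigenpair i x \<phi>"
      and D: "\<And>F. finite F \<Longrightarrow> i \<notin> F \<Longrightarrow> Suc i \<notin> F \<Longrightarrow> (\<Sum>j\<in>F. \<bar>secular_term j x\<bar>) \<le> D"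
    for i x \<phi> D
  proof -
    have x: "E i < x" "x < E (Suc i)" and secular: "(\<lambda>j. secular_term j x) sums 0"
      using pair by (auto simp: is_eigenpair_def)
    have D0: "D \<ge> 0" using D[of "{}"] by simp
    define X where "X = 1 / (x - E i)"
    define Y where "Y = 1 / (E (Suc i) - x)"
    have XY: "X > 0" "Y > 0" using x by (simp_all add: X_def Y_def)
    \<comment> \<open>The 1 comes from the regularising terms of the two poles, each at most 1/2;
      \<open>D\<close> bounds all other secular terms.\<close>
    have diff: "\<bar>X - Y\<bar> \<le> 1 + D"
    proof -
      have fin: "(\<lambda>j. if j \<in> {i, Suc i} then secular_term j x else 0) sums (\<Sum>j\<in>{i, Suc i}. secular_term j x)"
        by (rule sums_If_finite_set) simp
      have "1 / (E i - x) = - X" using x by (simp add: X_def field_simps)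
      hence val: "(\<Sum>j\<in>{i, Suc i}. secular_term j x) = - X + Y - e i - e (Suc i)"
        by (simp add: secular_term_def e_def Y_def)
      define r where "r j = (if j \<in> {i, Suc i} then 0 else secular_term j x)" for j
      have "(\<lambda>j. secular_term j x - (if j \<in> {i, Suc i} then secular_term j x else 0))
          sums (0 - (- X + Y - e i - e (Suc i)))"
        using sums_diff[OF secular fin] unfolding val .
      also have "(\<lambda>j. secular_term j x - (if j \<in> {i, Suc i} then secular_term j x else 0)) = r"
        by (auto simp: r_def)
      finally have r: "r sums (X - Y + e i + e (Suc i))" by (simp add: algebra_simps)
      have "\<bar>\<Sum>j<N. r j\<bar> \<le> D" for N
      proof -
        have "(\<Sum>j<N. r j) = (\<Sum>j\<in>{..<N} - {i, Suc i}. secular_term j x)"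
          unfolding r_def by (subst sum.If_cases) (auto intro!: sum.cong)
        also have "\<bar>\<dots>\<bar> \<le> (\<Sum>j\<in>{..<N} - {i, Suc i}. \<bar>secular_term j x\<bar>)" by (rule sum_abs)
        also have "\<dots> \<le> D" by (rule D) auto
        finally show ?thesis .
      qed
      hence "\<bar>X - Y + e i + e (Suc i)\<bar> \<le> D"
        using LIMSEQ_le_const2[OF tendsto_rabs[OF r[unfolded sums_def]]] by blast
      thus ?thesis using e(1,2)[of i] e(1,2)[of "Suc i"] by linarith
    qed
    define Q where "Q = resolvent_sum x"
    have Q_pos: "Q > 0"
    proof -
      obtain \<gamma> where \<gamma>: "\<gamma> > 0" "\<And>j. \<gamma> * E j \<le> \<bar>E j - x\<bar>" using spectral_gap[OF x] by blast
      have "E j \<noteq> x" for j using \<gamma>(2)[of j] mult_pos_pos[OF \<gamma>(1) E_pos[of j]] by auto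
      thus ?thesis unfolding Q_def resolvent_sum_def
        by (intro suminf_pos summable_resolvent[OF x]) simp
    qed
    \<comment> \<open>Every other resolvent factor is a secular term plus \<open>e j\<close>; the
      sum of squares of the former is at most the square of their sum, and \<open>W\<close> takes
      care of the latter.\<close>
    have Q_le: "Q \<le> X\<^sup>2 + Y\<^sup>2 + (2 * D\<^sup>2 + 2 * W)"
      unfolding Q_def resolvent_sum_def
    proof (rule suminf_le_const[OF summable_resolvent[OF x]])
      fix N
      let ?F = "{..<N} - {i, Suc i}"
      have "(\<Sum>j<N. 1 / (E j - x)\<^sup>2) \<le> (\<Sum>j\<in>{i, Suc i} \<union> ?F. 1 / (E j - x)\<^sup>2)"
        by (rule sum_mono2) auto
      also have "\<dots> = (\<Sum>j\<in>{i, Suc i}. 1 / (E j - x)\<^sup>2) + (\<Sum>j\<in>?F. 1 / (E j - x)\<^sup>2)"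
        by (rule sum.union_disjoint) auto
      also have "(\<Sum>j\<in>{i, Suc i}. 1 / (E j - x)\<^sup>2) = X\<^sup>2 + Y\<^sup>2"
        by (simp add: X_def Y_def power_divide power2_commute[of "E i"])
      also have "(\<Sum>j\<in>?F. 1 / (E j - x)\<^sup>2) \<le> (\<Sum>j\<in>?F. 2 * \<bar>secular_term j x\<bar>\<^sup>2 + 2 * (1 / (E j)\<^sup>2))"
      proof (rule sum_mono)
        fix j
        have "1 / (E j - x) = secular_term j x + e j" by (simp add: secular_term_def e_def)
        hence "1 / (E j - x)\<^sup>2 = (secular_term j x + e j)\<^sup>2" by (metis power_one_over)
        also have "\<dots> \<le> 2 * (secular_term j x)\<^sup>2 + 2 * (e j)\<^sup>2"
          using sum_squares_bound[of "secular_term j x" "e j"] by (simp add: power2_sum)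
        finally show "1 / (E j - x)\<^sup>2 \<le> 2 * \<bar>secular_term j x\<bar>\<^sup>2 + 2 * (1 / (E j)\<^sup>2)"
          using e(3)[of j] by simp
      qed
      also have "\<dots> = 2 * (\<Sum>j\<in>?F. \<bar>secular_term j x\<bar>\<^sup>2) + 2 * (\<Sum>j\<in>?F. 1 / (E j)\<^sup>2)"
        by (simp add: sum.distrib sum_distrib_left)
      also have "(\<Sum>j\<in>?F. \<bar>secular_term j x\<bar>\<^sup>2) \<le> (\<Sum>j\<in>?F. \<bar>secular_term j x\<bar>)\<^sup>2"
        by (rule sum_power2_le_power2_sum) simp
      also have "\<dots> \<le> D\<^sup>2" by (intro power_mono D sum_nonneg) auto
      finally show "(\<Sum>j<N. 1 / (E j - x)\<^sup>2) \<le> X\<^sup>2 + Y\<^sup>2 + (2 * D\<^sup>2 + 2 * W)"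
        using W_le[of ?F] by simp
    qed
    define h where "h = X + Y"
    \<comment> \<open>From 2(X^2 + Y^2) = h^2 + (X - Y)^2: the 5 collects 1 from (X - Y)^2 and 4
      from the term with D^2, and the 4W comes from the regularising terms.\<close>
    define \<kappa> where "\<kappa> = (5 + 4 * W) * (1 + D)\<^sup>2"
    have h: "h > 0" using XY by (simp add: h_def)
    have \<kappa>: "\<kappa> \<ge> 0" using W0 by (simp add: \<kappa>_def)
    have "2 * Q \<le> h\<^sup>2 + \<kappa>"
    proof -
      have "(X - Y)\<^sup>2 \<le> (1 + D)\<^sup>2" using power_mono[OF diff abs_ge_zero, of 2] by simp
      moreover have "4 * D\<^sup>2 \<le> 4 * (1 + D)\<^sup>2" using D0 by (intro mult_left_mono power_mono) auto
      moreover have "4 * W \<le> 4 * W * (1 + D)\<^sup>2"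
        using W0 D0 mult_left_mono[of 1 "(1 + D)\<^sup>2" "4 * W"] by (simp add: one_le_power)
      moreover have "2 * (X\<^sup>2 + Y\<^sup>2) = h\<^sup>2 + (X - Y)\<^sup>2"
        by (simp add: h_def power2_eq_square algebra_simps)
      ultimately show ?thesis using Q_le unfolding \<kappa>_def by (simp add: distrib_right)
    qed
    hence "sqrt (2 * Q) \<le> sqrt (h\<^sup>2 + \<kappa>)" by (rule real_sqrt_le_mono)
    moreover have "0 < sqrt (2 * Q)" using Q_pos by simp
    ultimately have "h / sqrt (h\<^sup>2 + \<kappa>) \<le> h / sqrt (2 * Q)"
      using h by (intro divide_left_mono mult_pos_pos) auto
    \<comment> \<open>With s^2 = h^2 + \<kappa> and h \<le> s, h/s is at least h^2/s^2, which
      dominates 1 - \<kappa>/h^2.\<close>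
    moreover have "1 - \<kappa> / h\<^sup>2 \<le> h / sqrt (h\<^sup>2 + \<kappa>)"
    proof -
      define s where "s = sqrt (h\<^sup>2 + \<kappa>)"
      have s: "s\<^sup>2 = h\<^sup>2 + \<kappa>" using \<kappa> by (simp add: s_def)
      have hs: "h \<le> s" unfolding s_def using \<kappa> by (intro real_le_rsqrt) simp
      have s0: "s > 0" using hs h by linarith
      have "h * h \<le> h * s" using hs h by (intro mult_left_mono) auto
      hence "h\<^sup>2 / s\<^sup>2 \<le> h / s" using s0 by (simp add: power2_eq_square divide_le_eq)
      moreover have "1 - \<kappa> / h\<^sup>2 \<le> h\<^sup>2 / s\<^sup>2"
      proof -
        have "(h\<^sup>2 - \<kappa>) * (h\<^sup>2 + \<kappa>) \<le> h\<^sup>2 * h\<^sup>2"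
          by (simp add: algebra_simps)
        moreover have "h\<^sup>2 > 0" "h\<^sup>2 + \<kappa> > 0" using h \<kappa> by (auto intro: add_pos_nonneg)
        ultimately have "(h\<^sup>2 - \<kappa>) / h\<^sup>2 \<le> h\<^sup>2 / (h\<^sup>2 + \<kappa>)"
          by (simp add: divide_le_eq le_divide_eq)
        thus ?thesis using h unfolding s by (simp add: diff_divide_distrib)
      qed
      ultimately show ?thesis unfolding s_def by linarith
    qed
    ultimately have "(L2_norm \<Omega> (\<lambda>z. \<phi> z - pair_superposition i z))\<^sup>2 \<le> 2 * (\<kappa> / h\<^sup>2)"
      unfolding eigenpair_distance[OF pair] X_def[symmetric] Y_def[symmetric] h_def[symmetric] Q_def[symmetric]
      by linarith
    also have "\<dots> \<le> 2 * (\<kappa> * (E (Suc i) - E i)\<^sup>2)"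
    proof -
      \<comment> \<open>Since \<open>x\<close> lies inside the gap, already one of the two poles is
        at least the reciprocal of its length.\<close>
      have "1 / (E (Suc i) - E i) \<le> X" unfolding X_def using x by (intro divide_left_mono) auto
      hence "1 / (E (Suc i) - E i) \<le> h" using XY by (simp add: h_def)
      hence "1 / h \<le> E (Suc i) - E i" using x h by (simp add: field_simps)
      hence "(1 / h)\<^sup>2 \<le> (E (Suc i) - E i)\<^sup>2" using h by (intro power_mono) auto
      from mult_left_mono[OF this \<kappa>] show ?thesis by (simp add: power_divide)
    qed
    also have "\<dots> = (C * ((1 + D) * (E (Suc i) - E i)))\<^sup>2"
      using W0 by (simp add: C_def \<kappa>_def power_mult_distrib)
    finally show ?thesis
      by (rule power2_le_imp_le) (use \<open>C > 0\<close> D0 x in auto)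
  qed
  ultimately show ?thesis by blast
qed

end

section \<open>Simplicity of the spectrum\<close>

text \<open>A coincidence between two modes makes \<open>a\<^sup>2/b\<^sup>2\<close> rational, and then all eigenvalues are integer
  multiples of one number.\<close>

lemma coincidence_imp_gap:
  assumes ab: "a > 0" "b > 0" and eq: "mode_energy a b (n, m) = mode_energy a b (n', m')"
    and ne: "(n, m) \<noteq> (n', m')"
  shows "\<exists>\<kappa>>0. \<forall>s t s' t'. energy a b s t < energy a b s' t' \<longrightarrow> \<kappa> \<le> energy a b s' t' - energy a b s t"
proof -
  \<comment> \<open>The coincidence says that (n^2 - n'^2)/a^2 equals (m'^2 - m^2)/b^2; absolute
    values give nonnegative integers with u/a^2 = v/b^2.\<close>
  define u where "u = \<bar>(int n)\<^sup>2 - (int n')\<^sup>2\<bar>"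
  define v where "v = \<bar>(int m')\<^sup>2 - (int m)\<^sup>2\<bar>"
  have "(real n)\<^sup>2 / a\<^sup>2 + (real m)\<^sup>2 / b\<^sup>2 = (real n')\<^sup>2 / a\<^sup>2 + (real m')\<^sup>2 / b\<^sup>2"
  proof -
    have en: "mode_energy a b (k, l) = pi\<^sup>2 / 4 * ((real k)\<^sup>2 / a\<^sup>2 + (real l)\<^sup>2 / b\<^sup>2)" for k l
      by (simp add: mode_energy_def distrib_left)
    show ?thesis using eq unfolding en by simp
  qed
  hence rel: "((real n)\<^sup>2 - (real n')\<^sup>2) / a\<^sup>2 = ((real m')\<^sup>2 - (real m)\<^sup>2) / b\<^sup>2"
    by (simp add: diff_divide_distrib)
  have uv: "real_of_int u / a\<^sup>2 = real_of_int v / b\<^sup>2"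
    using arg_cong[OF rel, of abs] by (simp add: u_def v_def abs_divide)
  \<comment> \<open>If \<open>v\<close> vanished, so would \<open>u\<close>, and the two modes would
    be the same.\<close>
  have "v \<noteq> 0"
  proof
    assume "v = 0"
    hence "u = 0" using uv ab by simp
    have "n = n'" "m = m'"
      using \<open>u = 0\<close> \<open>v = 0\<close> by (simp_all add: u_def v_def power2_eq_iff_nonneg)
    thus False using ne by simp
  qed
  moreover have "v \<ge> 0" by (simp add: v_def)
  ultimately have v: "v \<ge> 1" by linarith
  \<comment> \<open>The common unit of all energies; the 4 comes from (s + 1/2)^2 = (2s +
    1)^2/4.\<close>
  define \<kappa> where "\<kappa> = pi\<^sup>2 / (4 * a\<^sup>2 * real_of_int v)"
  have \<kappa>: "\<kappa> > 0" using ab v by (simp add: \<kappa>_def)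
  have b2: "1 / b\<^sup>2 = real_of_int u / (a\<^sup>2 * real_of_int v)"
    using uv v ab by (simp add: field_simps)
  have int: "energy a b s t = \<kappa> * real_of_int (v * (2 * int s + 1)\<^sup>2 + u * (2 * int t + 1)\<^sup>2)" for s t
  proof -
    have sq: "(real r + 1/2)\<^sup>2 = (2 * real r + 1)\<^sup>2 / 4" for r
      by (simp add: power2_eq_square algebra_simps)
    have "energy a b s t = pi\<^sup>2 * ((2 * real s + 1)\<^sup>2 / 4 * (1 / a\<^sup>2) + (2 * real t + 1)\<^sup>2 / 4 * (1 / b\<^sup>2))"
      unfolding energy_def sq by simp
    also have "\<dots> = \<kappa> * (real_of_int v * (2 * real s + 1)\<^sup>2 + real_of_int u * (2 * real t + 1)\<^sup>2)"
      unfolding b2 \<kappa>_def using v ab by (simp add: field_simps)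
    finally show ?thesis by simp
  qed
  have "\<kappa> \<le> energy a b s' t' - energy a b s t" if "energy a b s t < energy a b s' t'" for s t s' t'
  proof -
    define i where "i = v * (2 * int s + 1)\<^sup>2 + u * (2 * int t + 1)\<^sup>2"
    define j where "j = v * (2 * int s' + 1)\<^sup>2 + u * (2 * int t' + 1)\<^sup>2"
    have "real_of_int i < real_of_int j"
      using that \<kappa> unfolding int i_def[symmetric] j_def[symmetric] by simp
    hence "i + 1 \<le> j" by simp
    hence "real_of_int (i + 1) \<le> real_of_int j" by (simp only: of_int_le_iff)
    hence "1 \<le> real_of_int j - real_of_int i" by simp
    from mult_left_mono[OF this less_imp_le[OF \<kappa>]] show ?thesis
      unfolding int i_def[symmetric] j_def[symmetric] by (simp add: right_diff_distrib)
  qed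
  thus ?thesis using \<kappa> by blast
qed

text \<open>When no two modes share an energy, each eigenspace is a line and normalisation leaves
  only a sign. A listing without repetition is then a bijection onto the pairs of quantum
  numbers.\<close>

lemma eigen_listing_simple:
  assumes ab: "a > 0" "b > 0" and listing: "eigen_listing a b E \<Phi>"
    and inj: "\<And>n m n' m'. mode_energy a b (n, m) = mode_energy a b (n', m') \<Longrightarrow> (n, m) = (n', m')"
  shows "\<exists>S T sg. rectangle_spectrum a b E \<Phi> S T sg"
proof -
  have mono: "strict_mono E" and range: "range E = {energy a b s t | s t. True}"
    and basis: "\<And>j. \<exists>B. orthonormal_basis (rect a b) (eigenspace a b (E j)) B \<and> {u \<in> B. u (a, b) \<noteq> 0} = {\<Phi> j}"
    using listing by (auto simp: eigen_listing_def)
  define P where "P j s t c \<longleftrightarrow> E j = energy a b s t \<and> (c = 1 \<or> c = -1) \<and>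
      (\<forall>x. \<Phi> j x = c * sine_mode a b (2 * s + 1, 2 * t + 1) x)" for j s t c
  have "\<exists>s t c. P j s t c" for j
  proof -
    have "E j \<in> {energy a b s t | s t. True}" using range by blast
    then obtain s t where st: "E j = energy a b s t" by blast
    define k where "k = (2 * s + 1, 2 * t + 1)"
    have "{(n, m). n \<ge> 1 \<and> m \<ge> 1 \<and> mode_energy a b (n, m) = E j} = {k}"
      using inj unfolding st mode_energy_odd[symmetric] k_def by force
    hence eigenspace: "eigenspace a b (E j) = {\<lambda>x. c k * sine_mode a b k x | c. True}"
      by (simp add: eigenspace_def)
    obtain B where B: "orthonormal_basis (rect a b) (eigenspace a b (E j)) B" "{u \<in> B. u (a, b) \<noteq> 0} = {\<Phi> j}"
      using basis by blast
    have mem: "\<Phi> j \<in> B" and fin: "finite B" using B by (auto simp: orthonormal_basis_def)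
    have "\<Phi> j = (\<lambda>x. \<Sum>u\<in>B. (if u = \<Phi> j then 1 else 0) * u x)"
    proof (rule ext)
      fix x
      have "(\<Sum>u\<in>B. (if u = \<Phi> j then 1 else 0) * u x) = (\<Sum>u\<in>B. if u = \<Phi> j then u x else 0)"
        by (intro sum.cong) auto
      thus "\<Phi> j x = (\<Sum>u\<in>B. (if u = \<Phi> j then 1 else 0) * u x)" using mem fin by simp
    qed
    hence "\<Phi> j \<in> {\<lambda>x. \<Sum>u\<in>B. c u * u x | c. True}"
      unfolding mem_Collect_eq by (intro exI[of _ "\<lambda>u. if u = \<Phi> j then 1 else 0"] conjI TrueI)
    hence "\<Phi> j \<in> eigenspace a b (E j)" using B(1) by (simp add: orthonormal_basis_def)
    then obtain c where c: "\<Phi> j = (\<lambda>x. c * sine_mode a b k x)" unfolding eigenspace by blast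
    have "(LINT x|lebesgue_on (rect a b). \<Phi> j x * \<Phi> j x) = 1"
      using B(1) mem by (simp add: orthonormal_basis_def)
    also have "(LINT x|lebesgue_on (rect a b). \<Phi> j x * \<Phi> j x)
        = (LINT x|lebesgue_on (rect a b). (c * c) * (sine_mode a b k x * sine_mode a b k x))"
      by (simp only: c mult_ac)
    also have "\<dots> = (c * c) * (LINT x|lebesgue_on (rect a b). sine_mode a b k x * sine_mode a b k x)"
      by (rule integral_mult_right_zero)
    also have "(LINT x|lebesgue_on (rect a b). sine_mode a b k x * sine_mode a b k x) = 1"
      using sine_mode_orthonormal[OF ab, of k k] by (simp add: k_def)
    finally have "c = 1 \<or> c = -1" by (simp add: square_eq_1_iff)
    hence "P j s t c" using st c by (simp add: P_def k_def)
    thus ?thesis by blast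
  qed
  then obtain S T sg where "\<And>j. P j (S j) (T j) (sg j)" by metis
  hence ST: "\<And>j. E j = energy a b (S j) (T j)" "\<And>j. sg j = 1 \<or> sg j = -1"
    "\<And>j x. \<Phi> j x = sg j * sine_mode a b (2 * S j + 1, 2 * T j + 1) x"
    unfolding P_def by blast+
  have "bij (\<lambda>j. (S j, T j))"
  proof (rule bijI)
    show "inj (\<lambda>j. (S j, T j))"
    proof (rule injI)
      fix i j assume "(S i, T i) = (S j, T j)"
      hence "E i = E j" by (simp add: ST(1))
      thus "i = j" using mono by (simp add: strict_mono_eq)
    qed
    show "surj (\<lambda>j. (S j, T j))"
    proof -
      have "\<exists>j. (s, t) = (S j, T j)" for s t
      proof -
        have "energy a b s t \<in> range E" using range by blast
        then obtain j where j: "energy a b s t = E j" by blast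
        have "mode_energy a b (2 * s + 1, 2 * t + 1) = mode_energy a b (2 * S j + 1, 2 * T j + 1)"
          unfolding mode_energy_odd ST(1)[symmetric] by (rule j)
        from inj[OF this] show ?thesis by (intro exI[of _ j]) simp
      qed
      thus ?thesis unfolding surj_def by (metis surj_pair)
    qed
  qed
  hence "rectangle_spectrum a b E \<Phi> S T sg"
    using ab mono ST by unfold_locales auto
  thus ?thesis by blast
qed


section \<open>The subsequence of superpositions\<close>

text \<open>The index sequence tends to infinity but may oscillate or repeat on the way; a greedy
  choice makes it strictly increasing.\<close>

lemma strict_mono_subsequence:
  fixes k :: "nat \<Rightarrow> nat"
  assumes "filterlim k at_top sequentially"
  shows "\<exists>r::nat \<Rightarrow> nat. strict_mono r \<and> strict_mono (\<lambda>n. k (r n))"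
proof -
  have "\<exists>r. \<forall>n::nat. True \<and> (r n < r (Suc n) \<and> k (r n) < k (r (Suc n)))"
  proof (rule dependent_nat_choice)
    fix x n :: nat
    have "\<forall>\<^sub>F y in sequentially. Suc (k x) \<le> k y"
      using assms unfolding filterlim_at_top by blast
    hence "\<forall>\<^sub>F y in sequentially. x < y \<and> k x < k y"
      using eventually_gt_at_top[of x] by eventually_elim simp
    thus "\<exists>y. True \<and> x < y \<and> k x < k y" by (auto simp: eventually_sequentially)
  qed simp
  then obtain r where r: "\<And>n. r n < r (Suc n)" "\<And>n. k (r n) < k (r (Suc n))" by blast
  show ?thesis by (intro exI[of _ r] conjI) (simp_all add: strict_mono_Suc_iff r)
qed

text \<open>The finitely many gaps at indices below \<open>M\<close> have a positive minimum, so a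
  gap smaller than that lies further out.\<close>

lemma gap_tendsto_0_imp_index_at_top:
  fixes E :: "nat \<Rightarrow> real"
  assumes E: "strict_mono E" and gap: "(\<lambda>n. E (k n + 2) - E (k n + 1)) \<longlonglongrightarrow> 0"
  shows "filterlim k at_top sequentially"
  unfolding filterlim_at_top
proof
  fix M :: nat
  \<comment> \<open>The inserted 1 keeps the set nonempty when \<open>M = 0\<close>.\<close>
  define g where "g = Min (insert 1 ((\<lambda>i. E (i + 2) - E (i + 1)) ` {..<M}))"
  have "g > 0" unfolding g_def using E by (subst Min_gr_iff) (auto simp: strict_mono_less)
  from order_tendstoD(2)[OF gap this]
  show "\<forall>\<^sub>F n in sequentially. M \<le> k n"
  proof (rule eventually_mono)
    fix n assume less: "E (k n + 2) - E (k n + 1) < g"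
    show "M \<le> k n"
    proof (rule ccontr)
      assume "\<not> M \<le> k n"
      hence "g \<le> E (k n + 2) - E (k n + 1)" unfolding g_def by (intro Min_le) auto
      thus False using less by simp
    qed
  qed
qed

lemma vinogradov_tendsto_0:
  assumes "f \<lless> g" "g \<longlonglongrightarrow> 0" "\<And>n. 0 \<le> f n"
  shows "f \<longlonglongrightarrow> 0"
proof -
  obtain C where C: "\<forall>\<^sub>F n in sequentially. f n \<le> C * g n"
    using assms(1) unfolding vinogradov_def by blast
  have "(\<lambda>n. C * g n) \<longlonglongrightarrow> C * 0" by (intro tendsto_mult tendsto_const assms(2))
  hence "(\<lambda>n. C * g n) \<longlonglongrightarrow> 0" by simp
  note lim = this
  show ?thesis
  proof (rule tendsto_sandwich)
    show "\<forall>\<^sub>F n in sequentially. 0 \<le> f n" by (simp add: assms(3))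
    show "\<forall>\<^sub>F n in sequentially. f n \<le> C * g n" by (rule C)
    show "(\<lambda>n. C * g n) \<longlonglongrightarrow> 0" by (rule lim)
  qed (rule tendsto_const)
qed

context rectangle_spectrum
begin

text \<open>With x = O(\<epsilon>^(-\<rho>)) and \<delta> a multiple of \<epsilon>^q, the sum of the
  other secular terms is O(\<epsilon>^(-\<rho>/2-q)). Multiplied by the gap O(\<epsilon>) this gives
  a distance O(\<epsilon>^\<alpha>), where \<alpha> = 1 - \<rho>/2 - q is positive by the assumption
  on \<rho>.\<close>

lemma close_pair_superposition:
  fixes q \<rho> :: real and \<epsilon> :: "nat \<Rightarrow> real" and k :: "nat \<Rightarrow> nat"
  assumes q: "0 < q" "q < 1/2" and \<rho>: "1 < \<rho>" "\<rho> < 2 * (1 - q)"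
    and \<epsilon>: "\<And>n. \<epsilon> n > 0" "\<epsilon> \<longlonglongrightarrow> 0"
    and top: "(\<lambda>n. E (k n + 3)) \<lless> (\<lambda>n. \<epsilon> n powr (- \<rho>))"
    and close: "(\<lambda>n. E (k n + 2) - E (k n + 1)) \<lless> \<epsilon>"
    and above: "(\<lambda>n. \<epsilon> n powr q) \<lless> (\<lambda>n. E (k n + 3) - E (k n + 2))"
    and below: "(\<lambda>n. \<epsilon> n powr q) \<lless> (\<lambda>n. E (k n + 1) - E (k n))"
    and pair: "\<And>i. is_eigenpair i (\<mu> i) (\<phi> i)"
  shows "(\<lambda>n. L2_norm \<Omega> (\<lambda>z. \<phi> (k n + 1) z - pair_superposition (k n + 1) z)) \<longlonglongrightarrow> 0"
proof -
  \<comment> \<open>This choice turns x^(1/2+\<theta>) and sqrt x/\<delta> into the same power of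
    \<epsilon>.\<close>
  define \<theta> where "\<theta> = q / \<rho>"
  have \<theta>: "0 < \<theta>" "\<theta> \<le> 1" "\<rho> * \<theta> = q" using q \<rho> by (auto simp: \<theta>_def)
  obtain K where K: "K > 0" "\<And>x \<delta> F. E 0 \<le> x \<Longrightarrow> 0 < \<delta> \<Longrightarrow> \<delta> \<le> 1 \<Longrightarrow> finite F \<Longrightarrow>
      (\<And>j. j \<in> F \<Longrightarrow> \<delta> \<le> \<bar>E j - x\<bar>) \<Longrightarrow>
      (\<Sum>j\<in>F. \<bar>secular_term j x\<bar>) \<le> K * (x powr (1/2 + \<theta>) + sqrt x / \<delta>)"
    using secular_sum_bound[OF \<theta>(1,2)] by blast
  obtain C where C: "C > 0" "\<And>i x \<phi> D. is_eigenpair i x \<phi> \<Longrightarrow>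
      (\<And>F. finite F \<Longrightarrow> i \<notin> F \<Longrightarrow> Suc i \<notin> F \<Longrightarrow> (\<Sum>j\<in>F. \<bar>secular_term j x\<bar>) \<le> D) \<Longrightarrow>
      L2_norm \<Omega> (\<lambda>z. \<phi> z - pair_superposition i z) \<le> C * ((1 + D) * (E (Suc i) - E i))"
    using eigenpair_distance_le by blast
  obtain C1 where C1: "C1 > 0" "\<forall>\<^sub>F n in sequentially. E (k n + 3) \<le> C1 * \<epsilon> n powr (- \<rho>)"
    using top unfolding vinogradov_def by blast
  obtain C2 where C2: "C2 > 0" "\<forall>\<^sub>F n in sequentially. E (k n + 2) - E (k n + 1) \<le> C2 * \<epsilon> n"
    using close unfolding vinogradov_def by blast
  obtain C3 where C3: "C3 > 0" "\<forall>\<^sub>F n in sequentially. \<epsilon> n powr q \<le> C3 * (E (k n + 3) - E (k n + 2))"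
    using above unfolding vinogradov_def by blast
  obtain C4 where C4: "C4 > 0" "\<forall>\<^sub>F n in sequentially. \<epsilon> n powr q \<le> C4 * (E (k n + 1) - E (k n))"
    using below unfolding vinogradov_def by blast
  \<comment> \<open>Small enough for \<open>c * \<epsilon> n powr q\<close> to stay below both
    neighbouring gaps and, once \<epsilon> < 1, below 1.\<close>
  define c where "c = 1 / (1 + C3 + C4)"
  have c: "0 < c" "c \<le> 1" "c * C3 \<le> 1" "c * C4 \<le> 1"
    using C3(1) C4(1) by (auto simp: c_def divide_le_eq)
  define \<alpha> where "\<alpha> = 1 - \<rho> / 2 - q"
  have \<alpha>: "\<alpha> > 0" using \<rho> by (simp add: \<alpha>_def)
  define A where "A = C * ((1 + K * (C1 powr (1/2 + \<theta>) + sqrt C1 / c)) * C2)"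
  have \<epsilon>1: "\<forall>\<^sub>F n in sequentially. \<epsilon> n < 1" using order_tendstoD(2)[OF \<epsilon>(2), of 1] by simp
  have le: "\<forall>\<^sub>F n in sequentially. L2_norm \<Omega> (\<lambda>z. \<phi> (k n + 1) z - pair_superposition (k n + 1) z)
      \<le> A * \<epsilon> n powr \<alpha>"
    using C1(2) C2(2) C3(2) C4(2) \<epsilon>1
  proof eventually_elim
    case (elim n)
    define i where "i = k n + 1"
    define x where "x = \<mu> i"
    define e where "e = \<epsilon> n"
    define \<delta> where "\<delta> = c * e powr q"
    have e: "0 < e" "e < 1" using \<epsilon>(1)[of n] elim by (simp_all add: e_def)
    have x: "E i < x" "x < E (Suc i)" using pair[of i] by (simp_all add: is_eigenpair_def x_def)
    have Ei: "E i = E (k n + 1)" "E (Suc i) = E (k n + 2)" by (simp_all add: i_def)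
    have eq1: "e powr q \<le> 1" using e q powr_mono2[of q e 1] by simp
    have \<delta>: "0 < \<delta>" "\<delta> \<le> 1"
      using c e eq1 mult_mono[of c 1 "e powr q" 1] by (simp_all add: \<delta>_def)
    have \<delta>_above: "\<delta> \<le> E (k n + 3) - E (k n + 2)"
    proof -
      have "\<delta> \<le> c * (C3 * (E (k n + 3) - E (k n + 2)))"
        unfolding \<delta>_def e_def using c elim by (intro mult_left_mono) auto
      also have "\<dots> = (c * C3) * (E (k n + 3) - E (k n + 2))" by simp
      also have "\<dots> \<le> 1 * (E (k n + 3) - E (k n + 2))"
        using c E_le[of "k n + 2" "k n + 3"] by (intro mult_right_mono) auto
      finally show ?thesis by simp
    qed
    have \<delta>_below: "\<delta> \<le> E (k n + 1) - E (k n)"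
    proof -
      have "\<delta> \<le> c * (C4 * (E (k n + 1) - E (k n)))"
        unfolding \<delta>_def e_def using c elim by (intro mult_left_mono) auto
      also have "\<dots> = (c * C4) * (E (k n + 1) - E (k n))" by simp
      also have "\<dots> \<le> 1 * (E (k n + 1) - E (k n))"
        using c E_le[of "k n" "k n + 1"] by (intro mult_right_mono) auto
      finally show ?thesis by simp
    qed
    \<comment> \<open>\<open>x\<close> lies between the two close eigenvalues, so any other
      eigenvalue is separated from it by at least one of the two outer gaps.\<close>
    have away: "\<delta> \<le> \<bar>E j - x\<bar>" if "j \<noteq> i" "j \<noteq> Suc i" for j
    proof (cases "j \<le> k n")
      case True
      thus ?thesis using E_le[OF True] \<delta>_below x Ei by linarith
    next
      case False
      hence "k n + 3 \<le> j" using that by (simp add: i_def)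
      from E_le[OF this] show ?thesis using \<delta>_above x Ei by linarith
    qed
    define D where "D = K * (x powr (1/2 + \<theta>) + sqrt x / \<delta>)"
    have x0: "E 0 \<le> x" "0 < x" using x E_le[of 0 i] E_pos[of 0] by linarith+
    have "L2_norm \<Omega> (\<lambda>z. \<phi> i z - pair_superposition i z) \<le> C * ((1 + D) * (E (Suc i) - E i))"
    proof (rule C(2)[OF pair])
      fix F assume F: "finite F" "i \<notin> F" "Suc i \<notin> F"
      have "(\<Sum>j\<in>F. \<bar>secular_term j x\<bar>) \<le> D"
        unfolding D_def
      proof (rule K(2)[OF x0(1) \<delta> F(1)])
        fix j assume "j \<in> F"
        thus "\<delta> \<le> \<bar>E j - x\<bar>" using F by (intro away) auto
      qed
      thus "(\<Sum>j\<in>F. \<bar>secular_term j (\<mu> i)\<bar>) \<le> D" by (simp add: x_def)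
    qed
    also have "\<dots> \<le> C * (((1 + K * (C1 powr (1/2 + \<theta>) + sqrt C1 / c)) * e powr (- \<rho> / 2 - q)) * (C2 * e))"
    proof (intro mult_left_mono mult_mono)
      have xe: "x \<le> C1 * e powr (- \<rho>)"
        using x Ei E_le[of "k n + 2" "k n + 3"] elim(1) by (simp add: e_def)
      have "x powr (1/2 + \<theta>) \<le> (C1 * e powr (- \<rho>)) powr (1/2 + \<theta>)"
        using xe x0 \<theta> by (intro powr_mono2) auto
      also have "\<dots> = C1 powr (1/2 + \<theta>) * e powr (- \<rho> * (1/2 + \<theta>))"
        using C1(1) e by (simp add: powr_mult powr_powr)
      also have "- \<rho> * (1/2 + \<theta>) = - \<rho> / 2 - q" using \<theta>(3) by (simp add: algebra_simps)
      finally have t1: "x powr (1/2 + \<theta>) \<le> C1 powr (1/2 + \<theta>) * e powr (- \<rho> / 2 - q)" .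
      have "sqrt x \<le> sqrt (C1 * e powr (- \<rho>))" using xe by (rule real_sqrt_le_mono)
      also have "\<dots> = sqrt C1 * e powr (- \<rho> / 2)"
        using e by (simp add: real_sqrt_mult powr_half_sqrt[symmetric] powr_powr)
      finally have "sqrt x / \<delta> \<le> sqrt C1 * e powr (- \<rho> / 2) / \<delta>"
        using \<delta> by (intro divide_right_mono) auto
      also have "\<dots> = sqrt C1 / c * (e powr (- \<rho> / 2) / e powr q)" by (simp add: \<delta>_def)
      also have "e powr (- \<rho> / 2) / e powr q = e powr (- \<rho> / 2 - q)" by (simp add: powr_diff)
      finally have t2: "sqrt x / \<delta> \<le> sqrt C1 / c * e powr (- \<rho> / 2 - q)" .
      \<comment> \<open>The exponent is negative and e < 1, so the summand 1 in \<open>1 + D\<close>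
        is absorbed by the same power.\<close>
      have "e powr 0 \<le> e powr (- \<rho> / 2 - q)"
        using e q \<rho> by (intro powr_mono') auto
      hence t0: "1 \<le> e powr (- \<rho> / 2 - q)" using e by simp
      have "D \<le> K * (C1 powr (1/2 + \<theta>) * e powr (- \<rho> / 2 - q) + sqrt C1 / c * e powr (- \<rho> / 2 - q))"
        unfolding D_def using K(1) t1 t2 by (intro mult_left_mono add_mono) auto
      thus "1 + D \<le> (1 + K * (C1 powr (1/2 + \<theta>) + sqrt C1 / c)) * e powr (- \<rho> / 2 - q)"
        using t0 by (simp add: algebra_simps)
      show "E (Suc i) - E i \<le> C2 * e" using elim(2) unfolding Ei e_def .
      have "0 \<le> K * (C1 powr (1/2 + \<theta>) + sqrt C1 / c)"
        using K(1) C1(1) c by (intro mult_nonneg_nonneg add_nonneg_nonneg divide_nonneg_nonneg) auto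
      thus "0 \<le> (1 + K * (C1 powr (1/2 + \<theta>) + sqrt C1 / c)) * e powr (- \<rho> / 2 - q)" by simp
    qed (use C x in auto)
    also have "\<dots> = A * (e powr (- \<rho> / 2 - q) * e powr 1)" using e by (simp add: A_def)
    also have "- \<rho> / 2 - q + 1 = \<alpha>" by (simp add: \<alpha>_def)
    hence "e powr (- \<rho> / 2 - q) * e powr 1 = e powr \<alpha>" by (simp only: powr_add[symmetric])
    finally show ?case by (simp add: i_def e_def)
  qed
  have "(\<lambda>n. \<epsilon> n powr \<alpha>) \<longlonglongrightarrow> 0"
    by (rule tendsto_zero_powrI[OF \<epsilon>(2) tendsto_const _ \<alpha>]) (simp add: less_imp_le[OF \<epsilon>(1)])
  from tendsto_mult[OF tendsto_const this, of A]
  have lim: "(\<lambda>n. A * \<epsilon> n powr \<alpha>) \<longlonglongrightarrow> 0" by simp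
  show ?thesis
  proof (rule tendsto_sandwich[OF _ le tendsto_const lim])
    show "\<forall>\<^sub>F n in sequentially. 0 \<le> L2_norm \<Omega> (\<lambda>z. \<phi> (k n + 1) z - pair_superposition (k n + 1) z)"
      by (simp add: L2_norm_nonneg)
  qed
qed

end

theorem mainTheorem5:
  fixes a b q \<rho> :: real
    and E \<epsilon> :: "nat \<Rightarrow> real"
    and \<Phi> :: "nat \<Rightarrow> real \<times> real \<Rightarrow> real"
    and k :: "nat \<Rightarrow> nat"
  assumes "a > 0" and "b > 0"
    and "eigen_listing a b E \<Phi>"
    and "0 < q" and "q < 1/2" and "1 < \<rho>" and "\<rho> < 2 * (1 - q)"
    and "\<And>n. \<epsilon> n > 0" and "decseq \<epsilon>" and "\<epsilon> \<longlonglongrightarrow> 0"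
    \<comment> \<open>the four consecutive eigenvalues are \<open>E (k n), \<dots>, E (k n + 3)\<close>\<close>
    and "(\<lambda>n. E (k n + 3)) \<lless> (\<lambda>n. \<epsilon> n powr (- \<rho>))"
    and "(\<lambda>n. E (k n + 2) - E (k n + 1)) \<lless> \<epsilon>"
    and "(\<lambda>n. \<epsilon> n powr q) \<lless> (\<lambda>n. E (k n + 3) - E (k n + 2))"
    and "(\<lambda>n. \<epsilon> n powr q) \<lless> (\<lambda>n. E (k n + 1) - E (k n))"
  shows "\<exists>(\<phi> :: nat \<Rightarrow> wavefun) (\<mu> :: nat \<Rightarrow> real) (j :: nat \<Rightarrow> nat) (\<beta> :: nat \<Rightarrow> nat) (h :: real \<Rightarrow> nat).
      (\<forall>i. normalised_eigenfunction (rect a b) (H_pi a b E \<Phi>) (\<mu> i) (\<phi> i) \<and>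
           E i < \<mu> i \<and> \<mu> i < E (i + 1)) \<and>
      strict_mono j \<and>
      (\<forall>n. \<beta> n \<in> {0, 1} \<and> \<beta> n = h (sgn (\<Phi> (j n) (a, b) * \<Phi> (j n + 1) (a, b)))) \<and>
      (\<lambda>n. L2_norm (rect a b) (\<lambda>x. \<phi> (j n) x -
          of_real (1 / sqrt 2 * (\<Phi> (j n) x + (-1) ^ \<beta> n * \<Phi> (j n + 1) x)))) \<longlonglongrightarrow> 0"
proof -
  have mono: "strict_mono E" and range: "range E = {energy a b s t | s t. True}"
    using assms(3) by (auto simp: eigen_listing_def)
  have gap0: "(\<lambda>n. E (k n + 2) - E (k n + 1)) \<longlonglongrightarrow> 0"
    by (rule vinogradov_tendsto_0[OF assms(12,10)]) (use mono in \<open>simp add: strict_mono_less_eq\<close>)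
  \<comment> \<open>All modes are compared, those with even indices too, because
    \<open>eigenspace\<close> is spanned by every mode of the given energy. A coincidence would
    bound the vanishing gaps below by \<kappa>.\<close>
  have "(n, m) = (n', m')" if eq: "mode_energy a b (n, m) = mode_energy a b (n', m')" for n m n' m'
  proof (rule ccontr)
    assume "(n, m) \<noteq> (n', m')"
    from coincidence_imp_gap[OF assms(1,2) eq this] obtain \<kappa> where \<kappa>: "\<kappa> > 0"
      "\<And>s t s' t'. energy a b s t < energy a b s' t' \<Longrightarrow> \<kappa> \<le> energy a b s' t' - energy a b s t"
      by blast
    have en: "\<exists>s t. E i = energy a b s t" for i using range by blast
    have "\<kappa> \<le> E (k n + 2) - E (k n + 1)" for n
    proof -
      obtain s t s' t' where "E (k n + 1) = energy a b s t" "E (k n + 2) = energy a b s' t'"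
        using en[of "k n + 1"] en[of "k n + 2"] by blast
      moreover have "E (k n + 1) < E (k n + 2)" using mono by (simp add: strict_mono_less)
      ultimately show ?thesis using \<kappa>(2) by simp
    qed
    hence "\<kappa> \<le> 0" using LIMSEQ_le_const[OF gap0] by blast
    thus False using \<kappa>(1) by simp
  qed
  from eigen_listing_simple[OF assms(1-3) this] obtain S T sg
    where "rectangle_spectrum a b E \<Phi> S T sg" by blast
  then interpret rectangle_spectrum a b E \<Phi> S T sg .
  obtain \<mu> \<phi> where pair: "\<And>i. is_eigenpair i (\<mu> i) (\<phi> i)"
    using eigenpair_exists by metis
  have lim: "(\<lambda>n. L2_norm \<Omega> (\<lambda>z. \<phi> (k n + 1) z - pair_superposition (k n + 1) z)) \<longlonglongrightarrow> 0"
    by (rule close_pair_superposition[OF assms(4-8,10-14) pair])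
  obtain r :: "nat \<Rightarrow> nat" where r: "strict_mono r" "strict_mono (\<lambda>n. k (r n))"
    using strict_mono_subsequence[OF gap_tendsto_0_imp_index_at_top[OF mono gap0]] by blast
  \<comment> \<open>The index of the lower member of the close pair, the second of the four
    consecutive eigenvalues.\<close>
  define j where "j n = k (r n) + 1" for n
  \<comment> \<open>Equal signs at the centre give 1, hence the difference; opposite signs give 0,
    hence the sum. The sign is never 0, since no \<Phi>_j vanishes at the centre.\<close>
  define h :: "real \<Rightarrow> nat" where "h y = (if y > 0 then 1 else 0)" for y
  define \<beta> where "\<beta> n = h (sgn (\<Phi>p (j n) * \<Phi>p (j n + 1)))" for n
  have "(-1) ^ \<beta> n = - sgn (\<Phi>p (j n) * \<Phi>p (Suc (j n)))" for n
    using \<Phi>p_nz[of "j n"] \<Phi>p_nz[of "Suc (j n)"] by (auto simp: \<beta>_def h_def sgn_if)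
  hence sup: "of_real (1 / sqrt 2 * (\<Phi> (j n) x + (-1) ^ \<beta> n * \<Phi> (j n + 1) x)) = pair_superposition (j n) x" for n x
    by (simp add: pair_superposition_def)
  have "(\<lambda>n. L2_norm \<Omega> (\<lambda>x. \<phi> (j n) x -
      of_real (1 / sqrt 2 * (\<Phi> (j n) x + (-1) ^ \<beta> n * \<Phi> (j n + 1) x)))) \<longlonglongrightarrow> 0"
    unfolding sup using LIMSEQ_subseq_LIMSEQ[OF lim r(1)] by (simp add: o_def j_def)
  moreover have "strict_mono j" using r(2) by (simp add: strict_mono_def j_def)
  moreover have "\<forall>i. normalised_eigenfunction \<Omega> (H_pi a b E \<Phi>) (\<mu> i) (\<phi> i) \<and> E i < \<mu> i \<and> \<mu> i < E (i + 1)"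
    using pair by (simp add: is_eigenpair_def)
  moreover have "\<forall>n. \<beta> n \<in> {0, 1} \<and> \<beta> n = h (sgn (\<Phi>p (j n) * \<Phi>p (j n + 1)))"
    by (simp add: \<beta>_def h_def)
  ultimately show ?thesis
    by (intro exI[of _ \<phi>] exI[of _ \<mu>] exI[of _ j] exI[of _ \<beta>] exI[of _ h] conjI)
qed

end
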